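(* Let $0\le\rho<\rho^*$. When the symmetrized jump probability $s(\cdot)$, $s(z)=\frac12(p(z)+p(-z))$, is irreducible on $\mathbb{Z}^d$, the invariant measure $\nu_\rho$ of the zero-range process on $\mathbb{Z}^d$ is extremal: if $0<\epsilon<1$ and $Q_1,Q_2$ are invariant probability measures with $\nu_\rho=\epsilon Q_1+(1-\epsilon)Q_2$, then $Q_1=Q_2=\nu_\rho$.
   Context: $\mathbb{N}_0=\{0,1,2,\ldots\}$. The rate $g:\mathbb{N}_0\to[0,\infty)$ satisfies $g(0)=0$, $g(k)>0$ for $k\ge1$, and $\sup_{k\ge0}|g(k+1)-g(k)|\le a_0<\infty$. $p(x,y)=p(y-x)$ is a translation-invariant, irreducible transition probability on $\mathbb{Z}^d$, not necessarily finite-range; $p^{(n)}$ is the $n$-step probability. Set $\beta(x)=\sum_{n\ge0}2^{-n}p^{(n)}(x,0)$, $\|\eta-\zeta\|=\sum_x|\eta(x)-\zeta(x)|\beta(x)$, $\Omega'=\{\eta\in\mathbb{N}_0^{\mathbb{Z}^d}:\sum_x\eta(x)\beta(x)<\infty\}$; $\mathcal{L}$ is the set of $f:\Omega'\to\mathbb{R}$ that are Lipschitz for $\|\cdot\|$, with smallest Lipschitz constant $c(f)$. $Lf(\eta)=\sum_{x,y}p(y)g(\eta(x))[f(\eta^{x,x+y})-f(\eta)]$, $\eta^{x,z}$ being $\eta$ with one particle moved from $x$ to $z$. $(P_t)$ is the zero-range semigroup on $\mathcal{L}$: the unique semigroup of linear operators on $\mathcal{L}$ with $P_tf(\eta)=E^\eta[f(\eta_t)]$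 for $\eta$ with finitely many particles ($\eta_t$ the countable-state Markov chain with generator $L$) and $c(P_tf)\le c(f)e^{4a_0t}$. For $0\le\psi<\liminf_kg(k)$ let $\kappa_\psi(k)=Z(\psi)^{-1}\psi^k/(g(1)\cdots g(k))$ on $\mathbb{N}_0$ (empty product $1$), $\rho(\psi)$ its mean, $\Psi$ the inverse of $\rho(\cdot)$, $\rho^*=\lim_{\psi\uparrow\liminf g(k)}\rho(\psi)$, and $\nu_\rho=\prod_{x\in\mathbb{Z}^d}\kappa_{\Psi(\rho)}$; $\nu_\rho(\Omega')=1$ and $\nu_\rho$ is invariant. One has $\mathcal{L}\subset L^2(\nu_\rho)$, and $P_t$ extends by continuity to a Markov semigroup $P_t^\rho$ on $L^2(\nu_\rho)$. "Invariant" for a probability measure $Q$ means $\int P^\rho_tf\,dQ=\int f\,dQ$ for all bounded measurable $f$ and $t\ge0$ (in a decomposition as in the claim, $Q_1,Q_2$ are absolutely continuous with respect to $\nu_\rho$, so this is meaningful). *)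

theory Defs
  imports "HOL-Probability.Probability"
begin

type_synonym 'd site = "int ^ 'd"
type_synonym 'd config = "int ^ 'd \<Rightarrow> nat"
type_synonym 'd observable = "(int ^ 'd \<Rightarrow> nat) \<Rightarrow> real"


section \<open>Random walk kernels\<close>

definition jump_law :: "('d::finite site \<Rightarrow> real) \<Rightarrow> bool" where
  "jump_law p \<longleftrightarrow> (\<forall>z. 0 \<le> p z) \<and> (p has_sum 1) UNIV"

primrec nstep :: "('d::finite site \<Rightarrow> real) \<Rightarrow> nat \<Rightarrow> 'd site \<Rightarrow> 'd site \<Rightarrow> real" where
  "nstep p 0 x y = of_bool (x = y)"
| "nstep p (Suc n) x y = (\<Sum>\<^sub>\<infinity>z. p (z - x) * nstep p n z y)"

definition irreducible_walk :: "('d::finite site \<Rightarrow> real) \<Rightarrow> bool" where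
  "irreducible_walk p \<longleftrightarrow> (\<forall>x y. \<exists>n. 0 < nstep p n x y)"

definition symmetrized :: "('d::finite site \<Rightarrow> real) \<Rightarrow> 'd site \<Rightarrow> real" where
  "symmetrized p z = (p z + p (- z)) / 2"


section \<open>State space and Lipschitz functions\<close>

definition \<beta> :: "('d::finite site \<Rightarrow> real) \<Rightarrow> 'd site \<Rightarrow> real" where
  "\<beta> p x = (\<Sum>n. (1 / 2) ^ n * nstep p n x 0)"

definition config_dist :: "('d::finite site \<Rightarrow> real) \<Rightarrow> 'd config \<Rightarrow> 'd config \<Rightarrow> real" where
  "config_dist p \<eta> \<zeta> = (\<Sum>\<^sub>\<infinity>x. \<bar>real (\<eta> x) - real (\<zeta> x)\<bar> * \<beta> p x)"

definition Omega' :: "('d::finite site \<Rightarrow> real) \<Rightarrow> 'd config set" where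
  "Omega' p = {\<eta>. (\<lambda>x. real (\<eta> x) * \<beta> p x) summable_on UNIV}"

definition lip_bound :: "('d::finite site \<Rightarrow> real) \<Rightarrow> 'd observable \<Rightarrow> real \<Rightarrow> bool" where
  "lip_bound p f C \<longleftrightarrow> 0 \<le> C \<and>
     (\<forall>\<eta>\<in>Omega' p. \<forall>\<zeta>\<in>Omega' p. \<bar>f \<eta> - f \<zeta>\<bar> \<le> C * config_dist p \<eta> \<zeta>)"

text \<open>
  A real function on \<open>Omega' p\<close> is represented by its extension by zero to all configurations.
  This makes the representation unique and the vector space operations pointwise, and the
  representatives of Lipschitz functions are measurable for the product sigma-algebra.
\<close>

definition Lip :: "('d::finite site \<Rightarrow> real) \<Rightarrow> 'd observable set" where
  "Lip p = {f. (\<exists>C. lip_bound p f C) \<and> (\<forall>\<eta>. \<eta> \<notin> Omega' p \<longrightarrow> f \<eta> = 0)}"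

definition lip_const :: "('d::finite site \<Rightarrow> real) \<Rightarrow> 'd observable \<Rightarrow> real" where
  "lip_const p f = Inf {C. lip_bound p f C}"


section \<open>The zero-range dynamics\<close>

text \<open>
  For \<open>\<eta> x = 0\<close> the truncated subtraction gives a meaningless configuration, but then the
  rate \<open>g (\<eta> x)\<close> is zero.
\<close>

definition move :: "'d::finite site \<Rightarrow> 'd site \<Rightarrow> 'd config \<Rightarrow> 'd config" where
  "move x z \<eta> = (let \<eta>' = \<eta>(x := \<eta> x - 1) in \<eta>'(z := \<eta>' z + 1))"

definition generator ::
  "(nat \<Rightarrow> real) \<Rightarrow> ('d::finite site \<Rightarrow> real) \<Rightarrow> 'd observable \<Rightarrow> 'd observable" where
  "generator g p f \<eta> =
     (\<Sum>\<^sub>\<infinity>(x, y). p y * g (\<eta> x) * (f (move x (x + y) \<eta>) - f \<eta>))"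

definition finite_configs :: "'d::finite config set" where
  "finite_configs = {\<eta>. finite {x. \<eta> x \<noteq> 0}}"

text \<open>
  Transition function of the continuous-time chain on the countable set of finite
  configurations: \<open>K t \<eta>\<close> is the law at time \<open>t\<close> of the chain started from \<open>\<eta>\<close>, and the
  transition rate from \<open>\<eta>\<close> to \<open>\<zeta>\<close> is \<open>generator g p (indicator {\<zeta>}) \<eta>\<close>.
  The number of particles \<open>N\<close> is conserved and \<open>g k\<close> is at most \<open>a0 * k\<close>, so the total
  jump rate from \<open>\<eta>\<close> is at most \<open>a0 * N\<close> and these conditions determine \<open>K\<close> on
  \<open>finite_configs\<close> for nonnegative times.
\<close>

definition zero_range_chain ::
  "(nat \<Rightarrow> real) \<Rightarrow> ('d::finite site \<Rightarrow> real) \<Rightarrow> (real \<Rightarrow> 'd config \<Rightarrow> 'd config pmf) \<Rightarrow> bool" where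
  "zero_range_chain g p K \<longleftrightarrow> (\<forall>\<eta>\<in>finite_configs.
     K 0 \<eta> = return_pmf \<eta> \<and>
     (\<forall>t\<ge>0. set_pmf (K t \<eta>) \<subseteq> finite_configs) \<and>
     (\<forall>s\<ge>0. \<forall>t\<ge>0. K (s + t) \<eta> = bind_pmf (K s \<eta>) (K t)) \<and>
     (\<forall>\<zeta>\<in>finite_configs. ((\<lambda>t. pmf (K t \<eta>) \<zeta>) has_real_derivative
        generator g p (indicator {\<zeta>}) \<eta>) (at 0 within {0..})))"

definition zero_range_semigroup ::
  "(nat \<Rightarrow> real) \<Rightarrow> real \<Rightarrow> ('d::finite site \<Rightarrow> real) \<Rightarrow>
     (real \<Rightarrow> 'd observable \<Rightarrow> 'd observable) \<Rightarrow> bool" where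
  "zero_range_semigroup g a0 p P \<longleftrightarrow>
     (\<forall>t\<ge>0. \<forall>f\<in>Lip p. P t f \<in> Lip p) \<and>
     (\<forall>t\<ge>0. \<forall>f\<in>Lip p. \<forall>h\<in>Lip p. \<forall>a b.
        P t (\<lambda>\<eta>. a * f \<eta> + b * h \<eta>) = (\<lambda>\<eta>. a * P t f \<eta> + b * P t h \<eta>)) \<and>
     (\<forall>f\<in>Lip p. P 0 f = f) \<and>
     (\<forall>s\<ge>0. \<forall>t\<ge>0. \<forall>f\<in>Lip p. P (s + t) f = P s (P t f)) \<and>
     (\<exists>K. zero_range_chain g p K \<and>
        (\<forall>t\<ge>0. \<forall>f\<in>Lip p. \<forall>\<eta>\<in>finite_configs.
           P t f \<eta> = measure_pmf.expectation (K t \<eta>) f)) \<and>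
     (\<forall>t\<ge>0. \<forall>f\<in>Lip p. lip_const p (P t f) \<le> lip_const p f * exp (4 * a0 * t))"


section \<open>The product measures\<close>

definition fugacities :: "(nat \<Rightarrow> real) \<Rightarrow> real set" where
  "fugacities g = {\<psi>. 0 \<le> \<psi> \<and> ereal \<psi> < liminf (\<lambda>k. ereal (g k))}"

definition Z :: "(nat \<Rightarrow> real) \<Rightarrow> real \<Rightarrow> real" where
  "Z g \<psi> = (\<Sum>k. \<psi> ^ k / (\<Prod>i=1..k. g i))"

definition \<kappa> :: "(nat \<Rightarrow> real) \<Rightarrow> real \<Rightarrow> nat pmf" where
  "\<kappa> g \<psi> = embed_pmf (\<lambda>k. inverse (Z g \<psi>) * (\<psi> ^ k / (\<Prod>i=1..k. g i)))"

definition density_of :: "(nat \<Rightarrow> real) \<Rightarrow> real \<Rightarrow> real" where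
  "density_of g \<psi> = measure_pmf.expectation (\<kappa> g \<psi>) real"

definition \<Psi> :: "(nat \<Rightarrow> real) \<Rightarrow> real \<Rightarrow> real" where
  "\<Psi> g = the_inv_into (fugacities g) (density_of g)"

text \<open>
  The filter is \<open>\<psi>\<close> increasing to the (possibly infinite) limit inferior of \<open>g\<close>. If that limit
  inferior is 0 there is no admissible \<open>\<psi>\<close>, and the value 0 leaves no density below \<open>rho_star g\<close>.
\<close>

definition rho_star :: "(nat \<Rightarrow> real) \<Rightarrow> ereal" where
  "rho_star g = (if fugacities g = {} then 0
     else Lim (filtercomap ereal (at_left (liminf (\<lambda>k. ereal (g k)))))
            (\<lambda>\<psi>. ereal (density_of g \<psi>)))"

definition \<nu> :: "(nat \<Rightarrow> real) \<Rightarrow> real \<Rightarrow> 'd::finite config measure" where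
  "\<nu> g \<rho> = PiM UNIV (\<lambda>_. measure_pmf (\<kappa> g (\<Psi> g \<rho>)))"


section \<open>The semigroup on square-integrable functions and invariance\<close>

definition L2 :: "'a measure \<Rightarrow> ('a \<Rightarrow> real) set" where
  "L2 M = {f \<in> borel_measurable M. integrable M (\<lambda>x. (f x)\<^sup>2)}"

text \<open>
  Elements of the Hilbert space are represented by functions, identities between them being
  understood almost everywhere; continuity and linearity make the operators below compatible
  with almost everywhere equality.
\<close>

definition L2_markov_semigroup :: "'a measure \<Rightarrow> (real \<Rightarrow> ('a \<Rightarrow> real) \<Rightarrow> ('a \<Rightarrow> real)) \<Rightarrow> bool" where
  "L2_markov_semigroup M R \<longleftrightarrow>
     (\<forall>t\<ge>0. \<forall>f\<in>L2 M. R t f \<in> L2 M) \<and>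
     (\<forall>t\<ge>0. \<forall>f\<in>L2 M. \<forall>h\<in>L2 M. \<forall>a b.
        AE x in M. R t (\<lambda>y. a * f y + b * h y) x = a * R t f x + b * R t h x) \<and>
     (\<forall>t\<ge>0. \<exists>C. \<forall>f\<in>L2 M. (\<integral>x. (R t f x)\<^sup>2 \<partial>M) \<le> C * (\<integral>x. (f x)\<^sup>2 \<partial>M)) \<and>
     (\<forall>f\<in>L2 M. AE x in M. R 0 f x = f x) \<and>
     (\<forall>s\<ge>0. \<forall>t\<ge>0. \<forall>f\<in>L2 M. AE x in M. R (s + t) f x = R s (R t f) x) \<and>
     (\<forall>t\<ge>0. \<forall>f\<in>L2 M. (AE x in M. 0 \<le> f x) \<longrightarrow> (AE x in M. 0 \<le> R t f x)) \<and>
     (\<forall>t\<ge>0. AE x in M. R t (\<lambda>_. 1) x = 1)"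

text \<open>As \<open>Lip p\<close> is dense in \<open>L2 (\<nu> g \<rho>)\<close>, there is only one such extension.\<close>

definition L2_extension ::
  "('d::finite site \<Rightarrow> real) \<Rightarrow> 'd config measure \<Rightarrow>
     (real \<Rightarrow> 'd observable \<Rightarrow> 'd observable) \<Rightarrow> (real \<Rightarrow> 'd observable \<Rightarrow> 'd observable) \<Rightarrow> bool" where
  "L2_extension p M P R \<longleftrightarrow> L2_markov_semigroup M R \<and>
     (\<forall>t\<ge>0. \<forall>f\<in>Lip p. AE \<eta> in M. R t f \<eta> = P t f \<eta>)"

text \<open>
  Only meant for \<open>Q\<close> absolutely continuous with respect to the measure on whose
  square-integrable functions \<open>R\<close> acts.
\<close>

definition invariant_measure ::
  "(real \<Rightarrow> ('a \<Rightarrow> real) \<Rightarrow> ('a \<Rightarrow> real)) \<Rightarrow> 'a measure \<Rightarrow> bool" where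
  "invariant_measure R Q \<longleftrightarrow>
     (\<forall>t\<ge>0. \<forall>f\<in>borel_measurable Q. (\<exists>B. \<forall>x\<in>space Q. \<bar>f x\<bar> \<le> B) \<longrightarrow>
        (\<integral>x. R t f x \<partial>Q) = (\<integral>x. f x \<partial>Q))"

end

theory Submission
  imports Defs
begin

text \<open>
  Write \<open>Q1\<close> as \<open>\<phi> \<nu>\<close> with \<open>\<phi>\<close> bounded. Both invariant measures together make \<open>\<nu>\<close> invariant, and
  invariance of \<open>Q1\<close> gives \<open>R t \<phi> = \<phi>\<close> and, by Cauchy-Schwarz for the conditional covariance,
  \<open>R t (f * \<phi>) = \<phi> * R t f\<close>. Tested against a Lipschitz function \<open>h\<close> and differentiated at \<open>t = 0\<close> this
  becomes \<open>\<integral> f * \<phi> * L' h d\<nu> = \<integral> h * \<phi> * L f d\<nu>\<close>, with \<open>L'\<close> the generator of the reversed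
  process. For \<open>f\<close> and \<open>h\<close> the indicators of two disjoint cylinders that differ by one jump from \<open>x\<close> to
  \<open>y\<close>, only that jump contributes, and \<open>Q1\<close> satisfies the same exchange formula between \<open>x\<close> and \<open>y\<close> as
  \<open>\<nu>\<close>. The exchange relation between sites is an equivalence relation, so that by irreducibility of the
  symmetrized walk it holds for all pairs. Averaging over far away \<open>y\<close> with the weak law of large
  numbers yields \<open>g (k + 1) Q1 (\<eta> x = k + 1, \<dots>) = \<psi> Q1 (\<eta> x = k, \<dots>)\<close>, which characterizes \<open>\<nu>\<close>.
\<close>


section \<open>Growth bounds and densities\<close>

text \<open>The semigroup is given through the chain on finite configurations and the growth of
  Lipschitz constants; no generator on L2 and no continuity of \<open>R\<close> in time come with
  it. Derivatives at time 0 are therefore computed pointwise on \<open>Omega'\<close>, by truncating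
  configurations, with errors controlled by the mass, which is integrable under \<nu>. The delicate
  derivative is that of \<open>R t (f * \<phi>)\<close>, because \<open>\<phi>\<close> is merely
  bounded and measurable. Duality moves the generator onto the Lipschitz test function. The reversed
  generator is then controlled in the mean only, since the weight \<beta> is adapted to the jumps of
  \<open>p\<close> and not to those of its reflection. Boundedness of \<open>\<phi>\<close> comes
  from the mixture itself, as \<open>Q1\<close> is at most \<nu> divided by \<epsilon>. It is also
  what transfers the law of large numbers from \<nu> to \<open>Q1\<close>, about which no
  independence is known.\<close>

lemma right_upper_growth:
  fixes f :: "real \<Rightarrow> real"
  assumes T: "0 \<le> T" and cont: "continuous_on {0..T} f"
    and D: "\<And>t e. 0 \<le> t \<Longrightarrow> t < T \<Longrightarrow> 0 < e \<Longrightarrow> eventually (\<lambda>s. f (t + s) - f t \<le> (B + e) * s) (at_right 0)"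
  shows "f T - f 0 \<le> B * T"
proof -
  have main: "f T - f 0 \<le> (B + e) * T" if e: "0 < e" for e
  proof (rule ccontr)
    assume neg: "\<not> f T - f 0 \<le> (B + e) * T"
    \<comment> \<open>By continuity the bound still holds at the infimum \<open>s\<close> of the
      violating times, and the right-hand estimate carries it beyond \<open>s\<close>; so
      \<open>s\<close> cannot be the infimum.\<close>
    define S where "S = {t\<in>{0..T}. f t - f 0 > (B + e) * t}"
    have TS: "T \<in> S" using neg T by (auto simp: S_def)
    define s where "s = Inf S"
    have bdd: "bdd_below S" by (auto simp: S_def bdd_below_def)
    have s0: "0 \<le> s" unfolding s_def using TS by (intro cInf_greatest) (auto simp: S_def)
    have sT: "s \<le> T" unfolding s_def using TS bdd by (intro cInf_lower)
    have below: "f t - f 0 \<le> (B + e) * t" if "0 \<le> t" "t < s" for t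
      using that cInf_lower[OF _ bdd, of t] sT by (force simp: S_def s_def)
    have fs: "f s - f 0 \<le> (B + e) * s"
    proof (cases "s = 0")
      case False
      have "continuous_on {0..T} (\<lambda>t. f t - f 0 - (B + e) * t)" by (intro continuous_intros cont)
      then have "((\<lambda>t. f t - f 0 - (B + e) * t) \<longlongrightarrow> f s - f 0 - (B + e) * s) (at s within {0..T})"
        using s0 sT by (auto simp: continuous_on_def)
      then have lim: "((\<lambda>t. f t - f 0 - (B + e) * t) \<longlongrightarrow> f s - f 0 - (B + e) * s) (at s within {0..<s})"
        by (rule tendsto_within_subset) (use sT in auto)
      have nb: "at s within {0..<s} \<noteq> bot"
        using False s0 by (simp add: at_within_eq_bot_iff)
      have "f s - f 0 - (B + e) * s \<le> 0"
        by (rule tendsto_upperbound[OF lim _ nb]) (use below in \<open>auto simp: eventually_at_filter\<close>)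
      then show ?thesis by simp
    qed simp
    have "s \<noteq> T" using fs neg by auto
    with sT have "s < T" by simp
    from D[OF s0 this e] obtain d where d: "0 < d" "\<And>r. 0 < r \<Longrightarrow> r < d \<Longrightarrow> f (s + r) - f s \<le> (B + e) * r"
      by (auto simp: eventually_at_right_field)
    have "s + d \<le> t" if "t \<in> S" for t
    proof (rule ccontr)
      assume "\<not> s + d \<le> t"
      then have tl: "t < s + d" by simp
      have ts: "s \<le> t" unfolding s_def by (rule cInf_lower[OF that bdd])
      have "t \<noteq> s" using that fs by (auto simp: S_def)
      then have "f t - f s \<le> (B + e) * (t - s)" using d(2)[of "t - s"] ts tl by auto
      then have "f t - f 0 \<le> (B + e) * t" using fs by (simp add: algebra_simps)
      with that show False by (simp add: S_def)
    qed
    then have "s + d \<le> s" unfolding s_def using TS by (intro cInf_greatest) auto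
    then show False using d by simp
  qed
  show ?thesis
  proof (rule field_le_epsilon)
    fix e :: real assume e: "0 < e"
    \<comment> \<open>Dividing by \<open>T + 1\<close> rather than \<open>T\<close> also covers
      \<open>T = 0\<close>.\<close>
    have "f T - f 0 \<le> (B + e / (T + 1)) * T" using e T by (intro main) simp
    also have "\<dots> = B * T + e * (T / (T + 1))" by (simp add: algebra_simps)
    also have "\<dots> \<le> B * T + e" using e T by (simp add: field_simps)
    finally show "f T - f 0 \<le> B * T + e" .
  qed
qed

text \<open>Only right derivatives can be expected: the chain is differentiable at time 0 from the
  right, and the semigroup law transports this to a right derivative at every later time.\<close>

lemma right_growth_bound:
  fixes f :: "real \<Rightarrow> real"
  assumes T: "0 \<le> T" and cont: "continuous_on {0..T} f"
    and D: "\<And>t. 0 \<le> t \<Longrightarrow> t < T \<Longrightarrow> ((\<lambda>s. (f (t + s) - f t) / s) \<longlongrightarrow> D t) (at_right 0)"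
    and B: "\<And>t. 0 \<le> t \<Longrightarrow> t < T \<Longrightarrow> \<bar>D t\<bar> \<le> B"
  shows "\<bar>f T - f 0\<bar> \<le> B * T"
proof -
  have ev: "eventually (\<lambda>s. f (t + s) - f t \<le> (B + e) * s \<and> f t - f (t + s) \<le> (B + e) * s) (at_right 0)"
    if t: "0 \<le> t" "t < T" and e: "0 < e" for t e
  proof -
    have "eventually (\<lambda>s. dist ((f (t + s) - f t) / s) (D t) < e) (at_right 0)"
      using D[OF t] e by (rule tendstoD)
    moreover have "eventually (\<lambda>s. 0 < s) (at_right (0::real))" by (rule eventually_at_right_less)
    ultimately show ?thesis
    proof eventually_elim
      case (elim s)
      then have "\<bar>(f (t + s) - f t) / s\<bar> \<le> B + e" using B[OF t] unfolding dist_real_def by linarith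
      then have "\<bar>f (t + s) - f t\<bar> / s \<le> B + e" using elim by (simp only: abs_divide abs_of_pos)
      then have "\<bar>f (t + s) - f t\<bar> \<le> (B + e) * s" using elim by (simp only: pos_divide_le_eq)
      then show ?case by linarith
    qed
  qed
  have "f T - f 0 \<le> B * T"
    by (rule right_upper_growth[OF T cont], rule eventually_mono[OF ev]) auto
  moreover have "- f T - - f 0 \<le> B * T"
    by (rule right_upper_growth[OF T continuous_on_minus[OF cont]], rule eventually_mono[OF ev]) auto
  ultimately show ?thesis by linarith
qed

text \<open>A modulus for increments to the right that is uniform in the starting time also controls
  the left side of a point \<open>x\<close>: start at \<open>y < x\<close>.\<close>

lemma right_lipschitz_continuous_on:
  fixes f :: "real \<Rightarrow> real"
  assumes m: "(m \<longlongrightarrow> 0) (at_right 0)"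
    and f: "\<And>t s. 0 \<le> t \<Longrightarrow> 0 < s \<Longrightarrow> t + s \<le> T \<Longrightarrow> \<bar>f (t + s) - f t\<bar> \<le> m s"
  shows "continuous_on {0..T} f"
  unfolding continuous_on_iff
proof (intro ballI allI impI)
  fix x e :: real assume x: "x \<in> {0..T}" and e: "0 < e"
  from tendstoD[OF m e] obtain d where d: "0 < d" "\<And>r. 0 < r \<Longrightarrow> r < d \<Longrightarrow> \<bar>m r\<bar> < e"
    by (auto simp: eventually_at_right_field dist_real_def)
  have "dist (f y) (f x) < e" if y: "y \<in> {0..T}" "dist y x < d" for y
  proof -
    consider "y = x" | "y < x" | "x < y" by linarith
    then show ?thesis
    proof cases
      case 2
      then have "\<bar>f x - f y\<bar> \<le> m (x - y)" using f[of y "x - y"] x y by auto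
      also have "\<dots> < e" using d(2)[of "x - y"] 2 y by (auto simp: dist_real_def)
      finally show ?thesis by (simp add: dist_real_def abs_minus_commute)
    next
      case 3
      then have "\<bar>f y - f x\<bar> \<le> m (y - x)" using f[of x "y - x"] x y by auto
      also have "\<dots> < e" using d(2)[of "y - x"] 3 y by (auto simp: dist_real_def)
      finally show ?thesis by (simp add: dist_real_def)
    qed (use e in auto)
  qed
  then show "\<exists>d>0. \<forall>x'\<in>{0..T}. dist x' x < d \<longrightarrow> dist (f x') (f x) < e" using d(1) by auto
qed

text \<open>The Radon-Nikodym derivative is cut off at \<open>C\<close>, so that the bounds hold at
  every point and later boundedness arguments stay pointwise.\<close>

lemma bounded_density:
  assumes M: "finite_measure M" and Q: "finite_measure Q" "sets Q = sets M" and C: "0 \<le> C"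
    and le: "\<And>A. A \<in> sets M \<Longrightarrow> measure Q A \<le> C * measure M A"
  obtains \<phi> where "\<phi> \<in> borel_measurable M" "\<And>x. 0 \<le> \<phi> x" "\<And>x. \<phi> x \<le> C"
    "Q = density M (\<lambda>x. ennreal (\<phi> x))"
proof -
  interpret M: finite_measure M by fact
  interpret Q: finite_measure Q by fact
  have "absolutely_continuous M Q"
    unfolding absolutely_continuous_def
  proof
    fix A assume "A \<in> null_sets M"
    then have "A \<in> sets M" "measure M A = 0" by (auto simp: M.emeasure_eq_measure)
    then have "measure Q A = 0" using le[of A] measure_nonneg[of Q A] by auto
    then show "A \<in> null_sets Q" using \<open>A \<in> sets M\<close> Q(2) by (auto simp: Q.emeasure_eq_measure)
  qed
  then obtain h where h: "h \<in> borel_measurable M" "density M h = Q"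
    using M.Radon_Nikodym[of Q] Q(2) by blast
  have "AE x in M. h x \<le> ennreal C"
  proof (rule AE_upper_bound_inf_ennreal)
    fix e :: real assume e: "0 < e"
    \<comment> \<open>On \<open>A\<close> the density is at least \<open>C + e\<close>, so
      \<open>Q\<close> would exceed \<open>C * M\<close> there unless \<open>A\<close> is
      null.\<close>
    define A where "A = {x\<in>space M. h x \<ge> ennreal (C + e)}"
    have A: "A \<in> sets M" unfolding A_def using h(1) by measurable
    have "ennreal (C + e) * emeasure M A = (\<integral>\<^sup>+x. ennreal (C + e) * indicator A x \<partial>M)"
      using A by (simp add: nn_integral_cmult_indicator)
    also have "\<dots> \<le> (\<integral>\<^sup>+x. h x * indicator A x \<partial>M)"
      by (intro nn_integral_mono) (auto simp: A_def indicator_def)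
    also have "\<dots> = emeasure Q A" using emeasure_density[OF h(1) A] by (simp add: h(2))
    also have "\<dots> \<le> ennreal C * emeasure M A"
      using le[OF A] C by (simp add: Q.emeasure_eq_measure M.emeasure_eq_measure ennreal_mult[symmetric])
    finally have "(C + e) * measure M A \<le> C * measure M A"
      using C e by (simp add: M.emeasure_eq_measure ennreal_mult[symmetric] ennreal_plus[symmetric] del: ennreal_plus)
    then have "measure M A = 0" using e measure_nonneg[of M A] by (simp add: algebra_simps mult_le_0_iff)
    then have "A \<in> null_sets M" using A by (auto simp: M.emeasure_eq_measure)
    then have "AE x in M. x \<notin> A" by (rule AE_not_in)
    then have "AE x in M. h x \<le> ennreal (C + e)"
      by (rule AE_mp) (auto simp: A_def)
    then show "AE x in M. h x \<le> ennreal C + ennreal e" using C e by simp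
  qed
  then have ae: "AE x in M. h x = ennreal (min C (enn2real (h x)))"
  proof eventually_elim
    case (elim x)
    then have "h x < top" by (simp add: order.strict_trans1)
    then have "h x = ennreal (enn2real (h x))" by simp
    moreover have "enn2real (h x) \<le> C" using elim C by (metis enn2real_leI)
    ultimately show ?case by simp
  qed
  show thesis
  proof
    show "(\<lambda>x. min C (enn2real (h x))) \<in> borel_measurable M" using h(1) by measurable
    show "Q = density M (\<lambda>x. ennreal (min C (enn2real (h x))))"
      unfolding h(2)[symmetric] by (rule density_cong[OF h(1) _ ae]) (use h(1) in measurable)
  qed (use C in auto)
qed


section \<open>The single-site measures\<close>

locale positive_rate =
  fixes g :: "nat \<Rightarrow> real"
  assumes g0 [simp]: "g 0 = 0" and gpos: "\<And>k. 1 \<le> k \<Longrightarrow> 0 < g k"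
begin

text \<open>Coefficients of the partition function as a power series in the fugacity.\<close>

definition w :: "nat \<Rightarrow> real" where "w k = 1 / (\<Prod>i=1..k. g i)"

lemma g_nonneg [simp]: "0 \<le> g k"
  using gpos[of k] by (cases k) auto

lemma w_pos [simp]: "0 < w k"
  unfolding w_def by (auto intro!: prod_pos gpos divide_pos_pos)

lemma w_nonneg [simp]: "0 \<le> w k"
  using w_pos[of k] by linarith

lemma w_0 [simp]: "w 0 = 1"
  by (simp add: w_def)

lemma w_Suc: "g (Suc k) * w (Suc k) = w k"
  using gpos[of "Suc k"] by (simp add: w_def)

text \<open>The liminf of \<open>g\<close> leaves room for convergence strictly beyond \<psi>. This
  margin gives finite moments and continuity in the fugacity at \<psi>.\<close>

lemma summable_w_powser:
  assumes "\<psi> \<in> fugacities g"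
  obtains r where "\<psi> < r" "r \<in> fugacities g" "summable (\<lambda>k. w k * r ^ k)"
proof -
  have \<psi>: "0 \<le> \<psi>" "ereal \<psi> < liminf (\<lambda>k. ereal (g k))" using assms by (auto simp: fugacities_def)
  \<comment> \<open>\<open>c\<close> is real even when the liminf is infinite.\<close>
  then obtain c where c: "ereal \<psi> < ereal c" "ereal c < liminf (\<lambda>k. ereal (g k))"
    by (metis ereal_dense2)
  obtain r where r: "\<psi> < r" "r < c" using c dense[of \<psi> c] by auto
  have "eventually (\<lambda>k. ereal c < ereal (g k)) sequentially"
    using c(2) by (rule less_LiminfD)
  then obtain N where N: "\<And>k. N \<le> k \<Longrightarrow> c < g k" by (auto simp: eventually_sequentially)
  have "summable (\<lambda>k. w k * r ^ k)"
  proof (rule summable_ratio_test[of "r / c" N])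
    show "r / c < 1" using r \<psi> by simp
    fix k assume "N \<le> k"
    then have gk: "c < g (Suc k)" using N[of "Suc k"] by simp
    have "w (Suc k) = w k / g (Suc k)" using w_Suc[of k] gpos[of "Suc k"] by (simp add: field_simps)
    also have "\<dots> \<le> w k / c" using gk r \<psi> by (intro divide_left_mono) auto
    finally have "w (Suc k) * r ^ Suc k \<le> w k / c * r ^ Suc k" using r \<psi> by (intro mult_right_mono) auto
    then show "norm (w (Suc k) * r ^ Suc k) \<le> r / c * norm (w k * r ^ k)"
      using r \<psi> by (simp add: abs_mult algebra_simps)
  qed
  moreover have "r \<in> fugacities g" using r \<psi> less_trans[OF _ c(2), of "ereal r"] by (auto simp: fugacities_def)
  ultimately show thesis using that r by blast
qed

lemma summable_w: "\<psi> \<in> fugacities g \<Longrightarrow> summable (\<lambda>k. w k * \<psi> ^ k)"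
proof -
  assume a: "\<psi> \<in> fugacities g"
  then obtain r where "\<psi> < r" "summable (\<lambda>k. w k * r ^ k)" by (rule summable_w_powser)
  then show ?thesis using a by (auto simp: fugacities_def intro: powser_inside)
qed

text \<open>Up to the factor \<psi> this is the termwise derivative of the partition
  function.\<close>

lemma summable_moment:
  assumes "\<psi> \<in> fugacities g"
  shows "summable (\<lambda>k. real k * w k * \<psi> ^ k)"
proof -
  obtain r where r: "\<psi> < r" "summable (\<lambda>k. w k * r ^ k)" using assms by (rule summable_w_powser)
  have p: "0 \<le> \<psi>" using assms by (auto simp: fugacities_def)
  have "summable (\<lambda>n. diffs w n * \<psi> ^ n)"
    by (rule termdiff_converges[of _ r]) (use r p in \<open>auto intro: powser_inside\<close>)
  from summable_mult2[OF this, of \<psi>] have "summable (\<lambda>n. real (Suc n) * w (Suc n) * \<psi> ^ Suc n)"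
    by (simp add: diffs_def algebra_simps)
  then show ?thesis by (subst (asm) summable_Suc_iff)
qed

lemma continuous_partition:
  assumes "\<psi> \<in> fugacities g"
  shows "isCont (\<lambda>x. \<Sum>k. w k * x ^ k) \<psi>" "isCont (\<lambda>x. \<Sum>k. real k * w k * x ^ k) \<psi>"
proof -
  obtain r where r: "\<psi> < r" "r \<in> fugacities g" "summable (\<lambda>k. w k * r ^ k)" using assms by (rule summable_w_powser)
  have p: "0 \<le> \<psi>" using assms by (auto simp: fugacities_def)
  show "isCont (\<lambda>x. \<Sum>k. w k * x ^ k) \<psi>" by (rule isCont_powser[OF r(3)]) (use r p in auto)
  show "isCont (\<lambda>x. \<Sum>k. real k * w k * x ^ k) \<psi>"
    by (rule isCont_powser[OF summable_moment[OF r(2)]]) (use r p in auto)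
qed

lemma Z_eq: "Z g \<psi> = (\<Sum>k. w k * \<psi> ^ k)"
  by (simp add: Z_def w_def)

lemma Z_pos: "\<psi> \<in> fugacities g \<Longrightarrow> 0 < Z g \<psi>"
  unfolding Z_eq using summable_w[of \<psi>]
  by (intro suminf_pos2[of _ 0]) (auto simp: fugacities_def)

lemma pmf_\<kappa>:
  assumes "\<psi> \<in> fugacities g"
  shows "pmf (\<kappa> g \<psi>) k = w k * \<psi> ^ k / Z g \<psi>"
proof -
  have p: "0 \<le> \<psi>" using assms by (auto simp: fugacities_def)
  have eq: "(\<lambda>k. inverse (Z g \<psi>) * (\<psi> ^ k / (\<Prod>i=1..k. g i))) = (\<lambda>k. w k * \<psi> ^ k / Z g \<psi>)"
    by (simp add: w_def fun_eq_iff field_simps)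
  have s: "(\<lambda>k. w k * \<psi> ^ k / Z g \<psi>) sums 1"
    using summable_sums[OF summable_w[OF assms], THEN sums_divide, of "Z g \<psi>"] Z_pos[OF assms]
    by (simp add: Z_eq)
  have n: "0 \<le> w k * \<psi> ^ k / Z g \<psi>" for k
    using Z_pos[OF assms] p by (intro divide_nonneg_pos mult_nonneg_nonneg) auto
  have "(\<integral>\<^sup>+k. ennreal (w k * \<psi> ^ k / Z g \<psi>) \<partial>count_space UNIV) = ennreal 1"
    by (subst nn_integral_count_space_nat) (rule suminf_ennreal_eq[OF n s])
  then show ?thesis unfolding \<kappa>_def eq by (subst pmf_embed_pmf) (use n in auto)
qed

text \<open>The product of rates in the weights telescopes. This is the property of the single-site
  law behind the exchange formula for \<nu>.\<close>

lemma \<kappa>_detailed_balance: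
  assumes "\<psi> \<in> fugacities g"
  shows "g (Suc k) * pmf (\<kappa> g \<psi>) (Suc k) = \<psi> * pmf (\<kappa> g \<psi>) k"
  by (simp add: pmf_\<kappa>[OF assms] w_Suc mult.assoc[symmetric])

lemma \<kappa>_0_pos: "\<psi> \<in> fugacities g \<Longrightarrow> 0 < pmf (\<kappa> g \<psi>) 0"
  using Z_pos by (simp add: pmf_\<kappa>)

lemma \<kappa>_moment:
  assumes "\<psi> \<in> fugacities g"
  shows "integrable (measure_pmf (\<kappa> g \<psi>)) real"
    "density_of g \<psi> = (\<Sum>k. real k * w k * \<psi> ^ k) / Z g \<psi>"
proof -
  have p: "0 \<le> \<psi>" using assms by (auto simp: fugacities_def)
  have s: "summable (\<lambda>k. pmf (\<kappa> g \<psi>) k * real k)"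
    using summable_divide[OF summable_moment[OF assms], of "Z g \<psi>"]
    by (simp add: pmf_\<kappa>[OF assms] mult_ac)
  have i: "integrable (count_space UNIV) (\<lambda>k. pmf (\<kappa> g \<psi>) k * real k)"
    unfolding integrable_count_space_nat_iff using s by (simp add: abs_mult)
  then show "integrable (measure_pmf (\<kappa> g \<psi>)) real"
    unfolding measure_pmf_eq_density by (subst integrable_density) auto
  have "density_of g \<psi> = (\<integral>k. pmf (\<kappa> g \<psi>) k * real k \<partial>count_space UNIV)"
    unfolding density_of_def measure_pmf_eq_density by (subst integral_density) auto
  also have "\<dots> = (\<Sum>k. pmf (\<kappa> g \<psi>) k * real k)" by (rule integral_count_space_nat[OF i])
  also have "\<dots> = (\<Sum>k. real k * w k * \<psi> ^ k / Z g \<psi>)"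
    by (simp add: pmf_\<kappa>[OF assms] mult_ac)
  also have "\<dots> = (\<Sum>k. real k * w k * \<psi> ^ k) / Z g \<psi>"
    by (rule suminf_divide[OF summable_moment[OF assms]])
  finally show "density_of g \<psi> = (\<Sum>k. real k * w k * \<psi> ^ k) / Z g \<psi>" .
qed

section \<open>Monotonicity of the density and its inverse\<close>

lemma density_of_0: "0 \<in> fugacities g \<Longrightarrow> density_of g 0 = 0"
proof -
  have "(\<lambda>k. real k * w k * 0 ^ k) = (\<lambda>k. 0)" by (auto simp: power_0_left)
  then show "0 \<in> fugacities g \<Longrightarrow> density_of g 0 = 0" by (simp add: \<kappa>_moment(2))
qed

text \<open>
  With \<open>m\<close> the mean at the smaller fugacity \<open>a\<close> and \<open>r = b / a\<close>, every term of the series of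
  \<open>(k - m) * (r ^ k - r powr m) * a ^ k * w k\<close> is nonnegative.
\<close>
lemma density_of_strict_mono:
  assumes a: "a \<in> fugacities g" and b: "b \<in> fugacities g" and ab: "a < b"
  shows "density_of g a < density_of g b"
proof -
  have a0: "0 \<le> a" using a by (auto simp: fugacities_def)
  note sa = summable_w[OF a] and sb = summable_w[OF b]
  note ma = summable_moment[OF a] and mb = summable_moment[OF b]
  define m where "m = density_of g a"
  have mZ: "(\<Sum>k. real k * w k * a ^ k) - m * (\<Sum>k. w k * a ^ k) = 0"
    using Z_pos[OF a] unfolding m_def \<kappa>_moment(2)[OF a] Z_eq[symmetric] by simp
  have pos: "0 < (\<Sum>k. real k * w k * b ^ k) - m * (\<Sum>k. w k * b ^ k)"
  proof (cases "a = 0")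
    \<comment> \<open>At \<open>a = 0\<close> the ratio \<open>b / a\<close> is meaningless; there
      \<open>m = 0\<close>, and the series is positive because of its term at 1.\<close>
    case True
    then have "m = 0" using density_of_0 a by (simp add: m_def)
    moreover have "0 < (\<Sum>k. real k * w k * b ^ k)"
      using ab a0 by (intro suminf_pos2[OF mb, of 1]) auto
    ultimately show ?thesis by simp
  next
    case False
    define r where "r = b / a"
    have r: "1 < r" "b = r * a" using False a0 ab by (auto simp: r_def)
    \<comment> \<open>\<open>r ^ k - c\<close> changes sign exactly where \<open>k - m\<close> does;
      \<open>powr\<close> because the mean \<open>m\<close> need not be an integer.\<close>
    define c where "c = r powr m"
    define t where "t k = w k * a ^ k * ((real k - m) * (r ^ k - c))" for k
    have teq: "t k = (real k * w k * b ^ k - m * (w k * b ^ k)) - c * (real k * w k * a ^ k - m * (w k * a ^ k))" for k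
      unfolding t_def r(2) power_mult_distrib by (simp add: algebra_simps)
    have su: "summable (\<lambda>k. real k * w k * b ^ k - m * (w k * b ^ k))"
       "summable (\<lambda>k. real k * w k * a ^ k - m * (w k * a ^ k))"
      by (intro summable_diff summable_mult sa sb ma mb)+
    have tpos: "0 \<le> t k" and tpos': "real k \<noteq> m \<Longrightarrow> 0 < t k" for k
    proof -
      have rk: "r ^ k = r powr real k" using r by (simp add: powr_realpow)
      have h: "0 < (real k - m) * (r ^ k - c)" if "real k \<noteq> m"
      proof (cases "real k < m")
        case True
        then have "r ^ k < c" unfolding rk c_def using r by simp
        with True show ?thesis by (intro mult_neg_neg) auto
      next
        case False
        then have "c < r ^ k" unfolding rk c_def using r that by simp
        with False that show ?thesis by (intro mult_pos_pos) auto
      qed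
      have wk: "0 < w k * a ^ k" using False a0 by simp
      show "real k \<noteq> m \<Longrightarrow> 0 < t k" unfolding t_def using h wk by (metis mult_pos_pos)
      then show "0 \<le> t k" by (cases "real k = m") (auto simp: t_def intro: less_imp_le)
    qed
    \<comment> \<open>One of 0 and 1 differs from \<open>m\<close>; its term makes the sum strictly
      positive.\<close>
    obtain k0 :: nat where "real k0 \<noteq> m"
      by (metis of_nat_eq_iff zero_neq_one)
    then have "0 < (\<Sum>k. t k)"
      using tpos tpos' summable_diff[OF su(1) summable_mult[OF su(2), of c]]
      by (intro suminf_pos2[of t k0]) (auto simp: teq[abs_def])
    also have "(\<Sum>k. t k) = (\<Sum>k. real k * w k * b ^ k - m * (w k * b ^ k)) - c * (\<Sum>k. real k * w k * a ^ k - m * (w k * a ^ k))"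
      unfolding teq using su by (simp add: suminf_diff[symmetric] suminf_mult summable_mult)
    also have "\<dots> = ((\<Sum>k. real k * w k * b ^ k) - m * (\<Sum>k. w k * b ^ k)) - c * 0"
      unfolding mZ[symmetric] using sa sb ma mb by (simp add: suminf_diff[symmetric] suminf_mult summable_mult)
    finally show ?thesis by simp
  qed
  then show ?thesis using Z_pos[OF b] by (simp add: \<kappa>_moment(2)[OF b] m_def[symmetric] Z_eq[symmetric] pos_less_divide_eq)
qed

text \<open>The inverse \<open>\<Psi>\<close> has its intended value only for \<rho> in the range of
  the density. By strict monotonicity \<open>rho_star\<close> is the supremum of the densities, so
  some fugacity has a density above \<rho>; the intermediate value theorem below it, where the
  density starts at 0, gives a preimage.\<close>

lemma Psi_fugacity:
  assumes \<rho>: "0 \<le> \<rho>" "ereal \<rho> < rho_star g"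
  shows "\<Psi> g \<rho> \<in> fugacities g"
proof -
  define b where "b = liminf (\<lambda>k. ereal (g k))"
  \<comment> \<open>Without admissible fugacities \<open>rho_star g\<close> is 0 by convention, and
    no \<rho> lies below it.\<close>
  have ne: "fugacities g \<noteq> {}" using \<rho> by (auto simp: rho_star_def split: if_splits)
  then obtain \<psi>0 where \<psi>0: "0 \<le> \<psi>0" "ereal \<psi>0 < b" by (auto simp: fugacities_def b_def)
  define F where "F = filtercomap ereal (at_left b)"
  have ev: "eventually P F" if "x < b" "\<And>\<psi>. x < ereal \<psi> \<Longrightarrow> ereal \<psi> < b \<Longrightarrow> P \<psi>" for P x
    unfolding F_def eventually_filtercomap
    by (rule exI[of _ "\<lambda>y. x < y \<and> y < b"]) (use that in \<open>auto simp: eventually_at_left[OF \<psi>0(2)]\<close>)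
  \<comment> \<open>\<open>Lim\<close> returns the supremum only if the filter is proper.\<close>
  have Fnb: "F \<noteq> bot"
  proof
    assume "F = bot"
    then have "eventually (\<lambda>_. False) F" by simp
    then obtain Q where Q: "eventually Q (at_left b)" "\<And>\<psi>. \<not> Q (ereal \<psi>)"
      by (auto simp: F_def eventually_filtercomap)
    then obtain y where y: "y < b" "\<And>z. y < z \<Longrightarrow> z < b \<Longrightarrow> Q z"
      by (auto simp: eventually_at_left[OF \<psi>0(2)])
    then show False using Q(2) ereal_dense2[OF y(1)] by auto
  qed
  define S where "S = (SUP \<psi>\<in>fugacities g. ereal (density_of g \<psi>))"
  have "((\<lambda>\<psi>. ereal (density_of g \<psi>)) \<longlongrightarrow> S) F"
  proof (rule order_tendstoI)
    fix y assume "y < S"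
    then obtain \<psi>1 where \<psi>1: "\<psi>1 \<in> fugacities g" "y < ereal (density_of g \<psi>1)"
      by (auto simp: S_def less_SUP_iff)
    show "eventually (\<lambda>\<psi>. y < ereal (density_of g \<psi>)) F"
    proof (rule ev[of "ereal \<psi>1"])
      show "ereal \<psi>1 < b" using \<psi>1 by (simp add: fugacities_def b_def)
      fix \<psi> assume "ereal \<psi>1 < ereal \<psi>" "ereal \<psi> < b"
      then have "density_of g \<psi>1 < density_of g \<psi>"
        using \<psi>1 by (intro density_of_strict_mono) (auto simp: fugacities_def b_def)
      then show "y < ereal (density_of g \<psi>)" using \<psi>1(2) by (simp add: less_trans)
    qed
  next
    fix y assume y: "S < y"
    show "eventually (\<lambda>\<psi>. ereal (density_of g \<psi>) < y) F"
    proof (rule ev[OF \<psi>0(2)])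
      fix \<psi> assume "ereal \<psi>0 < ereal \<psi>" "ereal \<psi> < b"
      then have "\<psi> \<in> fugacities g" using \<psi>0 by (auto simp: fugacities_def b_def)
      then have "ereal (density_of g \<psi>) \<le> S" unfolding S_def by (rule SUP_upper)
      then show "ereal (density_of g \<psi>) < y" using y by simp
    qed
  qed
  then have "rho_star g = S"
    using ne Fnb unfolding rho_star_def F_def[symmetric] b_def[symmetric] by (simp add: tendsto_Lim)
  then obtain \<psi>1 where \<psi>1: "\<psi>1 \<in> fugacities g" "\<rho> < density_of g \<psi>1"
    using \<rho>(2) by (auto simp: S_def less_SUP_iff)
  have \<psi>1n: "0 \<le> \<psi>1" using \<psi>1 by (simp add: fugacities_def)
  have sub: "\<psi> \<in> fugacities g" if "0 \<le> \<psi>" "\<psi> \<le> \<psi>1" for \<psi>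
    using that \<psi>1 le_less_trans[of "ereal \<psi>" "ereal \<psi>1"] by (auto simp: fugacities_def)
  have "continuous_on {0..\<psi>1} (\<lambda>\<psi>. (\<Sum>k. real k * w k * \<psi> ^ k) / (\<Sum>k. w k * \<psi> ^ k))"
    using sub continuous_partition Z_pos
    by (intro continuous_on_divide continuous_at_imp_continuous_on) (force simp: Z_eq)+
  then have "continuous_on {0..\<psi>1} (density_of g)"
    by (rule continuous_on_cong[THEN iffD1, rotated -1]) (use sub in \<open>auto simp: \<kappa>_moment(2) Z_eq\<close>)
  then obtain \<psi> where \<psi>: "0 \<le> \<psi>" "\<psi> \<le> \<psi>1" "density_of g \<psi> = \<rho>"
    using IVT'[of "density_of g" 0 \<rho> \<psi>1] \<rho> \<psi>1 \<psi>1n sub density_of_0 by auto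
  have inj: "inj_on (density_of g) (fugacities g)"
  proof (rule inj_onI)
    fix x y assume "x \<in> fugacities g" "y \<in> fugacities g" "density_of g x = density_of g y"
    then show "x = y" using density_of_strict_mono[of x y] density_of_strict_mono[of y x]
      by (cases x y rule: linorder_cases) auto
  qed
  show ?thesis unfolding \<Psi>_def
    by (rule the_inv_into_into[OF inj]) (use \<psi> sub in auto)
qed

end


section \<open>The weight of a random walk\<close>

lemma nn_integral_count_space_swap:
  fixes f :: "'a \<Rightarrow> 'b \<Rightarrow> ennreal"
  shows "(\<integral>\<^sup>+x. \<integral>\<^sup>+y. f x y \<partial>count_space UNIV \<partial>count_space UNIV)
       = (\<integral>\<^sup>+y. \<integral>\<^sup>+x. f x y \<partial>count_space UNIV \<partial>count_space UNIV)"
  using nn_integral_fst_count_space[of "\<lambda>(x, y). f x y"] nn_integral_snd_count_space[of "\<lambda>(x, y). f x y"]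
  by simp

text \<open>Passes from \<open>infsum\<close>, the form of the definitions, to integrals over
  counting measure, where Tonelli and dominated convergence apply.\<close>

lemma ennreal_infsum_nonneg:
  fixes f :: "'a \<Rightarrow> real"
  assumes "f summable_on UNIV" "\<And>x. 0 \<le> f x"
  shows "ennreal (\<Sum>\<^sub>\<infinity>x. f x) = (\<integral>\<^sup>+x. ennreal (f x) \<partial>count_space UNIV)"
proof -
  have abs: "Infinite_Sum.abs_summable_on f UNIV" using assms by simp
  then have i: "integrable (count_space UNIV) f"
    by (simp only: abs_summable_equivalent Infinite_Set_Sum.abs_summable_on_def)
  have "(\<Sum>\<^sub>\<infinity>x. f x) = (\<integral>x. f x \<partial>count_space UNIV)"
    using infsetsum_infsum[OF abs_summable_equivalent[THEN iffD1, OF abs]] by (simp add: infsetsum_def)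
  then show ?thesis using nn_integral_eq_integral[OF i] assms(2) by simp
qed

lemma infsum_eq_integral_count_space:
  fixes f :: "'a \<Rightarrow> real"
  assumes "integrable (count_space UNIV) f"
  shows "(\<Sum>\<^sub>\<infinity>x. f x) = (\<integral>x. f x \<partial>count_space UNIV)"
  using infsetsum_infsum[of f UNIV] assms by (simp add: infsetsum_def abs_summable_on_def)

lemma integrable_count_space_iff_summable_on:
  fixes f :: "'a \<Rightarrow> real"
  assumes "\<And>x. 0 \<le> f x"
  shows "integrable (count_space UNIV) f \<longleftrightarrow> f summable_on UNIV"
  using assms abs_summable_equivalent[of f UNIV] by (simp add: Infinite_Set_Sum.abs_summable_on_def)

locale random_walk =
  fixes p :: "'d::finite site \<Rightarrow> real"
  assumes jump: "jump_law p" and irred: "irreducible_walk p"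
begin

lemma p_nonneg [simp]: "0 \<le> p z"
  using jump by (simp add: jump_law_def)

lemma p_sum: "(p has_sum 1) UNIV"
  using jump by (simp add: jump_law_def)

lemma p_nn: "(\<integral>\<^sup>+z. ennreal (p z) \<partial>count_space UNIV) = 1"
  using ennreal_infsum_nonneg[of p] p_sum by (simp add: infsumI has_sum_imp_summable)

lemma p_shift_nn: "(\<integral>\<^sup>+z. ennreal (p (z - x)) \<partial>count_space UNIV) = 1"
proof -
  have "bij_betw (\<lambda>z. z - x) UNIV UNIV" by (rule bij_betw_byWitness[of _ "\<lambda>z. z + x"]) auto
  from nn_integral_bij_count_space[OF this, of "\<lambda>z. ennreal (p z)"] show ?thesis by (simp add: p_nn)
qed

lemma p_shift_nn': "(\<integral>\<^sup>+x. ennreal (p (z - x)) \<partial>count_space UNIV) = 1"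
proof -
  have "bij_betw (\<lambda>x. z - x) UNIV UNIV" by (rule bij_betw_byWitness[of _ "\<lambda>x. z - x"]) auto
  from nn_integral_bij_count_space[OF this, of "\<lambda>z. ennreal (p z)"] show ?thesis by (simp add: p_nn)
qed

text \<open>An infinite sum has its intended value only if it is summable. At step
  \<open>n + 1\<close> summability comes by domination from the bound 1 at step \<open>n\<close>,
  hence the bounds and the integral form are proved together.\<close>

lemma nstep_bounds:
  shows "0 \<le> nstep p n x y" "nstep p n x y \<le> 1"
    "ennreal (nstep p (Suc n) x y) = (\<integral>\<^sup>+z. ennreal (p (z - x) * nstep p n z y) \<partial>count_space UNIV)"
proof -
  have sum: "ennreal (nstep p (Suc n) x y) = (\<integral>\<^sup>+z. ennreal (p (z - x) * nstep p n z y) \<partial>count_space UNIV)"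
    if nb: "\<And>z. 0 \<le> nstep p n z y \<and> nstep p n z y \<le> 1" for n x y
  proof -
    have "integrable (count_space UNIV) (\<lambda>z. p (z - x))"
      by (intro integrableI_nonneg) (use p_shift_nn in auto)
    then have "integrable (count_space UNIV) (\<lambda>z. p (z - x) * nstep p n z y)"
      by (rule Bochner_Integration.integrable_bound) (use nb in \<open>auto simp: abs_mult intro!: mult_left_le\<close>)
    then show ?thesis using nb
      by (simp add: integrable_count_space_iff_summable_on ennreal_infsum_nonneg)
  qed
  have b: "0 \<le> nstep p n x y \<and> nstep p n x y \<le> 1" for n x y
  proof (induction n arbitrary: x y)
    case (Suc n)
    have "ennreal (nstep p (Suc n) x y) = (\<integral>\<^sup>+z. ennreal (p (z - x) * nstep p n z y) \<partial>count_space UNIV)"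
      by (rule sum) (use Suc in auto)
    also have "\<dots> \<le> (\<integral>\<^sup>+z. ennreal (p (z - x)) \<partial>count_space UNIV)"
      using Suc by (intro nn_integral_mono ennreal_leI mult_left_le) auto
    finally have "ennreal (nstep p (Suc n) x y) \<le> ennreal 1" by (simp add: p_shift_nn)
    moreover have "0 \<le> nstep p (Suc n) x y" using Suc by (auto intro!: infsum_nonneg)
    ultimately show ?case by (simp del: nstep.simps add: ennreal_le_iff)
  qed auto
  show "0 \<le> nstep p n x y" "nstep p n x y \<le> 1"
    "ennreal (nstep p (Suc n) x y) = (\<integral>\<^sup>+z. ennreal (p (z - x) * nstep p n z y) \<partial>count_space UNIV)"
    using b sum by blast+
qed

text \<open>Translation invariance makes the columns of the kernel sum to 1 as well as the rows;
  this gives \<beta> finite total weight.\<close>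

lemma nstep_column_sum: "(\<integral>\<^sup>+x. ennreal (nstep p n x y) \<partial>count_space UNIV) = 1"
proof (induction n)
  case 0
  have "(\<integral>\<^sup>+x. ennreal (nstep p 0 x y) \<partial>count_space UNIV) = (\<integral>\<^sup>+x. indicator {y} x \<partial>count_space UNIV)"
    by (intro nn_integral_cong) (auto simp: indicator_def)
  then show ?case by simp
next
  case (Suc n)
  have "(\<integral>\<^sup>+x. ennreal (nstep p (Suc n) x y) \<partial>count_space UNIV)
      = (\<integral>\<^sup>+z. \<integral>\<^sup>+x. ennreal (p (z - x) * nstep p n z y) \<partial>count_space UNIV \<partial>count_space UNIV)"
    unfolding nstep_bounds(3) by (rule nn_integral_count_space_swap)
  also have "\<dots> = (\<integral>\<^sup>+z. ennreal (nstep p n z y) \<partial>count_space UNIV)"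
    by (intro nn_integral_cong) (simp add: ennreal_mult nstep_bounds(1) nn_integral_multc p_shift_nn')
  finally show ?case by (simp add: Suc)
qed

lemma summable_\<beta>: "summable (\<lambda>n. (1 / 2) ^ n * nstep p n x 0)"
  by (rule summable_comparison_test'[of "\<lambda>n. (1 / 2) ^ n" 0])
    (auto simp: nstep_bounds abs_mult mult_left_le summable_geometric)

lemma \<beta>_nn: "ennreal (\<beta> p x) = (\<Sum>n. ennreal ((1 / 2) ^ n * nstep p n x 0))"
  unfolding \<beta>_def by (rule suminf_ennreal2[symmetric]) (auto simp: nstep_bounds summable_\<beta>)

lemma \<beta>_nonneg [simp]: "0 \<le> \<beta> p x"
  unfolding \<beta>_def by (intro suminf_nonneg summable_\<beta>) (auto simp: nstep_bounds)

text \<open>Irreducibility makes every site visible in the norm, which later makes local functions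
  Lipschitz.\<close>

lemma \<beta>_pos [simp]: "0 < \<beta> p x"
proof -
  obtain n where "0 < nstep p n x 0" using irred by (auto simp: irreducible_walk_def)
  then show ?thesis
    unfolding \<beta>_def by (intro suminf_pos2[OF summable_\<beta>, where i = n]) (auto simp: nstep_bounds)
qed

lemma \<beta>_le: "\<beta> p x \<le> 2"
proof -
  have "\<beta> p x \<le> (\<Sum>n. (1 / 2) ^ n)"
    unfolding \<beta>_def by (intro suminf_le summable_\<beta> summable_geometric mult_left_le) (auto simp: nstep_bounds)
  then show ?thesis by (simp add: suminf_geometric)
qed

lemma \<beta>_sum: "(\<integral>\<^sup>+x. ennreal (\<beta> p x) \<partial>count_space UNIV) = 2"
proof -
  have "(\<integral>\<^sup>+x. ennreal (\<beta> p x) \<partial>count_space UNIV)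
      = (\<Sum>n. \<integral>\<^sup>+x. ennreal ((1 / 2) ^ n * nstep p n x 0) \<partial>count_space UNIV)"
    unfolding \<beta>_nn by (rule nn_integral_suminf) simp
  also have "\<dots> = (\<Sum>n. ennreal ((1 / 2) ^ n))"
    by (simp add: ennreal_mult nstep_bounds(1) nn_integral_cmult nstep_column_sum)
  also have "\<dots> = ennreal (\<Sum>n. (1 / 2) ^ n)" by (rule suminf_ennreal2) (auto simp: summable_geometric)
  finally show ?thesis by (simp add: suminf_geometric)
qed

text \<open>One step of the walk shifts the index in the series for \<beta>, and the geometric
  weights turn the shift into a factor 2. This is the purpose of \<beta>: a jump of any range costs
  on average at most a multiple of the weight of its origin.\<close>

lemma \<beta>_step: "(\<integral>\<^sup>+y. ennreal (p y * \<beta> p (x + y)) \<partial>count_space UNIV) \<le> ennreal (2 * \<beta> p x)"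
proof -
  have bij: "bij_betw (\<lambda>z. z - x) UNIV UNIV" by (rule bij_betw_byWitness[of _ "\<lambda>z. z + x"]) auto
  have "(\<integral>\<^sup>+y. ennreal (p y * \<beta> p (x + y)) \<partial>count_space UNIV)
      = (\<integral>\<^sup>+z. ennreal (p (z - x) * \<beta> p z) \<partial>count_space UNIV)"
    using nn_integral_bij_count_space[OF bij, of "\<lambda>y. ennreal (p y * \<beta> p (x + y))"] by simp
  also have "\<dots> = (\<integral>\<^sup>+z. (\<Sum>n. ennreal ((1 / 2) ^ n) * ennreal (p (z - x) * nstep p n z 0)) \<partial>count_space UNIV)"
  proof (intro nn_integral_cong)
    fix z
    have "ennreal (p (z - x) * \<beta> p z) = (\<Sum>n. ennreal (p (z - x)) * ennreal ((1 / 2) ^ n * nstep p n z 0))"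
      by (simp only: ennreal_mult[OF p_nonneg \<beta>_nonneg] \<beta>_nn ennreal_suminf_cmult)
    also have "\<dots> = (\<Sum>n. ennreal ((1 / 2) ^ n) * ennreal (p (z - x) * nstep p n z 0))"
      by (intro suminf_cong) (simp add: ennreal_mult[symmetric] nstep_bounds(1) ac_simps)
    finally show "ennreal (p (z - x) * \<beta> p z) = (\<Sum>n. ennreal ((1 / 2) ^ n) * ennreal (p (z - x) * nstep p n z 0))" .
  qed
  also have "\<dots> = (\<Sum>n. \<integral>\<^sup>+z. ennreal ((1 / 2) ^ n) * ennreal (p (z - x) * nstep p n z 0) \<partial>count_space UNIV)"
    by (rule nn_integral_suminf) simp
  also have "\<dots> = (\<Sum>n. ennreal ((1 / 2) ^ n * nstep p (Suc n) x 0))"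
    by (simp del: nstep.simps add: nn_integral_cmult nstep_bounds ennreal_mult)
  also have "\<dots> = ennreal (\<Sum>n. (1 / 2) ^ n * nstep p (Suc n) x 0)"
  proof (rule suminf_ennreal2)
    show "summable (\<lambda>n. (1 / 2) ^ n * nstep p (Suc n) x 0)"
      by (rule summable_comparison_test'[of "\<lambda>n. (1 / 2) ^ n" 0])
        (auto simp: nstep_bounds abs_mult mult_left_le summable_geometric simp del: nstep.simps)
  qed (simp add: nstep_bounds del: nstep.simps)
  also have "\<dots> \<le> ennreal (2 * \<beta> p x)"
  proof (rule ennreal_leI)
    have s: "summable (\<lambda>n. 2 * ((1 / 2) ^ n * nstep p n x 0))" by (rule summable_mult[OF summable_\<beta>])
    have "2 * \<beta> p x = (\<Sum>n. 2 * ((1 / 2) ^ n * nstep p n x 0))"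
      unfolding \<beta>_def by (rule suminf_mult[OF summable_\<beta>, symmetric])
    \<comment> \<open>The head term has no counterpart in the shifted series; being nonnegative, it
      leaves an inequality.\<close>
    also have "\<dots> = (\<Sum>n. 2 * ((1 / 2) ^ Suc n * nstep p (Suc n) x 0)) + 2 * nstep p 0 x 0"
      using suminf_split_head[OF s] by (simp del: nstep.simps)
    finally show "(\<Sum>n. (1 / 2) ^ n * nstep p (Suc n) x 0) \<le> 2 * \<beta> p x"
      using nstep_bounds(1)[of 0 x 0] by (simp del: nstep.simps)
  qed
  finally show ?thesis .
qed

end


section \<open>Configurations and the generator\<close>

locale zero_range = positive_rate g + random_walk p
  for g :: "nat \<Rightarrow> real" and p :: "'d::finite site \<Rightarrow> real" +
  fixes a0 :: real
  assumes g_lipschitz: "\<And>k. \<bar>g (k + 1) - g k\<bar> \<le> a0"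
begin

lemma a0_nonneg: "0 \<le> a0"
  using g_lipschitz[of 0] by linarith

lemma g_le: "g k \<le> a0 * real k"
proof (induction k)
  case (Suc k)
  then show ?case using g_lipschitz[of k] by (simp add: algebra_simps abs_le_iff)
qed simp

text \<open>On \<open>Omega'\<close> this is the distance to the empty configuration; elsewhere the
  integral defaults to 0.\<close>

definition mass :: "'d config \<Rightarrow> real" where
  "mass \<eta> = (\<integral>x. real (\<eta> x) * \<beta> p x \<partial>count_space UNIV)"

lemma Omega'_iff: "\<eta> \<in> Omega' p \<longleftrightarrow> integrable (count_space UNIV) (\<lambda>x. real (\<eta> x) * \<beta> p x)"
  by (simp add: Omega'_def integrable_count_space_iff_summable_on)

lemma mass_nonneg [simp]: "0 \<le> mass \<eta>"
  by (simp add: mass_def)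

lemma Omega'_mono: "\<zeta> \<in> Omega' p \<Longrightarrow> (\<And>x. \<eta> x \<le> \<zeta> x) \<Longrightarrow> \<eta> \<in> Omega' p"
  unfolding Omega'_iff by (erule Bochner_Integration.integrable_bound) (auto simp: abs_mult intro!: mult_right_mono)

lemma mass_mono: "\<zeta> \<in> Omega' p \<Longrightarrow> (\<And>x. \<eta> x \<le> \<zeta> x) \<Longrightarrow> mass \<eta> \<le> mass \<zeta>"
  unfolding mass_def using Omega'_mono[of \<zeta> \<eta>]
  by (intro integral_mono) (auto simp: Omega'_iff intro!: mult_right_mono)

lemma integrable_dist:
  assumes "\<eta> \<in> Omega' p" "\<zeta> \<in> Omega' p"
  shows "integrable (count_space UNIV) (\<lambda>x. \<bar>real (\<eta> x) - real (\<zeta> x)\<bar> * \<beta> p x)"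
proof (rule Bochner_Integration.integrable_bound)
  show "integrable (count_space UNIV) (\<lambda>x. real (\<eta> x) * \<beta> p x + real (\<zeta> x) * \<beta> p x)"
    using assms by (simp add: Omega'_iff)
  show "AE x in count_space UNIV. norm (\<bar>real (\<eta> x) - real (\<zeta> x)\<bar> * \<beta> p x) \<le> norm (real (\<eta> x) * \<beta> p x + real (\<zeta> x) * \<beta> p x)"
    by (auto simp: abs_mult distrib_right[symmetric] intro!: mult_right_mono)
qed simp

lemma config_dist_eq:
  "\<eta> \<in> Omega' p \<Longrightarrow> \<zeta> \<in> Omega' p \<Longrightarrow>
    config_dist p \<eta> \<zeta> = (\<integral>x. \<bar>real (\<eta> x) - real (\<zeta> x)\<bar> * \<beta> p x \<partial>count_space UNIV)"
  unfolding config_dist_def by (rule infsum_eq_integral_count_space[OF integrable_dist])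

lemma finite_in_Omega': "\<eta> \<in> finite_configs \<Longrightarrow> \<eta> \<in> Omega' p"
proof -
  assume "\<eta> \<in> finite_configs"
  then have "finite {x. real (\<eta> x) * \<beta> p x \<noteq> 0}"
    by (auto simp: finite_configs_def elim!: rev_finite_subset)
  then have s: "(\<lambda>x. real (\<eta> x) * \<beta> p x) summable_on {x. real (\<eta> x) * \<beta> p x \<noteq> 0}" by simp
  have "(\<lambda>x. real (\<eta> x) * \<beta> p x) summable_on UNIV"
    using summable_on_cong_neutral[THEN iffD1, OF _ _ _ s, of UNIV "\<lambda>x. real (\<eta> x) * \<beta> p x"] by auto
  then show ?thesis by (simp add: Omega'_def)
qed

lemma count_space_point [simp]:
  "integrable (count_space UNIV) (\<lambda>y. of_bool (y = x) * (f y :: real))"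
  "(\<integral>y. of_bool (y = x) * (f y :: real) \<partial>count_space UNIV) = f x"
proof -
  have eq: "(\<lambda>y. of_bool (y = x) * f y) = (\<lambda>y. indicator {x} y *\<^sub>R f x)" by (auto simp: indicator_def)
  show "integrable (count_space UNIV) (\<lambda>y. of_bool (y = x) * (f y :: real))"
    unfolding eq by (intro integrable_scaleR_left integrable_real_indicator) auto
  show "(\<integral>y. of_bool (y = x) * (f y :: real) \<partial>count_space UNIV) = f x" unfolding eq by simp
qed

lemma move_apply: "move x z \<eta> u = (if u = z then (if x = z then \<eta> x - 1 else \<eta> z) + 1 else if u = x then \<eta> x - 1 else \<eta> u)"
  by (auto simp: move_def Let_def)

lemma move_self: "1 \<le> \<eta> x \<Longrightarrow> move x x \<eta> = \<eta>"
  by (auto simp: fun_eq_iff move_apply)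

lemma move_bound: "real (move x z \<eta> u) \<le> real (\<eta> u) + of_bool (u = z)"
  by (auto simp: move_apply)

lemma move_mass:
  assumes "\<eta> \<in> Omega' p"
  shows "move x z \<eta> \<in> Omega' p" "mass (move x z \<eta>) \<le> mass \<eta> + \<beta> p z"
proof -
  have i: "integrable (count_space UNIV) (\<lambda>u. real (\<eta> u) * \<beta> p u + of_bool (u = z) * \<beta> p u)"
    using assms by (intro Bochner_Integration.integrable_add count_space_point) (simp add: Omega'_iff)
  have b: "real (move x z \<eta> u) * \<beta> p u \<le> real (\<eta> u) * \<beta> p u + of_bool (u = z) * \<beta> p u" for u
    unfolding distrib_right[symmetric] by (intro mult_right_mono move_bound) simp
  show o: "move x z \<eta> \<in> Omega' p"
    unfolding Omega'_iff using i
    by (rule Bochner_Integration.integrable_bound) (use b in \<open>auto intro: order_trans[OF _ abs_ge_self]\<close>)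
  have "mass (move x z \<eta>) \<le> (\<integral>u. real (\<eta> u) * \<beta> p u + of_bool (u = z) * \<beta> p u \<partial>count_space UNIV)"
    unfolding mass_def using o b i by (intro integral_mono) (auto simp: Omega'_iff)
  also have "\<dots> = mass \<eta> + \<beta> p z"
    using assms unfolding mass_def by (subst Bochner_Integration.integral_add) (simp_all add: Omega'_iff)
  finally show "mass (move x z \<eta>) \<le> mass \<eta> + \<beta> p z" .
qed

lemma move_dist:
  assumes "\<eta> \<in> Omega' p" "1 \<le> \<eta> x"
  shows "config_dist p (move x z \<eta>) \<eta> \<le> \<beta> p x + \<beta> p z"
proof -
  have i: "integrable (count_space UNIV) (\<lambda>u. of_bool (u = x) * \<beta> p u + of_bool (u = z) * \<beta> p u)"
    by (intro Bochner_Integration.integrable_add count_space_point)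
  have b: "\<bar>real (move x z \<eta> u) - real (\<eta> u)\<bar> * \<beta> p u \<le> of_bool (u = x) * \<beta> p u + of_bool (u = z) * \<beta> p u" for u
    unfolding distrib_right[symmetric] using assms(2) by (intro mult_right_mono) (auto simp: move_apply)
  have "config_dist p (move x z \<eta>) \<eta> \<le> (\<integral>u. of_bool (u = x) * \<beta> p u + of_bool (u = z) * \<beta> p u \<partial>count_space UNIV)"
    unfolding config_dist_eq[OF move_mass(1)[OF assms(1)] assms(1)]
    by (intro integral_mono integrable_dist move_mass(1) assms(1) i b)
  also have "\<dots> = \<beta> p x + \<beta> p z"
    by (subst Bochner_Integration.integral_add) simp_all
  finally show ?thesis .
qed

section \<open>Truncation to finitely many sites\<close>

definition trunc :: "nat \<Rightarrow> 'd config \<Rightarrow> 'd config" where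
  "trunc n \<eta> = (\<lambda>x. if to_nat x < n then \<eta> x else 0)"

lemma trunc_le: "trunc n \<eta> x \<le> \<eta> x"
  by (simp add: trunc_def)

lemma finite_to_nat_less: "finite {x. to_nat (x :: 'd site) < n}"
proof (rule finite_imageD)
  show "finite (to_nat ` {x. to_nat (x :: 'd site) < n})" by (rule finite_subset[of _ "{..<n}"]) auto
qed (rule inj_on_subset[OF inj_to_nat], simp)

lemma trunc_eq: "to_nat x < n \<Longrightarrow> trunc n \<eta> x = \<eta> x"
  by (simp add: trunc_def)

lemma trunc_finite: "trunc n \<eta> \<in> finite_configs"
  unfolding finite_configs_def trunc_def using finite_to_nat_less[of n] by (auto elim!: rev_finite_subset)

lemma trunc_Omega' [simp]: "trunc n \<eta> \<in> Omega' p"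
  by (intro finite_in_Omega' trunc_finite)

lemma trunc_eventually: "eventually (\<lambda>n. trunc n \<eta> x = \<eta> x) sequentially"
  unfolding trunc_def by (rule eventually_sequentiallyI[of "Suc (to_nat x)"]) auto

text \<open>Finite configurations are thus dense in \<open>Omega'\<close>: statements about the
  chain pass to \<open>Omega'\<close> along truncations.\<close>

lemma trunc_dist:
  assumes "\<eta> \<in> Omega' p"
  shows "(\<lambda>n. config_dist p (trunc n \<eta>) \<eta>) \<longlonglongrightarrow> 0"
proof -
  have "(\<lambda>n. \<integral>x. \<bar>real (trunc n \<eta> x) - real (\<eta> x)\<bar> * \<beta> p x \<partial>count_space UNIV)
      \<longlonglongrightarrow> (\<integral>x. 0 \<partial>count_space (UNIV :: 'd site set))"
  proof (rule integral_dominated_convergence[where w = "\<lambda>x. real (\<eta> x) * \<beta> p x"])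
    show "integrable (count_space UNIV) (\<lambda>x. real (\<eta> x) * \<beta> p x)" using assms by (simp add: Omega'_iff)
    show "AE x in count_space UNIV. (\<lambda>n. \<bar>real (trunc n \<eta> x) - real (\<eta> x)\<bar> * \<beta> p x) \<longlonglongrightarrow> 0"
      by (intro AE_I2 tendsto_eventually eventually_mono[OF trunc_eventually]) auto
  qed (auto simp: trunc_def abs_mult)
  then show ?thesis using assms by (simp add: config_dist_eq)
qed

section \<open>Lipschitz bounds\<close>

lemma lip_boundD:
  "lip_bound p f C \<Longrightarrow> \<eta> \<in> Omega' p \<Longrightarrow> \<zeta> \<in> Omega' p \<Longrightarrow> \<bar>f \<eta> - f \<zeta>\<bar> \<le> C * config_dist p \<eta> \<zeta>"
  by (auto simp: lip_bound_def)

lemma lip_bound_nonneg: "lip_bound p f C \<Longrightarrow> 0 \<le> C"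
  by (auto simp: lip_bound_def)

lemma config_dist_nonneg: "\<eta> \<in> Omega' p \<Longrightarrow> \<zeta> \<in> Omega' p \<Longrightarrow> 0 \<le> config_dist p \<eta> \<zeta>"
  by (simp add: config_dist_eq)

lemma lip_bound_mono: "lip_bound p f C \<Longrightarrow> C \<le> D \<Longrightarrow> lip_bound p f D"
  unfolding lip_bound_def using config_dist_nonneg by (meson mult_right_mono order_trans)

text \<open>The infimum in \<open>lip_const\<close> is attained, which turns the growth assumption
  on the semigroup into usable Lipschitz bounds.\<close>

lemma lip_bound_lip_const:
  assumes "f \<in> Lip p"
  shows "lip_bound p f (lip_const p f)"
proof -
  have ne: "{C. lip_bound p f C} \<noteq> {}" using assms by (auto simp: Lip_def)
  have 0: "0 \<le> lip_const p f" unfolding lip_const_def using ne by (intro cInf_greatest) (auto dest: lip_bound_nonneg)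
  have "\<bar>f \<eta> - f \<zeta>\<bar> \<le> lip_const p f * config_dist p \<eta> \<zeta>" if o: "\<eta> \<in> Omega' p" "\<zeta> \<in> Omega' p" for \<eta> \<zeta>
  proof (cases "config_dist p \<eta> \<zeta> = 0")
    case True
    then show ?thesis using ne lip_boundD[OF _ o, of f] by auto
  next
    case False
    then have d: "0 < config_dist p \<eta> \<zeta>" using config_dist_nonneg[OF o] by simp
    have "\<bar>f \<eta> - f \<zeta>\<bar> / config_dist p \<eta> \<zeta> \<le> lip_const p f"
      unfolding lip_const_def using ne
    proof (rule cInf_greatest)
      fix C assume "C \<in> {C. lip_bound p f C}"
      then show "\<bar>f \<eta> - f \<zeta>\<bar> / config_dist p \<eta> \<zeta> \<le> C"
        using lip_boundD[OF _ o, of f C] d by (simp add: pos_divide_le_eq)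
    qed
    then show ?thesis using d by (simp add: pos_divide_le_eq)
  qed
  with 0 show ?thesis by (auto simp: lip_bound_def)
qed

lemma lip_const_le: "lip_bound p f C \<Longrightarrow> lip_const p f \<le> C"
  unfolding lip_const_def by (rule cInf_lower) (auto simp: bdd_below_def dest: lip_bound_nonneg)

lemma lip_trunc:
  assumes "lip_bound p f C" "\<eta> \<in> Omega' p"
  shows "(\<lambda>n. f (trunc n \<eta>)) \<longlonglongrightarrow> f \<eta>"
proof (rule Lim_transform[where g = "\<lambda>_. f \<eta>"])
  have "(\<lambda>n. C * config_dist p (trunc n \<eta>) \<eta>) \<longlonglongrightarrow> 0"
    using tendsto_mult[OF tendsto_const trunc_dist[OF assms(2)], of C] by simp
  then show "(\<lambda>n. f (trunc n \<eta>) - f \<eta>) \<longlonglongrightarrow> 0"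
    by (rule Lim_null_comparison[rotated])
      (use lip_boundD[OF assms(1) trunc_Omega' assms(2)] in auto)
qed simp

lemma move_trunc:
  assumes "to_nat x < n" "to_nat z < n"
  shows "move x z (trunc n \<eta>) = trunc n (move x z \<eta>)"
  using assms by (auto simp: fun_eq_iff move_apply trunc_def)

section \<open>Jump costs and the generator on Lipschitz functions\<close>

definition cost :: "'d config \<Rightarrow> 'd site \<times> 'd site \<Rightarrow> real" where
  "cost \<eta> = (\<lambda>(x, y). p y * g (\<eta> x) * (\<beta> p x + \<beta> p (x + y)))"

text \<open>\<open>g\<close> need not be monotone, but its linear majorant is: \<open>cost'\<close>
  at \<eta> dominates the cost of every configuration below \<eta>.\<close>

definition cost' :: "'d config \<Rightarrow> 'd site \<times> 'd site \<Rightarrow> real" where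
  "cost' \<eta> = (\<lambda>(x, y). p y * (a0 * real (\<eta> x)) * (\<beta> p x + \<beta> p (x + y)))"

lemma cost_nonneg [simp]: "0 \<le> cost \<eta> xy"
  by (auto simp: cost_def split: prod.split intro!: mult_nonneg_nonneg add_nonneg_nonneg)

lemma cost_le: "cost \<eta> xy \<le> cost' \<eta> xy"
  by (auto simp: cost_def cost'_def split: prod.split intro!: mult_right_mono mult_left_mono g_le add_nonneg_nonneg)

lemma cost'_nonneg [simp]: "0 \<le> cost' \<eta> xy"
  by (rule order_trans[OF cost_nonneg cost_le])

text \<open>The 3 is 1 + 2: the departure site contributes the total jump probability, the arrival
  site the factor of \<open>\<beta>_step\<close>.\<close>

lemma weighted_jump_sum:
  assumes "\<And>x. 0 \<le> f x"
  shows "(\<integral>\<^sup>+(x, y). ennreal (p y * f x * (\<beta> p x + \<beta> p (x + y))) \<partial>count_space UNIV)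
      \<le> 3 * (\<integral>\<^sup>+x. ennreal (f x * \<beta> p x) \<partial>count_space UNIV)"
proof -
  have "(\<integral>\<^sup>+(x, y). ennreal (p y * f x * (\<beta> p x + \<beta> p (x + y))) \<partial>count_space UNIV)
      = (\<integral>\<^sup>+x. \<integral>\<^sup>+y. ennreal (f x * \<beta> p x) * ennreal (p y) + ennreal (f x) * ennreal (p y * \<beta> p (x + y)) \<partial>count_space UNIV \<partial>count_space UNIV)"
    unfolding nn_integral_fst_count_space[symmetric]
    using assms by (intro nn_integral_cong)
      (simp add: ennreal_mult[symmetric] ennreal_plus[symmetric] algebra_simps del: ennreal_plus)
  also have "\<dots> \<le> (\<integral>\<^sup>+x. 3 * ennreal (f x * \<beta> p x) \<partial>count_space UNIV)"
  proof (intro nn_integral_mono)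
    fix x
    have "(\<integral>\<^sup>+y. ennreal (f x * \<beta> p x) * ennreal (p y) + ennreal (f x) * ennreal (p y * \<beta> p (x + y)) \<partial>count_space UNIV)
       \<le> ennreal (f x * \<beta> p x) * 1 + ennreal (f x) * ennreal (2 * \<beta> p x)"
      by (subst nn_integral_add) (auto simp: nn_integral_cmult p_nn intro!: add_mono mult_left_mono \<beta>_step)
    also have "\<dots> = ennreal (3 * (f x * \<beta> p x))"
      using assms by (simp add: ennreal_mult[symmetric] ennreal_plus[symmetric] del: ennreal_plus)
    finally show "(\<integral>\<^sup>+y. ennreal (f x * \<beta> p x) * ennreal (p y) + ennreal (f x) * ennreal (p y * \<beta> p (x + y)) \<partial>count_space UNIV)
       \<le> 3 * ennreal (f x * \<beta> p x)" by (simp add: ennreal_mult')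
  qed
  also have "\<dots> = 3 * (\<integral>\<^sup>+x. ennreal (f x * \<beta> p x) \<partial>count_space UNIV)"
    by (rule nn_integral_cmult) simp
  finally show ?thesis .
qed

lemma cost'_integral:
  assumes "\<eta> \<in> Omega' p"
  shows "integrable (count_space UNIV) (cost' \<eta>)" "(\<integral>xy. cost' \<eta> xy \<partial>count_space UNIV) \<le> 3 * a0 * mass \<eta>"
proof -
  have m: "(\<integral>\<^sup>+x. ennreal (real (\<eta> x) * \<beta> p x) \<partial>count_space UNIV) = ennreal (mass \<eta>)"
    unfolding mass_def using assms by (intro nn_integral_eq_integral) (auto simp: Omega'_iff)
  have "(\<integral>\<^sup>+xy. ennreal (cost' \<eta> xy) \<partial>count_space UNIV) \<le> 3 * (\<integral>\<^sup>+x. ennreal (a0 * real (\<eta> x) * \<beta> p x) \<partial>count_space UNIV)"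
    using weighted_jump_sum[of "\<lambda>x. a0 * real (\<eta> x)"] a0_nonneg by (simp add: cost'_def case_prod_beta')
  also have "\<dots> = ennreal (3 * a0 * mass \<eta>)"
    using a0_nonneg by (simp add: mult.assoc ennreal_mult'[of a0] ennreal_mult'[of 3] nn_integral_cmult m)
  finally have n: "(\<integral>\<^sup>+xy. ennreal (cost' \<eta> xy) \<partial>count_space UNIV) \<le> ennreal (3 * a0 * mass \<eta>)" .
  then show i: "integrable (count_space UNIV) (cost' \<eta>)"
    by (intro integrableI_nonneg) (auto simp: le_less_trans)
  show "(\<integral>xy. cost' \<eta> xy \<partial>count_space UNIV) \<le> 3 * a0 * mass \<eta>"
    using n a0_nonneg by (simp add: nn_integral_eq_integral[OF i])
qed

lemma cost_integral:
  assumes "\<eta> \<in> Omega' p"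
  shows "integrable (count_space UNIV) (cost \<eta>)" "(\<integral>xy. cost \<eta> xy \<partial>count_space UNIV) \<le> 3 * a0 * mass \<eta>"
proof -
  show i: "integrable (count_space UNIV) (cost \<eta>)"
    by (rule Bochner_Integration.integrable_bound[OF cost'_integral(1)[OF assms]]) (auto simp: cost_le)
  have "(\<integral>xy. cost \<eta> xy \<partial>count_space UNIV) \<le> (\<integral>xy. cost' \<eta> xy \<partial>count_space UNIV)"
    by (intro integral_mono i cost'_integral assms cost_le)
  also have "\<dots> \<le> 3 * a0 * mass \<eta>" by (rule cost'_integral[OF assms])
  finally show "(\<integral>xy. cost \<eta> xy \<partial>count_space UNIV) \<le> 3 * a0 * mass \<eta>" .
qed

definition jump_term :: "'d observable \<Rightarrow> 'd config \<Rightarrow> 'd site \<times> 'd site \<Rightarrow> real" where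
  "jump_term u \<eta> = (\<lambda>(x, y). p y * g (\<eta> x) * (u (move x (x + y) \<eta>) - u \<eta>))"

lemma jump_term_bound:
  assumes "lip_bound p u C" "\<eta> \<in> Omega' p"
  shows "\<bar>jump_term u \<eta> xy\<bar> \<le> C * cost \<eta> xy"
proof (cases xy)
  case (Pair x y)
  show ?thesis
  proof (cases "\<eta> x = 0")
    case False
    then have "\<bar>u (move x (x + y) \<eta>) - u \<eta>\<bar> \<le> C * (\<beta> p x + \<beta> p (x + y))"
      by (intro order_trans[OF lip_boundD[OF assms(1) move_mass(1)[OF assms(2)] assms(2)]]
          mult_left_mono move_dist[OF assms(2)] lip_bound_nonneg[OF assms(1)]) simp
    then have "p y * g (\<eta> x) * \<bar>u (move x (x + y) \<eta>) - u \<eta>\<bar> \<le> p y * g (\<eta> x) * (C * (\<beta> p x + \<beta> p (x + y)))"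
      by (intro mult_left_mono) auto
    then show ?thesis by (simp add: Pair jump_term_def cost_def abs_mult mult_ac)
  qed (simp add: Pair jump_term_def cost_def)
qed

lemma jump_term_integrable:
  assumes "lip_bound p u C" "\<eta> \<in> Omega' p"
  shows "integrable (count_space UNIV) (jump_term u \<eta>)"
  by (rule Bochner_Integration.integrable_bound[OF integrable_mult_right[OF cost_integral(1)[OF assms(2)], of C]])
    (use jump_term_bound[OF assms] lip_bound_nonneg[OF assms(1)] in \<open>auto simp: abs_mult\<close>)

lemma generator_eq:
  assumes "lip_bound p u C" "\<eta> \<in> Omega' p"
  shows "generator g p u \<eta> = (\<integral>xy. jump_term u \<eta> xy \<partial>count_space UNIV)"
  using infsum_eq_integral_count_space[OF jump_term_integrable[OF assms]]
  by (simp add: generator_def jump_term_def)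

text \<open>The total jump rate out of a configuration in \<open>Omega'\<close> may be infinite. The
  generator is finite nevertheless, because a Lipschitz function hardly feels jumps between sites of
  small weight.\<close>

lemma generator_bound:
  assumes "lip_bound p u C" "\<eta> \<in> Omega' p"
  shows "\<bar>generator g p u \<eta>\<bar> \<le> 3 * a0 * C * mass \<eta>"
proof -
  have "\<bar>generator g p u \<eta>\<bar> \<le> (\<integral>xy. C * cost \<eta> xy \<partial>count_space UNIV)"
    unfolding generator_eq[OF assms]
    by (rule order_trans[OF integral_abs_bound integral_mono])
      (use jump_term_bound[OF assms] jump_term_integrable[OF assms] cost_integral(1)[OF assms(2)] in auto)
  also have "\<dots> \<le> C * (3 * a0 * mass \<eta>)"
    using cost_integral[OF assms(2)] lip_bound_nonneg[OF assms(1)] by (simp add: mult_left_mono)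
  finally show ?thesis by (simp add: mult_ac)
qed

text \<open>Dominated convergence over the jumps: a jump between two fixed sites commutes with
  truncation once both lie below the cutoff.\<close>

lemma generator_trunc:
  assumes u: "lip_bound p u C" and \<eta>: "\<eta> \<in> Omega' p"
  shows "(\<lambda>n. generator g p u (trunc n \<eta>)) \<longlonglongrightarrow> generator g p u \<eta>"
  unfolding generator_eq[OF u \<eta>] generator_eq[OF u trunc_Omega']
proof (rule integral_dominated_convergence[where w = "\<lambda>xy. C * cost' \<eta> xy"])
  show "integrable (count_space UNIV) (\<lambda>xy. C * cost' \<eta> xy)" by (intro integrable_mult_right cost'_integral \<eta>)
  show "AE xy in count_space UNIV. (\<lambda>n. jump_term u (trunc n \<eta>) xy) \<longlonglongrightarrow> jump_term u \<eta> xy"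
  proof (intro AE_I2)
    fix xy :: "'d site \<times> 'd site"
    obtain x y where xy: "xy = (x, y)" by (cases xy)
    have "(\<lambda>n. p y * g (\<eta> x) * (u (trunc n (move x (x + y) \<eta>)) - u (trunc n \<eta>)))
      \<longlonglongrightarrow> p y * g (\<eta> x) * (u (move x (x + y) \<eta>) - u \<eta>)"
      by (intro tendsto_mult tendsto_const tendsto_diff lip_trunc[OF u] \<eta> move_mass)
    moreover have "eventually (\<lambda>n. p y * g (\<eta> x) * (u (trunc n (move x (x + y) \<eta>)) - u (trunc n \<eta>)) = jump_term u (trunc n \<eta>) (x, y)) sequentially"
      by (rule eventually_sequentiallyI[of "Suc (max (to_nat x) (to_nat (x + y)))"])
        (simp add: jump_term_def move_trunc trunc_eq)
    ultimately show "(\<lambda>n. jump_term u (trunc n \<eta>) xy) \<longlonglongrightarrow> jump_term u \<eta> xy"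
      unfolding xy by (subst (2) jump_term_def) (auto intro: Lim_transform_eventually)
  qed
  fix n
  show "AE xy in count_space UNIV. norm (jump_term u (trunc n \<eta>) xy) \<le> C * cost' \<eta> xy"
  proof (intro AE_I2)
    fix xy
    have "cost' (trunc n \<eta>) xy \<le> cost' \<eta> xy"
      using a0_nonneg trunc_le[of n \<eta>]
      by (auto simp: cost'_def split: prod.split intro!: mult_right_mono mult_left_mono add_nonneg_nonneg)
    then have "C * cost (trunc n \<eta>) xy \<le> C * cost' \<eta> xy"
      using cost_le[of "trunc n \<eta>" xy] lip_bound_nonneg[OF u] by (intro mult_left_mono) auto
    then show "norm (jump_term u (trunc n \<eta>) xy) \<le> C * cost' \<eta> xy"
      using jump_term_bound[OF u trunc_Omega', of n \<eta> xy] by simp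
  qed
qed auto

end


section \<open>The chain on finite configurations\<close>

context zero_range
begin

definition rate :: "'d config \<Rightarrow> 'd site \<times> 'd site \<Rightarrow> real" where
  "rate \<eta> = (\<lambda>(x, y). p y * g (\<eta> x))"

definition dest :: "'d config \<Rightarrow> 'd site \<times> 'd site \<Rightarrow> 'd config" where
  "dest \<eta> = (\<lambda>(x, y). move x (x + y) \<eta>)"

lemma rate_nonneg [simp]: "0 \<le> rate \<eta> xy"
  by (auto simp: rate_def split: prod.split)

lemma jump_term_eq: "jump_term u \<eta> xy = rate \<eta> xy * (u (dest \<eta> xy) - u \<eta>)"
  by (auto simp: jump_term_def rate_def dest_def split: prod.split)

lemma rate_integrable:
  assumes "\<eta> \<in> finite_configs"
  shows "integrable (count_space UNIV) (rate \<eta>)"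
proof (rule integrableI_nonneg)
  have fin: "finite {x. \<eta> x \<noteq> 0}" using assms by (simp add: finite_configs_def)
  have "(\<integral>\<^sup>+xy. ennreal (rate \<eta> xy) \<partial>count_space UNIV)
      = (\<integral>\<^sup>+x. \<integral>\<^sup>+y. ennreal (g (\<eta> x)) * ennreal (p y) \<partial>count_space UNIV \<partial>count_space UNIV)"
    by (subst nn_integral_fst_count_space[symmetric]) (simp add: rate_def ennreal_mult mult_ac)
  also have "\<dots> = (\<integral>\<^sup>+x. ennreal (g (\<eta> x)) \<partial>count_space UNIV)"
    by (simp add: nn_integral_cmult p_nn)
  also have "\<dots> = (\<integral>\<^sup>+x. ennreal (g (\<eta> x)) \<partial>count_space {x. \<eta> x \<noteq> 0})"
    by (rule nn_integral_count_space_eq) (auto intro!: gpos simp: Suc_le_eq)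
  also have "\<dots> = (\<Sum>x\<in>{x. \<eta> x \<noteq> 0}. ennreal (g (\<eta> x)))"
    using fin by (rule nn_integral_count_space_finite)
  also have "\<dots> < \<infinity>" by simp
  finally show "(\<integral>\<^sup>+xy. ennreal (rate \<eta> xy) \<partial>count_space UNIV) < \<infinity>" .
qed auto

lemma dest_finite: "\<eta> \<in> finite_configs \<Longrightarrow> dest \<eta> xy \<in> finite_configs"
proof (cases xy)
  case (Pair x y)
  assume "\<eta> \<in> finite_configs"
  then have "finite (insert (x + y) {x. \<eta> x \<noteq> 0})" by (simp add: finite_configs_def)
  moreover have "{u. dest \<eta> xy u \<noteq> 0} \<subseteq> insert (x + y) {x. \<eta> x \<noteq> 0}"
    by (auto simp: Pair dest_def move_apply split: if_splits)
  ultimately show ?thesis unfolding finite_configs_def by (auto dest: finite_subset)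
qed

text \<open>A measure on the uncountable configuration space is determined by its atoms if it is
  carried by finite configurations.\<close>

lemma countable_finite_configs: "countable (finite_configs :: 'd config set)"
proof -
  have "finite_configs \<subseteq> (\<lambda>xs. (\<lambda>x. case map_of xs x of None \<Rightarrow> 0 | Some k \<Rightarrow> k)) ` (UNIV :: ('d site \<times> nat) list set)"
  proof
    fix \<eta> :: "'d config" assume "\<eta> \<in> finite_configs"
    then have "finite {x. \<eta> x \<noteq> 0}" by (simp add: finite_configs_def)
    then obtain ys where ys: "set ys = {x. \<eta> x \<noteq> 0}" using finite_list by blast
    have "\<eta> = (\<lambda>x. case map_of (map (\<lambda>y. (y, \<eta> y)) ys) x of None \<Rightarrow> 0 | Some k \<Rightarrow> k)"
    proof
      fix x
      show "\<eta> x = (case map_of (map (\<lambda>y. (y, \<eta> y)) ys) x of None \<Rightarrow> 0 | Some k \<Rightarrow> k)"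
        using ys by (cases "x \<in> set ys") (auto simp: map_of_map_restrict restrict_map_def)
    qed
    then show "\<eta> \<in> (\<lambda>xs. (\<lambda>x. case map_of xs x of None \<Rightarrow> 0 | Some k \<Rightarrow> k)) ` UNIV" by blast
  qed
  then show ?thesis by (rule countable_subset) (intro countable_image countableI_type)
qed

text \<open>An image measure, because several pairs \<open>(x, y)\<close> can lead to the same
  configuration; jumps with \<open>y = 0\<close> contribute to the diagonal.\<close>

definition jump_rate :: "'d config \<Rightarrow> 'd config \<Rightarrow> real" where
  "jump_rate \<eta> \<zeta> = measure (distr (density (count_space UNIV) (\<lambda>xy. ennreal (rate \<eta> xy))) (count_space UNIV) (dest \<eta>)) {\<zeta>}"

text \<open>The image measure is carried by a countable set, so it has a density with respect to
  counting measure, and integrals change variables along \<open>dest\<close>.\<close>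

lemma jump_rate:
  assumes \<eta>: "\<eta> \<in> finite_configs"
  shows jump_rate_integrable: "integrable (count_space UNIV) (jump_rate \<eta>)"
    and jump_rate_outside: "\<zeta> \<notin> finite_configs \<Longrightarrow> jump_rate \<eta> \<zeta> = 0"
    and jump_rate_integral: "(\<integral>\<zeta>. jump_rate \<eta> \<zeta> * f \<zeta> \<partial>count_space UNIV)
      = (\<integral>xy. rate \<eta> xy * f (dest \<eta> xy) \<partial>count_space UNIV)"
proof -
  define R where "R = density (count_space UNIV) (\<lambda>xy. ennreal (rate \<eta> xy))"
  define D where "D = distr R (count_space UNIV) (dest \<eta>)"
  have [simp]: "space R = UNIV" "sets R = UNIV" "sets D = UNIV" "space D = UNIV" by (simp_all add: R_def D_def)
  have [measurable]: "dest \<eta> \<in> R \<rightarrow>\<^sub>M count_space UNIV" by (simp add: R_def)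
  have "emeasure R (space R) < \<infinity>"
    using integrableD(2)[OF rate_integrable[OF \<eta>]] by (simp add: R_def emeasure_density top.not_eq_extremum)
  then interpret R: finite_measure R by (intro finite_measureI) auto
  interpret D: finite_measure D unfolding D_def by (rule R.finite_measure_distr) measurable
  have jr: "jump_rate \<eta> \<zeta> = measure D {\<zeta>}" for \<zeta> by (simp add: jump_rate_def D_def R_def)
  have ae: "AE \<zeta> in D. \<zeta> \<in> finite_configs"
    unfolding D_def by (subst AE_distr_iff) (auto simp: dest_finite[OF \<eta>])
  show out: "jump_rate \<eta> \<zeta> = 0" if "\<zeta> \<notin> finite_configs" for \<zeta>
  proof -
    have "AE \<xi> in D. \<xi> \<notin> {\<zeta>}" using ae by eventually_elim (use that in auto)
    then show ?thesis unfolding jr by (subst (asm) AE_iff_measurable[of "{\<zeta>}"]) (auto simp: measure_def)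
  qed
  have "AE \<zeta> in density (count_space UNIV) (\<lambda>\<zeta>. ennreal (jump_rate \<eta> \<zeta>)). \<zeta> \<in> finite_configs"
    by (subst AE_density) (use out in \<open>force intro!: AE_I2\<close>)+
  then have eq: "D = density (count_space UNIV) (\<lambda>\<zeta>. ennreal (jump_rate \<eta> \<zeta>))"
    by (intro measure_eqI_countable_AE[OF _ _ ae _ countable_finite_configs])
      (auto simp: emeasure_density jr D.emeasure_eq_measure nn_integral_indicator_singleton)
  have "(\<integral>\<^sup>+\<zeta>. ennreal (jump_rate \<eta> \<zeta>) \<partial>count_space UNIV) = emeasure D UNIV"
    by (subst eq) (simp add: emeasure_density)
  then show "integrable (count_space UNIV) (jump_rate \<eta>)"
    by (intro integrableI_nonneg) (auto simp: jr D.emeasure_eq_measure)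
  have "(\<integral>\<zeta>. jump_rate \<eta> \<zeta> * f \<zeta> \<partial>count_space UNIV) = (\<integral>\<zeta>. f \<zeta> \<partial>D)"
    unfolding eq by (subst integral_density) (auto simp: jr)
  also have "\<dots> = (\<integral>xy. f (dest \<eta> xy) \<partial>R)" unfolding D_def by (rule integral_distr) auto
  also have "\<dots> = (\<integral>xy. rate \<eta> xy * f (dest \<eta> xy) \<partial>count_space UNIV)"
    unfolding R_def by (subst integral_density) auto
  finally show "(\<integral>\<zeta>. jump_rate \<eta> \<zeta> * f \<zeta> \<partial>count_space UNIV)
      = (\<integral>xy. rate \<eta> xy * f (dest \<eta> xy) \<partial>count_space UNIV)" .
qed

lemma jump_rate_nonneg [simp]: "0 \<le> jump_rate \<eta> \<zeta>"
  by (simp add: jump_rate_def)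

lemma bounded_times_integrable:
  assumes "integrable (count_space UNIV) r" "\<And>x. \<bar>f x\<bar> \<le> M"
  shows "integrable (count_space UNIV) (\<lambda>x. r x * f x :: real)"
proof (rule Bochner_Integration.integrable_bound[OF integrable_mult_right[OF assms(1), of M]])
  have "0 \<le> M" using assms(2) abs_ge_zero order_trans by blast
  then show "AE x in count_space UNIV. norm (r x * f x) \<le> norm (M * r x)"
    using assms(2) by (auto simp: abs_mult mult.commute[of M] intro!: mult_left_mono)
qed simp

lemma generator_finite:
  assumes "\<eta> \<in> finite_configs" "\<And>\<zeta>. \<bar>u \<zeta>\<bar> \<le> M"
  shows "generator g p u \<eta> = (\<integral>xy. rate \<eta> xy * (u (dest \<eta> xy) - u \<eta>) \<partial>count_space UNIV)"
proof -
  have "\<bar>u \<zeta> - u \<eta>\<bar> \<le> 2 * M" for \<zeta> using assms(2)[of \<zeta>] assms(2)[of \<eta>] by linarith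
  then have "integrable (count_space UNIV) (jump_term u \<eta>)"
    unfolding jump_term_eq[abs_def] by (rule bounded_times_integrable[OF rate_integrable[OF assms(1)]])
  from infsum_eq_integral_count_space[OF this] show ?thesis
    by (simp add: generator_def jump_term_def[symmetric] jump_term_eq[symmetric])
qed

text \<open>The jump rates are the \<open>\<ell>\<^sup>1\<close> limit of the rescaled transition probabilities, by Scheffe's lemma.\<close>
lemma chain_expansion:
  assumes K: "zero_range_chain g p K" and \<eta>: "\<eta> \<in> finite_configs"
    and s: "\<And>n. 0 < s n" "s \<longlonglongrightarrow> 0"
    and v: "\<And>n \<zeta>. \<bar>v n \<zeta>\<bar> \<le> M" "\<And>\<zeta>. \<zeta> \<in> finite_configs \<Longrightarrow> (\<lambda>n. v n \<zeta>) \<longlonglongrightarrow> v' \<zeta>"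
  shows "(\<lambda>n. (measure_pmf.expectation (K (s n) \<eta>) (v n) - v n \<eta>) / s n)
    \<longlonglongrightarrow> (\<integral>xy. rate \<eta> xy * (v' (dest \<eta> xy) - v' \<eta>) \<partial>count_space UNIV)"
proof -
  have M0: "0 \<le> M" using v(1)[of 0 \<eta>] by linarith
  have K0: "K 0 \<eta> = return_pmf \<eta>" and Kset: "\<And>t. 0 \<le> t \<Longrightarrow> set_pmf (K t \<eta>) \<subseteq> finite_configs"
    and Kder: "\<And>\<zeta>. \<zeta> \<in> finite_configs \<Longrightarrow> ((\<lambda>t. pmf (K t \<eta>) \<zeta>) has_real_derivative
        generator g p (indicator {\<zeta>}) \<eta>) (at 0 within {0..})"
    using K \<eta> by (auto simp: zero_range_chain_def)
  \<comment> \<open>The derivative of the transition probability at time 0; on the diagonal it is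
    minus the rate of leaving \<eta>.\<close>
  have lim: "(\<lambda>n. (pmf (K (s n) \<eta>) \<zeta> - of_bool (\<zeta> = \<eta>)) / s n) \<longlonglongrightarrow>
      (\<integral>xy. rate \<eta> xy * (indicator {\<zeta>} (dest \<eta> xy) - of_bool (\<zeta> = \<eta>)) \<partial>count_space UNIV)"
    if "\<zeta> \<in> finite_configs" for \<zeta>
  proof -
    have "((\<lambda>t. (pmf (K t \<eta>) \<zeta> - pmf (K 0 \<eta>) \<zeta>) / (t - 0)) \<longlongrightarrow> generator g p (indicator {\<zeta>}) \<eta>) (at 0 within {0..})"
      using Kder[OF that] by (simp add: has_field_derivative_iff)
    moreover have "filterlim s (at 0 within {0..}) sequentially"
      using s by (auto simp: filterlim_at intro!: always_eventually less_imp_le) (metis less_irrefl)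
    ultimately have "(\<lambda>n. (pmf (K (s n) \<eta>) \<zeta> - pmf (K 0 \<eta>) \<zeta>) / (s n - 0)) \<longlonglongrightarrow> generator g p (indicator {\<zeta>}) \<eta>"
      by (rule filterlim_compose)
    moreover have "pmf (K 0 \<eta>) \<zeta> = of_bool (\<zeta> = \<eta>)" by (auto simp: K0 indicator_def)
    moreover have "generator g p (indicator {\<zeta>}) \<eta> = (\<integral>xy. rate \<eta> xy * (indicator {\<zeta>} (dest \<eta> xy) - of_bool (\<zeta> = \<eta>)) \<partial>count_space UNIV)"
      by (subst generator_finite[OF \<eta>, of _ 1]) (auto simp: indicator_def of_bool_def intro!: Bochner_Integration.integral_cong)
    ultimately show ?thesis by simp
  qed
  \<comment> \<open>The diagonal is removed because its rescaled mass diverges, while the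
    off-diagonal parts converge to the rates.\<close>
  define k where "k n \<zeta> = of_bool (\<zeta> \<noteq> \<eta>) * pmf (K (s n) \<eta>) \<zeta> / s n" for n \<zeta>
  define q where "q \<zeta> = of_bool (\<zeta> \<noteq> \<eta>) * jump_rate \<eta> \<zeta>" for \<zeta>
  have s0: "0 \<le> s n" "s n \<noteq> 0" for n using s(1)[of n] by auto
  have k0: "0 \<le> k n \<zeta>" and q0: "0 \<le> q \<zeta>" for n \<zeta> using s0 by (auto simp: k_def q_def)
  have kint: "integrable (count_space UNIV) (k n)" for n
    unfolding k_def using bounded_times_integrable[OF integrable_pmf, of "\<lambda>\<zeta>. of_bool (\<zeta> \<noteq> \<eta>)" 1 "K (s n) \<eta>"]
    by (simp add: mult.commute)
  have qint: "integrable (count_space UNIV) q"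
    unfolding q_def using bounded_times_integrable[OF jump_rate_integrable[OF \<eta>], of "\<lambda>\<zeta>. of_bool (\<zeta> \<noteq> \<eta>)" 1]
    by (simp add: mult.commute)
  have kq: "(\<lambda>n. k n \<zeta>) \<longlonglongrightarrow> q \<zeta>" for \<zeta>
  proof (cases "\<zeta> \<in> finite_configs \<and> \<zeta> \<noteq> \<eta>")
    case True
    have "(\<integral>xy. rate \<eta> xy * (indicator {\<zeta>} (dest \<eta> xy) - of_bool (\<zeta> = \<eta>)) \<partial>count_space UNIV)
        = (\<integral>xy. rate \<eta> xy * indicator {\<zeta>} (dest \<eta> xy) \<partial>count_space UNIV)" using True by simp
    also have "\<dots> = (\<integral>\<xi>. jump_rate \<eta> \<xi> * indicator {\<zeta>} \<xi> \<partial>count_space UNIV)"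
      by (rule jump_rate_integral[OF \<eta>, symmetric])
    also have "\<dots> = (\<integral>\<xi>. of_bool (\<xi> = \<zeta>) * jump_rate \<eta> \<xi> \<partial>count_space UNIV)"
      by (intro Bochner_Integration.integral_cong) (auto simp: indicator_def)
    also have "\<dots> = jump_rate \<eta> \<zeta>"
    proof -
      have "(\<lambda>\<xi>. of_bool (\<xi> = \<zeta>) * jump_rate \<eta> \<xi>) = (\<lambda>\<xi>. indicator {\<zeta>} \<xi> *\<^sub>R jump_rate \<eta> \<zeta>)" by (auto simp: indicator_def)
      then show ?thesis by simp
    qed
    finally show ?thesis using lim[of \<zeta>] True by (simp add: k_def q_def)
  next
    case False
    then have "k n \<zeta> = 0" "q \<zeta> = 0" for n
      using Kset[OF s0(1), of n] jump_rate_outside[OF \<eta>] by (auto simp: k_def q_def pmf_eq_0_set_pmf)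
    then show ?thesis by simp
  qed
  have kmass: "(\<integral>\<zeta>. k n \<zeta> \<partial>count_space UNIV) = (1 - pmf (K (s n) \<eta>) \<eta>) / s n" for n
  proof -
    have "(\<lambda>\<zeta>. k n \<zeta>) = (\<lambda>\<zeta>. (pmf (K (s n) \<eta>) \<zeta> - indicator {\<eta>} \<zeta> *\<^sub>R pmf (K (s n) \<eta>) \<eta>) / s n)"
      by (auto simp: k_def indicator_def)
    then have "(\<integral>\<zeta>. k n \<zeta> \<partial>count_space UNIV) = (\<integral>\<zeta>. pmf (K (s n) \<eta>) \<zeta> - indicator {\<eta>} \<zeta> *\<^sub>R pmf (K (s n) \<eta>) \<eta> \<partial>count_space UNIV) / s n"
      by simp
    also have "\<dots> = (1 - pmf (K (s n) \<eta>) \<eta>) / s n"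
      by (subst Bochner_Integration.integral_diff) (auto simp: integrable_pmf integral_pmf)
    finally show ?thesis .
  qed
  have qmass: "(\<integral>\<zeta>. q \<zeta> \<partial>count_space UNIV) = (\<integral>xy. rate \<eta> xy * of_bool (dest \<eta> xy \<noteq> \<eta>) \<partial>count_space UNIV)"
    unfolding q_def by (subst jump_rate_integral[OF \<eta>, symmetric]) (simp add: mult.commute)
  \<comment> \<open>Conservation of probability turns the derivative of the diagonal entry into
    convergence of the total off-diagonal mass, the hypothesis of Scheffe's lemma.\<close>
  have masslim: "(\<lambda>n. \<integral>\<zeta>. k n \<zeta> \<partial>count_space UNIV) \<longlonglongrightarrow> (\<integral>\<zeta>. q \<zeta> \<partial>count_space UNIV)"
  proof -
    have "(\<lambda>n. - ((pmf (K (s n) \<eta>) \<eta> - 1) / s n)) \<longlonglongrightarrow>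
      - (\<integral>xy. rate \<eta> xy * (indicator {\<eta>} (dest \<eta> xy) - 1) \<partial>count_space UNIV)"
      using tendsto_minus[OF lim[OF \<eta>]] by simp
    also have "(\<lambda>n. - ((pmf (K (s n) \<eta>) \<eta> - 1) / s n)) = (\<lambda>n. \<integral>\<zeta>. k n \<zeta> \<partial>count_space UNIV)"
      unfolding kmass by (simp add: minus_divide_left)
    also have "- (\<integral>xy. rate \<eta> xy * (indicator {\<eta>} (dest \<eta> xy) - 1) \<partial>count_space UNIV) = (\<integral>\<zeta>. q \<zeta> \<partial>count_space UNIV)"
      unfolding qmass Bochner_Integration.integral_minus[symmetric]
      by (intro Bochner_Integration.integral_cong) (auto simp: indicator_def)
    finally show ?thesis .
  qed
  have nnk: "(\<integral>\<^sup>+\<zeta>. ennreal (norm (k n \<zeta>)) \<partial>count_space UNIV) = ennreal (\<integral>\<zeta>. k n \<zeta> \<partial>count_space UNIV)" for n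
    using nn_integral_eq_integral[OF kint[of n]] k0 by simp
  have nnq: "(\<integral>\<^sup>+\<zeta>. ennreal (norm (q \<zeta>)) \<partial>count_space UNIV) = ennreal (\<integral>\<zeta>. q \<zeta> \<partial>count_space UNIV)"
    using nn_integral_eq_integral[OF qint] q0 by simp
  have "(\<lambda>n. \<integral>\<^sup>+\<zeta>. norm (k n \<zeta> - q \<zeta>) \<partial>count_space UNIV) \<longlonglongrightarrow> 0"
  proof (rule Scheffe_lemma1[OF kint qint])
    show "limsup (\<lambda>n. \<integral>\<^sup>+\<zeta>. ennreal (norm (k n \<zeta>)) \<partial>count_space UNIV) \<le> (\<integral>\<^sup>+\<zeta>. ennreal (norm (q \<zeta>)) \<partial>count_space UNIV)"
      unfolding nnk nnq using tendsto_ennrealI[OF masslim] by (simp add: lim_imp_Limsup)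
  qed (use kq in auto)
  then have "(\<lambda>n. ennreal (\<integral>\<zeta>. \<bar>k n \<zeta> - q \<zeta>\<bar> \<partial>count_space UNIV)) \<longlonglongrightarrow> ennreal 0"
    using kint qint by (subst nn_integral_eq_integral[symmetric]) auto
  then have l1: "(\<lambda>n. \<integral>\<zeta>. \<bar>k n \<zeta> - q \<zeta>\<bar> \<partial>count_space UNIV) \<longlonglongrightarrow> 0"
    by (subst (asm) tendsto_ennreal_iff) auto
  \<comment> \<open>Centred at \<eta>, so that the removed diagonal contributes nothing to the
    expectation.\<close>
  define d where "d n \<zeta> = v n \<zeta> - v n \<eta>" for n \<zeta>
  have d: "\<bar>d n \<zeta>\<bar> \<le> 2 * M" for n \<zeta> using v(1)[of n \<zeta>] v(1)[of n \<eta>] by (simp add: d_def)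
  have kd: "(measure_pmf.expectation (K (s n) \<eta>) (v n) - v n \<eta>) / s n = (\<integral>\<zeta>. k n \<zeta> * d n \<zeta> \<partial>count_space UNIV)" for n
  proof -
    have iv: "integrable (measure_pmf (K (s n) \<eta>)) (v n)"
      by (rule measure_pmf.integrable_const_bound[of _ M]) (use v(1) in auto)
    have "measure_pmf.expectation (K (s n) \<eta>) (v n) - v n \<eta> = measure_pmf.expectation (K (s n) \<eta>) (d n)"
      unfolding d_def using iv by (subst Bochner_Integration.integral_diff) auto
    also have "\<dots> = (\<integral>\<zeta>. pmf (K (s n) \<eta>) \<zeta> * d n \<zeta> \<partial>count_space UNIV)"
      unfolding measure_pmf_eq_density by (subst integral_density) auto
    also have "\<dots> = (\<integral>\<zeta>. s n * (k n \<zeta> * d n \<zeta>) \<partial>count_space UNIV)"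
      using s0 by (intro Bochner_Integration.integral_cong) (auto simp: k_def d_def)
    finally show ?thesis using s0 by simp
  qed
  have "(\<lambda>n. (\<integral>\<zeta>. k n \<zeta> * d n \<zeta> \<partial>count_space UNIV) - (\<integral>\<zeta>. q \<zeta> * d n \<zeta> \<partial>count_space UNIV)) \<longlonglongrightarrow> 0"
  proof (rule Lim_null_comparison)
    show "(\<lambda>n. 2 * M * (\<integral>\<zeta>. \<bar>k n \<zeta> - q \<zeta>\<bar> \<partial>count_space UNIV)) \<longlonglongrightarrow> 0"
      using tendsto_mult[OF tendsto_const l1, of "2 * M"] by simp
    have "\<bar>(\<integral>\<zeta>. k n \<zeta> * d n \<zeta> \<partial>count_space UNIV) - (\<integral>\<zeta>. q \<zeta> * d n \<zeta> \<partial>count_space UNIV)\<bar>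
        \<le> 2 * M * (\<integral>\<zeta>. \<bar>k n \<zeta> - q \<zeta>\<bar> \<partial>count_space UNIV)" for n
    proof -
      have i: "integrable (count_space UNIV) (\<lambda>\<zeta>. k n \<zeta> * d n \<zeta>)" "integrable (count_space UNIV) (\<lambda>\<zeta>. q \<zeta> * d n \<zeta>)"
        by (intro bounded_times_integrable[OF _ d] kint qint)+
      have "\<bar>(\<integral>\<zeta>. k n \<zeta> * d n \<zeta> \<partial>count_space UNIV) - (\<integral>\<zeta>. q \<zeta> * d n \<zeta> \<partial>count_space UNIV)\<bar>
        = \<bar>\<integral>\<zeta>. (k n \<zeta> - q \<zeta>) * d n \<zeta> \<partial>count_space UNIV\<bar>"
        using i by (simp add: left_diff_distrib)
      also have "\<dots> \<le> (\<integral>\<zeta>. \<bar>(k n \<zeta> - q \<zeta>) * d n \<zeta>\<bar> \<partial>count_space UNIV)" by (rule integral_abs_bound)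
      also have "\<dots> \<le> (\<integral>\<zeta>. 2 * M * \<bar>k n \<zeta> - q \<zeta>\<bar> \<partial>count_space UNIV)"
      proof (intro integral_mono integrable_mult_right integrable_abs)
        show "integrable (count_space UNIV) (\<lambda>\<zeta>. (k n \<zeta> - q \<zeta>) * d n \<zeta>)"
          by (intro bounded_times_integrable[OF _ d] Bochner_Integration.integrable_diff kint qint)
        show "\<bar>(k n \<zeta> - q \<zeta>) * d n \<zeta>\<bar> \<le> 2 * M * \<bar>k n \<zeta> - q \<zeta>\<bar>" for \<zeta>
          using mult_left_mono[OF d[of n \<zeta>], of "\<bar>k n \<zeta> - q \<zeta>\<bar>"] by (simp add: abs_mult mult_ac)
      qed (intro Bochner_Integration.integrable_diff kint qint)
      finally show ?thesis by simp
    qed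
    then show "\<forall>\<^sub>F n in sequentially. norm ((\<integral>\<zeta>. k n \<zeta> * d n \<zeta> \<partial>count_space UNIV) - (\<integral>\<zeta>. q \<zeta> * d n \<zeta> \<partial>count_space UNIV))
       \<le> 2 * M * (\<integral>\<zeta>. \<bar>k n \<zeta> - q \<zeta>\<bar> \<partial>count_space UNIV)" by simp
  qed
  moreover have "(\<lambda>n. \<integral>\<zeta>. q \<zeta> * d n \<zeta> \<partial>count_space UNIV) \<longlonglongrightarrow> (\<integral>\<zeta>. q \<zeta> * (v' \<zeta> - v' \<eta>) \<partial>count_space UNIV)"
  proof (rule integral_dominated_convergence[where w = "\<lambda>\<zeta>. 2 * M * q \<zeta>"])
    show "AE \<zeta> in count_space UNIV. (\<lambda>n. q \<zeta> * d n \<zeta>) \<longlonglongrightarrow> q \<zeta> * (v' \<zeta> - v' \<eta>)"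
    proof (intro AE_I2)
      fix \<zeta>
      show "(\<lambda>n. q \<zeta> * d n \<zeta>) \<longlonglongrightarrow> q \<zeta> * (v' \<zeta> - v' \<eta>)"
      proof (cases "\<zeta> \<in> finite_configs")
        case True
        then show ?thesis unfolding d_def by (intro tendsto_mult tendsto_const tendsto_diff v(2) \<eta>)
      qed (simp add: q_def jump_rate_outside[OF \<eta>])
    qed
    show "AE \<zeta> in count_space UNIV. norm (q \<zeta> * d n \<zeta>) \<le> 2 * M * q \<zeta>" for n
      using d q0 by (auto simp: abs_mult mult.commute[of "2 * M"] intro!: mult_left_mono)
  qed (use qint in auto)
  ultimately have "(\<lambda>n. \<integral>\<zeta>. k n \<zeta> * d n \<zeta> \<partial>count_space UNIV) \<longlonglongrightarrow> (\<integral>\<zeta>. q \<zeta> * (v' \<zeta> - v' \<eta>) \<partial>count_space UNIV)"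
    by (rule Lim_transform[rotated])
  also have "(\<integral>\<zeta>. q \<zeta> * (v' \<zeta> - v' \<eta>) \<partial>count_space UNIV) = (\<integral>\<zeta>. jump_rate \<eta> \<zeta> * (v' \<zeta> - v' \<eta>) \<partial>count_space UNIV)"
    by (intro Bochner_Integration.integral_cong) (auto simp: q_def)
  also have "\<dots> = (\<integral>xy. rate \<eta> xy * (v' (dest \<eta> xy) - v' \<eta>) \<partial>count_space UNIV)"
    by (rule jump_rate_integral[OF \<eta>])
  finally show ?thesis unfolding kd .
qed

end


section \<open>Small times\<close>

locale zero_range_process = zero_range g p a0
  for g :: "nat \<Rightarrow> real" and p :: "'d::finite site \<Rightarrow> real" and a0 :: real +
  fixes P :: "real \<Rightarrow> 'd observable \<Rightarrow> 'd observable"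
  assumes semigroup: "zero_range_semigroup g a0 p P"
begin

definition blip :: "real \<Rightarrow> real \<Rightarrow> 'd observable \<Rightarrow> bool" where
  "blip C M u \<longleftrightarrow> u \<in> Lip p \<and> lip_bound p u C \<and> (\<forall>\<eta>. \<bar>u \<eta>\<bar> \<le> M)"

lemma blipD:
  assumes "blip C M u"
  shows "u \<in> Lip p" "lip_bound p u C" "\<bar>u \<eta>\<bar> \<le> M" "0 \<le> C" "0 \<le> M"
proof -
  show u: "u \<in> Lip p" "lip_bound p u C" "\<bar>u \<eta>\<bar> \<le> M" using assms by (auto simp: blip_def)
  show "0 \<le> C" using u(2) by (rule lip_bound_nonneg)
  show "0 \<le> M" using u(3) by linarith
qed

definition K :: "real \<Rightarrow> 'd config \<Rightarrow> 'd config pmf" where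
  "K = (SOME K. zero_range_chain g p K \<and>
        (\<forall>t\<ge>0. \<forall>f\<in>Lip p. \<forall>\<eta>\<in>finite_configs. P t f \<eta> = measure_pmf.expectation (K t \<eta>) f))"

lemma K_props: "zero_range_chain g p K"
  "0 \<le> t \<Longrightarrow> f \<in> Lip p \<Longrightarrow> \<eta> \<in> finite_configs \<Longrightarrow> P t f \<eta> = measure_pmf.expectation (K t \<eta>) f"
proof -
  have ex: "\<exists>K. zero_range_chain g p K \<and>
        (\<forall>t\<ge>0. \<forall>f\<in>Lip p. \<forall>\<eta>\<in>finite_configs. P t f \<eta> = measure_pmf.expectation (K t \<eta>) f)"
    using semigroup unfolding zero_range_semigroup_def by blast
  note k = someI_ex[OF this, folded K_def]
  show "zero_range_chain g p K" using k by blast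
  show "0 \<le> t \<Longrightarrow> f \<in> Lip p \<Longrightarrow> \<eta> \<in> finite_configs \<Longrightarrow> P t f \<eta> = measure_pmf.expectation (K t \<eta>) f"
    using k by blast
qed

lemma P_Lip: "0 \<le> t \<Longrightarrow> f \<in> Lip p \<Longrightarrow> P t f \<in> Lip p"
  using semigroup unfolding zero_range_semigroup_def by blast

lemma P_0: "f \<in> Lip p \<Longrightarrow> P 0 f = f"
  using semigroup unfolding zero_range_semigroup_def by blast

lemma P_add: "0 \<le> s \<Longrightarrow> 0 \<le> t \<Longrightarrow> f \<in> Lip p \<Longrightarrow> P (s + t) f = P s (P t f)"
  using semigroup unfolding zero_range_semigroup_def by blast

lemma P_lip_const: "0 \<le> t \<Longrightarrow> f \<in> Lip p \<Longrightarrow> lip_const p (P t f) \<le> lip_const p f * exp (4 * a0 * t)"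
  using semigroup unfolding zero_range_semigroup_def by blast

lemma P_lip_bound:
  assumes "0 \<le> t" "f \<in> Lip p" "lip_bound p f C"
  shows "lip_bound p (P t f) (C * exp (4 * a0 * t))"
  by (rule lip_bound_mono[OF lip_bound_lip_const[OF P_Lip[OF assms(1,2)]]])
    (use order_trans[OF P_lip_const[OF assms(1,2)] mult_right_mono[OF lip_const_le[OF assms(3)]]] in auto)

text \<open>Expectations contract the supremum norm on finite configurations; truncation extends
  this to \<open>Omega'\<close>, and elsewhere elements of \<open>Lip p\<close> vanish.\<close>

lemma P_bound:
  assumes "0 \<le> t" "blip C M u"
  shows "\<bar>P t u \<eta>\<bar> \<le> M"
proof (cases "\<eta> \<in> Omega' p")
  case False
  then have "P t u \<eta> = 0" using P_Lip[OF assms(1) blipD(1)[OF assms(2)]] by (simp add: Lip_def)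
  then show ?thesis using blipD(5)[OF assms(2)] by simp
next
  case True
  have fin: "\<bar>P t u \<zeta>\<bar> \<le> M" if "\<zeta> \<in> finite_configs" for \<zeta>
  proof -
    have "\<bar>P t u \<zeta>\<bar> \<le> measure_pmf.expectation (K t \<zeta>) (\<lambda>\<xi>. \<bar>u \<xi>\<bar>)"
      unfolding K_props(2)[OF assms(1) blipD(1)[OF assms(2)] that] by (rule integral_abs_bound)
    also have "\<dots> \<le> measure_pmf.expectation (K t \<zeta>) (\<lambda>_. M)"
      using blipD(3,5)[OF assms(2)] by (intro integral_mono measure_pmf.integrable_const_bound[of _ M]) auto
    finally show ?thesis by simp
  qed
  have "(\<lambda>n. P t u (trunc n \<eta>)) \<longlonglongrightarrow> P t u \<eta>"
    by (rule lip_trunc[OF P_lip_bound[OF assms(1) blipD(1,2)[OF assms(2)]] True])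
  then have "(\<lambda>n. \<bar>P t u (trunc n \<eta>)\<bar>) \<longlonglongrightarrow> \<bar>P t u \<eta>\<bar>" by (rule tendsto_rabs)
  then show ?thesis by (rule LIMSEQ_le_const2) (use fin trunc_finite in auto)
qed

lemma blip_P: "0 \<le> t \<Longrightarrow> blip C M u \<Longrightarrow> blip (C * exp (4 * a0 * t)) M (P t u)"
  unfolding blip_def using P_Lip P_lip_bound P_bound[unfolded blip_def] by blast

text \<open>The backward equation. The additional time \<open>s\<close> is spent first, so the
  expansion of the chain at time 0 applies to the fixed function \<open>P t u\<close>.\<close>

lemma P_right_derivative_finite:
  assumes t: "0 \<le> t" and u: "blip C M u" and \<eta>: "\<eta> \<in> finite_configs"
  shows "((\<lambda>s. (P (t + s) u \<eta> - P t u \<eta>) / s) \<longlongrightarrow> generator g p (P t u) \<eta>) (at_right 0)"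
proof (rule tendsto_at_right_sequentially[of 0 1])
  fix S :: "nat \<Rightarrow> real" assume S: "\<And>n. 0 < S n" "S \<longlonglongrightarrow> 0"
  have S0: "0 \<le> S n" for n using S(1)[of n] by simp
  have Pt: "P (t + S n) u \<eta> = measure_pmf.expectation (K (S n) \<eta>) (P t u)" for n
    using K_props(2)[OF S0 P_Lip[OF t blipD(1)[OF u]] \<eta>] P_add[OF S0 t blipD(1)[OF u]] by (simp add: add.commute)
  show "(\<lambda>n. (P (t + S n) u \<eta> - P t u \<eta>) / S n) \<longlonglongrightarrow> generator g p (P t u) \<eta>"
    unfolding Pt generator_finite[of \<eta> "P t u", OF \<eta> P_bound[OF t u]]
    by (rule chain_expansion[OF K_props(1) \<eta> S, of "\<lambda>_. P t u" M]) (use P_bound[OF t u] in auto)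
qed simp

text \<open>The increment is at most \<open>2 * M\<close> times the probability that the chain is
  not at \<eta> at time \<open>s\<close>, a modulus that does not depend on
  \<open>t\<close>.\<close>

lemma P_continuous_finite:
  assumes u: "blip C M u" and \<eta>: "\<eta> \<in> finite_configs"
  shows "continuous_on {0..T} (\<lambda>t. P t u \<eta>)"
proof (rule right_lipschitz_continuous_on)
  have "((\<lambda>t. pmf (K t \<eta>) \<eta>) has_real_derivative generator g p (indicator {\<eta>}) \<eta>) (at 0 within {0..})"
    and K0: "K 0 \<eta> = return_pmf \<eta>"
    using K_props(1) \<eta> by (auto simp: zero_range_chain_def)
  then have "((\<lambda>t. pmf (K t \<eta>) \<eta>) \<longlongrightarrow> 1) (at 0 within {0..})"
    using DERIV_continuous[of "\<lambda>t. pmf (K t \<eta>) \<eta>" _ 0 "{0..}"] by (auto simp: continuous_within)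
  then have "((\<lambda>t. pmf (K t \<eta>) \<eta>) \<longlongrightarrow> 1) (at_right 0)" by (rule tendsto_within_subset) auto
  then have "((\<lambda>s. 2 * M * (1 - pmf (K s \<eta>) \<eta>)) \<longlongrightarrow> 2 * M * (1 - 1)) (at_right 0)"
    by (intro tendsto_mult tendsto_const tendsto_diff)
  then show "((\<lambda>s. 2 * M * (1 - pmf (K s \<eta>) \<eta>)) \<longlongrightarrow> 0) (at_right 0)" by simp
  fix t s :: real assume ts: "0 \<le> t" "0 < s" "t + s \<le> T"
  define v where "v = P t u"
  have v: "\<bar>v \<zeta>\<bar> \<le> M" for \<zeta> unfolding v_def by (rule P_bound[OF ts(1) u])
  have iv: "integrable (measure_pmf (K s \<eta>)) v"
    by (rule measure_pmf.integrable_const_bound[of _ M]) (use v in auto)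
  have "P (t + s) u \<eta> - P t u \<eta> = measure_pmf.expectation (K s \<eta>) v - v \<eta>"
    using K_props(2)[OF _ P_Lip[OF ts(1) blipD(1)[OF u]] \<eta>, of s] P_add[OF _ ts(1) blipD(1)[OF u], of s] ts
    by (simp add: add.commute v_def)
  also have "\<dots> = measure_pmf.expectation (K s \<eta>) (\<lambda>\<zeta>. v \<zeta> - v \<eta>)"
    using iv by (subst Bochner_Integration.integral_diff) auto
  also have "\<bar>\<dots>\<bar> \<le> measure_pmf.expectation (K s \<eta>) (\<lambda>\<zeta>. \<bar>v \<zeta> - v \<eta>\<bar>)" by (rule integral_abs_bound)
  also have "\<dots> \<le> measure_pmf.expectation (K s \<eta>) (\<lambda>\<zeta>. 2 * M * (1 - indicator {\<eta>} \<zeta>))"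
  proof (rule integral_mono)
    show "integrable (measure_pmf (K s \<eta>)) (\<lambda>\<zeta>. \<bar>v \<zeta> - v \<eta>\<bar>)" using iv by auto
    show "\<bar>v \<zeta> - v \<eta>\<bar> \<le> 2 * M * (1 - indicator {\<eta>} \<zeta>)" for \<zeta>
      using v[of \<zeta>] v[of \<eta>] by (auto simp: indicator_def)
  qed (auto intro!: Bochner_Integration.integrable_diff integrable_mult_right integrable_real_indicator simp: measure_pmf.emeasure_eq_measure)
  also have "\<dots> = 2 * M * (1 - pmf (K s \<eta>) \<eta>)"
    by (subst integral_mult_right_zero, subst Bochner_Integration.integral_diff)
      (auto simp: pmf.rep_eq measure_pmf.emeasure_eq_measure)
  finally show "\<bar>P (t + s) u \<eta> - P t u \<eta>\<bar> \<le> 2 * M * (1 - pmf (K s \<eta>) \<eta>)" .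
qed

text \<open>The generator bound is integrated along the backward equation. It sees the configuration
  through its mass only, which truncation does not increase, so it survives the passage to
  \<open>Omega'\<close>.\<close>

lemma small_time_bound:
  assumes t: "0 \<le> t" and u: "blip C M u" and \<eta>: "\<eta> \<in> Omega' p"
  shows "\<bar>P t u \<eta> - u \<eta>\<bar> \<le> 3 * a0 * (C * exp (4 * a0 * t)) * mass \<eta> * t"
proof -
  have fin: "\<bar>P t u \<zeta> - u \<zeta>\<bar> \<le> 3 * a0 * (C * exp (4 * a0 * t)) * mass \<zeta> * t" if \<zeta>: "\<zeta> \<in> finite_configs" for \<zeta>
  proof -
    have "\<bar>P t u \<zeta> - P 0 u \<zeta>\<bar> \<le> 3 * a0 * (C * exp (4 * a0 * t)) * mass \<zeta> * t"
    proof (rule right_growth_bound[OF t P_continuous_finite[OF u \<zeta>] P_right_derivative_finite[OF _ u \<zeta>]])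
      fix s assume s: "0 \<le> s" "s < t"
      have "\<bar>generator g p (P s u) \<zeta>\<bar> \<le> 3 * a0 * (C * exp (4 * a0 * s)) * mass \<zeta>"
        by (rule generator_bound[OF blipD(2)[OF blip_P[OF s(1) u]] finite_in_Omega'[OF \<zeta>]])
      also have "\<dots> \<le> 3 * a0 * (C * exp (4 * a0 * t)) * mass \<zeta>"
        using s a0_nonneg blipD(4)[OF u] by (intro mult_right_mono mult_left_mono) (auto intro: mult_left_mono)
      finally show "\<bar>generator g p (P s u) \<zeta>\<bar> \<le> 3 * a0 * (C * exp (4 * a0 * t)) * mass \<zeta>" .
    qed
    then show ?thesis by (simp add: P_0[OF blipD(1)[OF u]])
  qed
  have "(\<lambda>n. \<bar>P t u (trunc n \<eta>) - u (trunc n \<eta>)\<bar>) \<longlonglongrightarrow> \<bar>P t u \<eta> - u \<eta>\<bar>"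
    by (intro tendsto_rabs tendsto_diff lip_trunc[OF blipD(2)[OF u] \<eta>] lip_trunc[OF P_lip_bound[OF t blipD(1,2)[OF u]] \<eta>])
  then show ?thesis
  proof (rule LIMSEQ_le_const2)
    have "\<bar>P t u (trunc n \<eta>) - u (trunc n \<eta>)\<bar> \<le> 3 * a0 * (C * exp (4 * a0 * t)) * mass \<eta> * t" for n
      by (rule order_trans[OF fin[OF trunc_finite]])
        (use a0_nonneg blipD(4)[OF u] t \<eta> in \<open>intro mult_right_mono mult_left_mono mass_mono trunc_le; simp\<close>)
    then show "\<exists>N. \<forall>n\<ge>N. \<bar>P t u (trunc n \<eta>) - u (trunc n \<eta>)\<bar> \<le> 3 * a0 * (C * exp (4 * a0 * t)) * mass \<eta> * t" by blast
  qed
qed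

text \<open>Up to a constant, this bounds the change in the contribution of one jump to the
  generator when \<open>u\<close> becomes \<open>P r u\<close>. The minimum joins the Lipschitz
  estimate to the small-time estimates at both ends of the jump; their masses add up to at most
  \<open>2 * mass \<eta> + 2\<close> because \<beta> is at most 2.\<close>

definition modulus_term :: "'d config \<Rightarrow> real \<Rightarrow> 'd site \<times> 'd site \<Rightarrow> real" where
  "modulus_term \<eta> r = (\<lambda>(x, y). p y * (a0 * real (\<eta> x)) * min (\<beta> p x + \<beta> p (x + y)) (r * (2 * mass \<eta> + 2)))"

definition modulus :: "'d config \<Rightarrow> real \<Rightarrow> real" where
  "modulus \<eta> r = (\<integral>xy. modulus_term \<eta> r xy \<partial>count_space UNIV)"

lemma modulus_term_bounds:
  assumes "0 \<le> r"
  shows "0 \<le> modulus_term \<eta> r xy" "modulus_term \<eta> r xy \<le> cost' \<eta> xy"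
  using assms a0_nonneg
  by (auto simp: modulus_term_def cost'_def split: prod.split intro!: mult_nonneg_nonneg mult_left_mono add_nonneg_nonneg)

lemma modulus_term_integrable:
  assumes "0 \<le> r" "\<eta> \<in> Omega' p"
  shows "integrable (count_space UNIV) (modulus_term \<eta> r)"
  by (rule Bochner_Integration.integrable_bound[OF cost'_integral(1)[OF assms(2)]])
    (use modulus_term_bounds[OF assms(1)] in auto)

text \<open>Provides one modulus for all truncations of \<eta> and all times up to
  \<open>s\<close>.\<close>

lemma modulus_mono:
  assumes "0 \<le> r" "r \<le> s" "\<eta> \<in> Omega' p" "\<And>x. \<zeta> x \<le> \<eta> x"
  shows "modulus \<zeta> r \<le> modulus \<eta> s"
  unfolding modulus_def
proof (rule integral_mono)
  have z: "\<zeta> \<in> Omega' p" by (rule Omega'_mono[OF assms(3,4)])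
  show "integrable (count_space UNIV) (modulus_term \<zeta> r)" "integrable (count_space UNIV) (modulus_term \<eta> s)"
    using assms z by (auto intro!: modulus_term_integrable)
  have "r * (2 * mass \<zeta> + 2) \<le> s * (2 * mass \<eta> + 2)"
    using mass_mono[OF assms(3,4)] assms(1,2) by (intro mult_mono) auto
  then show "modulus_term \<zeta> r xy \<le> modulus_term \<eta> s xy" for xy
    using assms a0_nonneg
    by (auto simp: modulus_term_def split: prod.split intro!: mult_mono mult_nonneg_nonneg add_nonneg_nonneg)
qed

lemma modulus_tendsto:
  assumes \<eta>: "\<eta> \<in> Omega' p"
  shows "(modulus \<eta> \<longlongrightarrow> 0) (at_right 0)"
proof (rule tendsto_at_right_sequentially[of 0 1])
  fix S :: "nat \<Rightarrow> real" assume S: "\<And>n. 0 < S n" "S \<longlonglongrightarrow> 0"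
  have S0: "0 \<le> S n" for n using S(1)[of n] by simp
  have "(\<lambda>n. \<integral>xy. modulus_term \<eta> (S n) xy \<partial>count_space UNIV) \<longlonglongrightarrow> (\<integral>xy. 0 \<partial>count_space (UNIV :: ('d site \<times> 'd site) set))"
  proof (rule integral_dominated_convergence[where w = "cost' \<eta>"])
    show "AE xy in count_space UNIV. (\<lambda>n. modulus_term \<eta> (S n) xy) \<longlonglongrightarrow> 0"
    proof (intro AE_I2)
      fix xy :: "'d site \<times> 'd site"
      obtain x y where xy: "xy = (x, y)" by (cases xy)
      have "(\<lambda>n. p y * (a0 * real (\<eta> x)) * min (\<beta> p x + \<beta> p (x + y)) (S n * (2 * mass \<eta> + 2)))
        \<longlonglongrightarrow> p y * (a0 * real (\<eta> x)) * min (\<beta> p x + \<beta> p (x + y)) (0 * (2 * mass \<eta> + 2))"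
        by (intro tendsto_mult tendsto_const tendsto_min S)
      then show "(\<lambda>n. modulus_term \<eta> (S n) xy) \<longlonglongrightarrow> 0"
        by (simp add: modulus_term_def xy min_absorb2 add_nonneg_nonneg)
    qed
    show "AE xy in count_space UNIV. norm (modulus_term \<eta> (S n) xy) \<le> cost' \<eta> xy" for n
      using modulus_term_bounds[OF S0] by auto
  qed (auto intro: cost'_integral \<eta>)
  then show "(\<lambda>n. modulus \<eta> (S n)) \<longlonglongrightarrow> 0" by (simp add: modulus_def)
qed simp

lemma generator_difference:
  assumes r: "0 \<le> r" "r \<le> 1" and u: "blip C M u" and \<eta>: "\<eta> \<in> Omega' p"
  shows "\<bar>generator g p (P r u) \<eta> - generator g p u \<eta>\<bar> \<le> (2 * (C * exp (4 * a0)) + 3 * a0 * (C * exp (4 * a0))) * modulus \<eta> r"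
proof -
  \<comment> \<open>A Lipschitz constant of \<open>P r u\<close> for every \<open>r\<close> up to 1;
    \<open>A\<close> is the resulting constant of the small-time bound.\<close>
  define C1 where "C1 = C * exp (4 * a0)"
  define A where "A = 3 * a0 * C1"
  have C0: "0 \<le> C" "0 \<le> C1" "0 \<le> A" using blipD(4)[OF u] a0_nonneg by (simp_all add: C1_def A_def)
  have "C * 1 \<le> C * exp (4 * a0)" using C0 a0_nonneg by (intro mult_left_mono) auto
  then have CC1: "C \<le> C1" by (simp add: C1_def)
  have Cr: "C * exp (4 * a0 * r) \<le> C1"
    unfolding C1_def using r C0 a0_nonneg mult_left_le[of r "4 * a0"] by (intro mult_left_mono) auto
  have lu: "lip_bound p u C1" by (rule lip_bound_mono[OF blipD(2)[OF u] CC1])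
  have lPu: "lip_bound p (P r u) C1" by (rule lip_bound_mono[OF blipD(2)[OF blip_P[OF r(1) u]] Cr])
  have wb: "\<bar>P r u \<zeta> - u \<zeta>\<bar> \<le> A * r * mass \<zeta>" if "\<zeta> \<in> Omega' p" for \<zeta>
  proof -
    have "3 * a0 * (C * exp (4 * a0 * r)) * mass \<zeta> * r \<le> 3 * a0 * C1 * mass \<zeta> * r"
      using Cr a0_nonneg r by (intro mult_right_mono mult_left_mono) auto
    then show ?thesis using small_time_bound[OF r(1) u that] by (simp add: A_def mult_ac)
  qed
  note i1 = jump_term_integrable[OF lPu \<eta>] and i2 = jump_term_integrable[OF lu \<eta>]
  have jt: "\<bar>jump_term (P r u) \<eta> xy - jump_term u \<eta> xy\<bar> \<le> (2 * C1 + A) * modulus_term \<eta> r xy" for xy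
  proof (cases xy)
    case (Pair x y)
    show ?thesis
    proof (cases "\<eta> x = 0")
      case False
      define \<zeta> where "\<zeta> = move x (x + y) \<eta>"
      define b where "b = \<beta> p x + \<beta> p (x + y)"
      define D where "D = \<bar>(P r u \<zeta> - P r u \<eta>) - (u \<zeta> - u \<eta>)\<bar>"
      have b0: "0 \<le> b" by (simp add: b_def add_nonneg_nonneg)
      have \<zeta>: "\<zeta> \<in> Omega' p" "mass \<zeta> \<le> mass \<eta> + 2"
        using move_mass[OF \<eta>, of x "x + y"] \<beta>_le[of "x + y"] by (auto simp: \<zeta>_def)
      have dist: "config_dist p \<zeta> \<eta> \<le> b" unfolding \<zeta>_def b_def using False by (intro move_dist[OF \<eta>]) simp
      have "\<bar>v \<zeta> - v \<eta>\<bar> \<le> C1 * b" if "lip_bound p v C1" for v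
        by (rule order_trans[OF lip_boundD[OF that \<zeta>(1) \<eta>] mult_left_mono[OF dist C0(2)]])
      from this[OF lu] this[OF lPu] have "D \<le> 2 * C1 * b" unfolding D_def by linarith
      also have "\<dots> \<le> (2 * C1 + A) * b" using C0 b0 by (intro mult_right_mono) auto
      finally have D1: "D \<le> (2 * C1 + A) * b" .
      have "D \<le> \<bar>P r u \<zeta> - u \<zeta>\<bar> + \<bar>P r u \<eta> - u \<eta>\<bar>" unfolding D_def by linarith
      also have "\<dots> \<le> A * r * mass \<zeta> + A * r * mass \<eta>" by (intro add_mono wb \<zeta> \<eta>)
      also have "\<dots> \<le> A * r * (mass \<eta> + 2) + A * r * mass \<eta>"
        using C0 r \<zeta>(2) by (intro add_right_mono mult_left_mono) auto
      also have "\<dots> = A * (r * (2 * mass \<eta> + 2))" by (simp add: algebra_simps)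
      also have "\<dots> \<le> (2 * C1 + A) * (r * (2 * mass \<eta> + 2))"
        using C0 r by (intro mult_right_mono) auto
      finally have D2: "D \<le> (2 * C1 + A) * (r * (2 * mass \<eta> + 2))" .
      have Dm: "D \<le> (2 * C1 + A) * min b (r * (2 * mass \<eta> + 2))"
        using D1 D2 by (simp add: min_def)
      have m0: "0 \<le> min b (r * (2 * mass \<eta> + 2))" using b0 r by simp
      have "\<bar>jump_term (P r u) \<eta> xy - jump_term u \<eta> xy\<bar> = p y * g (\<eta> x) * D"
        unfolding Pair jump_term_def D_def \<zeta>_def by (simp add: abs_mult flip: right_diff_distrib)
      also have "\<dots> \<le> p y * (a0 * real (\<eta> x)) * ((2 * C1 + A) * min b (r * (2 * mass \<eta> + 2)))"
        using Dm g_le[of "\<eta> x"] a0_nonneg by (intro mult_mono) (auto simp: D_def intro: mult_left_mono)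
      finally show ?thesis by (simp add: Pair modulus_term_def b_def mult_ac)
    qed (simp add: Pair jump_term_def modulus_term_def)
  qed
  have "\<bar>generator g p (P r u) \<eta> - generator g p u \<eta>\<bar> = \<bar>\<integral>xy. jump_term (P r u) \<eta> xy - jump_term u \<eta> xy \<partial>count_space UNIV\<bar>"
    unfolding generator_eq[OF lPu \<eta>] generator_eq[OF lu \<eta>] using i1 i2 by simp
  also have "\<dots> \<le> (\<integral>xy. \<bar>jump_term (P r u) \<eta> xy - jump_term u \<eta> xy\<bar> \<partial>count_space UNIV)" by (rule integral_abs_bound)
  also have "\<dots> \<le> (\<integral>xy. (2 * C1 + A) * modulus_term \<eta> r xy \<partial>count_space UNIV)"
    using i1 i2 modulus_term_integrable[OF r(1) \<eta>] jt by (intro integral_mono) auto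
  also have "\<dots> = (2 * C1 + A) * modulus \<eta> r" by (simp add: modulus_def)
  finally show ?thesis by (simp add: C1_def A_def)
qed

text \<open>Letting \<open>s\<close> tend to 0 and removing the truncation need not commute. The
  error of the first-order expansion is therefore bounded on finite configurations by the modulus of
  \<eta> itself, uniformly over its truncations.\<close>

lemma P_right_derivative:
  assumes u: "blip C M u" and \<eta>: "\<eta> \<in> Omega' p"
  shows "((\<lambda>s. (P s u \<eta> - u \<eta>) / s) \<longlongrightarrow> generator g p u \<eta>) (at_right 0)"
proof -
  define B where "B = 2 * (C * exp (4 * a0)) + 3 * a0 * (C * exp (4 * a0))"
  have B0: "0 \<le> B" using blipD(4)[OF u] a0_nonneg by (simp add: B_def)
  have fin: "\<bar>P s u \<zeta> - u \<zeta> - s * generator g p u \<zeta>\<bar> \<le> B * modulus \<eta> s * s"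
    if \<zeta>: "\<zeta> \<in> finite_configs" "\<And>x. \<zeta> x \<le> \<eta> x" and s: "0 \<le> s" "s \<le> 1" for \<zeta> s
  proof -
    \<comment> \<open>The right derivative of the first-order remainder is the change of the
      generator, which \<open>generator_difference\<close> controls.\<close>
    have "\<bar>(P s u \<zeta> - s * generator g p u \<zeta>) - (P 0 u \<zeta> - 0 * generator g p u \<zeta>)\<bar> \<le> B * modulus \<eta> s * s"
    proof (rule right_growth_bound[where D = "\<lambda>t. generator g p (P t u) \<zeta> - generator g p u \<zeta>", OF s(1)])
      show "continuous_on {0..s} (\<lambda>t. P t u \<zeta> - t * generator g p u \<zeta>)"
        by (intro continuous_intros P_continuous_finite[OF u \<zeta>(1)])
      fix t assume t: "0 \<le> t" "t < s"
      have "((\<lambda>h. (P (t + h) u \<zeta> - P t u \<zeta>) / h - generator g p u \<zeta>) \<longlongrightarrow> generator g p (P t u) \<zeta> - generator g p u \<zeta>) (at_right 0)"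
        by (intro tendsto_diff tendsto_const P_right_derivative_finite[OF t(1) u \<zeta>(1)])
      then show "((\<lambda>h. (P (t + h) u \<zeta> - (t + h) * generator g p u \<zeta> - (P t u \<zeta> - t * generator g p u \<zeta>)) / h)
          \<longlongrightarrow> generator g p (P t u) \<zeta> - generator g p u \<zeta>) (at_right 0)"
        by (rule Lim_transform_eventually)
          (auto simp: eventually_at_right_field field_simps intro!: exI[of _ 1])
      have "\<bar>generator g p (P t u) \<zeta> - generator g p u \<zeta>\<bar> \<le> B * modulus \<zeta> t"
        unfolding B_def using t s by (intro generator_difference[OF _ _ u finite_in_Omega'[OF \<zeta>(1)]]) auto
      also have "\<dots> \<le> B * modulus \<eta> s"
        using t \<zeta> \<eta> by (intro mult_left_mono modulus_mono B0) auto
      finally show "\<bar>generator g p (P t u) \<zeta> - generator g p u \<zeta>\<bar> \<le> B * modulus \<eta> s" .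
    qed
    then show ?thesis by (simp add: P_0[OF blipD(1)[OF u]] algebra_simps)
  qed
  have bound: "\<bar>P s u \<eta> - u \<eta> - s * generator g p u \<eta>\<bar> \<le> B * modulus \<eta> s * s" if s: "0 \<le> s" "s \<le> 1" for s
  proof -
    have "(\<lambda>n. \<bar>P s u (trunc n \<eta>) - u (trunc n \<eta>) - s * generator g p u (trunc n \<eta>)\<bar>)
        \<longlonglongrightarrow> \<bar>P s u \<eta> - u \<eta> - s * generator g p u \<eta>\<bar>"
      by (intro tendsto_rabs tendsto_diff tendsto_mult tendsto_const lip_trunc[OF blipD(2)[OF u] \<eta>]
          lip_trunc[OF P_lip_bound[OF s(1) blipD(1,2)[OF u]] \<eta>] generator_trunc[OF blipD(2)[OF u] \<eta>])
    then show ?thesis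
      by (rule LIMSEQ_le_const2) (use fin[OF trunc_finite trunc_le s] in auto)
  qed
  have "((\<lambda>s. (P s u \<eta> - u \<eta>) / s - generator g p u \<eta>) \<longlongrightarrow> 0) (at_right 0)"
  proof (rule Lim_null_comparison)
    show "((\<lambda>s. B * modulus \<eta> s) \<longlongrightarrow> 0) (at_right 0)"
      using tendsto_mult[OF tendsto_const modulus_tendsto[OF \<eta>], of B] by simp
    have "norm ((P s u \<eta> - u \<eta>) / s - generator g p u \<eta>) \<le> B * modulus \<eta> s" if s: "0 < s" "s < 1" for s
    proof -
      have "(P s u \<eta> - u \<eta>) / s - generator g p u \<eta> = (P s u \<eta> - u \<eta> - s * generator g p u \<eta>) / s"
        using s by (simp add: field_simps)
      then show ?thesis using bound[of s] s by (simp add: pos_divide_le_eq)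
    qed
    then show "\<forall>\<^sub>F s in at_right 0. norm ((P s u \<eta> - u \<eta>) / s - generator g p u \<eta>) \<le> B * modulus \<eta> s"
      by (auto simp: eventually_at_right_field intro!: exI[of _ 1])
  qed
  then show ?thesis by (simp add: LIM_zero_iff)
qed

end


section \<open>Measures on configuration space\<close>

abbreviation conf :: "('i \<Rightarrow> nat) measure" where
  "conf \<equiv> PiM UNIV (\<lambda>_. count_space UNIV)"

definition cyl :: "'i set \<Rightarrow> ('i \<Rightarrow> nat) \<Rightarrow> ('i \<Rightarrow> nat) set" where
  "cyl S e = {\<eta>. \<forall>z\<in>S. \<eta> z = e z}"

lemma space_conf [simp]: "space conf = UNIV"
  by (auto simp: space_PiM)

lemma measurable_coordinate [measurable]: "(\<lambda>\<eta>. \<eta> x) \<in> conf \<rightarrow>\<^sub>M count_space UNIV"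
  by (rule measurable_component_singleton) simp

lemma cyl_sets [measurable]: "finite S \<Longrightarrow> cyl S e \<in> sets conf"
proof -
  assume S: "finite S"
  have "{\<eta>\<in>space conf. \<forall>z\<in>S. \<eta> z = e z} \<in> sets conf"
    using S by measurable
  then show ?thesis by (simp add: cyl_def)
qed

text \<open>Padding by 0 keeps the type of configurations: functions can be evaluated at
  restrictions, and for finite \<open>S\<close> the range is countable.\<close>

definition restr :: "'i set \<Rightarrow> ('i \<Rightarrow> nat) \<Rightarrow> 'i \<Rightarrow> nat" where
  "restr S \<eta> = (\<lambda>x. if x \<in> S then \<eta> x else 0)"

lemma countable_range_restr:
  assumes "finite S"
  shows "countable (range (restr S))"
proof -
  have "range (restr S) \<subseteq> (\<lambda>f x. if x \<in> S then f x else 0) ` (PiE S (\<lambda>_. UNIV))"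
  proof
    fix f assume "f \<in> range (restr S)"
    then obtain \<eta> where f: "f = restr S \<eta>" by auto
    have "f = (\<lambda>f x. if x \<in> S then f x else 0) (restrict \<eta> S)" by (auto simp: f restr_def)
    moreover have "restrict \<eta> S \<in> PiE S (\<lambda>_. UNIV)" by auto
    ultimately show "f \<in> (\<lambda>f x. if x \<in> S then f x else 0) ` (PiE S (\<lambda>_. UNIV))" by blast
  qed
  moreover have "countable (PiE S (\<lambda>_. UNIV :: nat set))" using assms by (intro countable_PiE) auto
  ultimately show ?thesis by (meson countable_image countable_subset)
qed

lemma measurable_restr:
  assumes S: "finite S"
  shows "restr S \<in> conf \<rightarrow>\<^sub>M count_space UNIV"
proof (rule measurableI)
  fix A :: "('a \<Rightarrow> nat) set"
  have "restr S -` A = (\<Union>\<zeta>\<in>A \<inter> range (restr S). cyl S \<zeta>)"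
  proof (intro set_eqI iffI)
    fix \<eta> assume "\<eta> \<in> restr S -` A"
    then have "restr S \<eta> \<in> A \<inter> range (restr S)" "\<eta> \<in> cyl S (restr S \<eta>)" by (auto simp: cyl_def restr_def)
    then show "\<eta> \<in> (\<Union>\<zeta>\<in>A \<inter> range (restr S). cyl S \<zeta>)" by blast
  next
    fix \<eta> assume "\<eta> \<in> (\<Union>\<zeta>\<in>A \<inter> range (restr S). cyl S \<zeta>)"
    then obtain \<xi> where "restr S \<xi> \<in> A" "\<eta> \<in> cyl S (restr S \<xi>)" by auto
    moreover from this(2) have "restr S \<eta> = restr S \<xi>" by (auto simp: cyl_def restr_def fun_eq_iff)
    ultimately show "\<eta> \<in> restr S -` A" by simp
  qed
  also have "\<dots> \<in> sets conf"
    using countable_range_restr[OF S] by (intro sets.countable_UN'' cyl_sets S) (auto intro: countable_subset)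
  finally show "restr S -` A \<inter> space conf \<in> sets conf" by simp
qed auto

definition local_fun :: "(('i \<Rightarrow> nat) \<Rightarrow> real) \<Rightarrow> bool" where
  "local_fun u \<longleftrightarrow> (\<exists>S. finite S \<and> (\<forall>\<eta>. u (restr S \<eta>) = u \<eta>))"

lemma local_fun_measurable: "local_fun u \<Longrightarrow> u \<in> borel_measurable conf"
proof -
  assume "local_fun u"
  then obtain S where S: "finite S" "\<And>\<eta>. u (restr S \<eta>) = u \<eta>" by (auto simp: local_fun_def)
  have "(\<lambda>\<eta>. u (restr S \<eta>)) \<in> borel_measurable conf"
    by (rule measurable_compose[OF measurable_restr[OF S(1)]]) simp
  then show ?thesis by (simp add: S(2))
qed

lemma local_fun_combine:
  assumes "local_fun u" "local_fun v"
  shows "local_fun (\<lambda>\<eta>. F (u \<eta>) (v \<eta>))"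
proof -
  obtain S where S: "finite S" "\<And>\<eta>. u (restr S \<eta>) = u \<eta>" using assms(1) by (auto simp: local_fun_def)
  obtain T where T: "finite T" "\<And>\<eta>. v (restr T \<eta>) = v \<eta>" using assms(2) by (auto simp: local_fun_def)
  have rr: "restr S (restr (S \<union> T) \<eta>) = restr S \<eta>" "restr T (restr (S \<union> T) \<eta>) = restr T \<eta>" for \<eta> :: "'a \<Rightarrow> nat"
    by (auto simp: restr_def)
  have "u (restr (S \<union> T) \<eta>) = u \<eta>" "v (restr (S \<union> T) \<eta>) = v \<eta>" for \<eta>
    using S(2)[of "restr (S \<union> T) \<eta>"] S(2)[of \<eta>] T(2)[of "restr (S \<union> T) \<eta>"] T(2)[of \<eta>] by (simp_all add: rr)
  then show ?thesis unfolding local_fun_def using S(1) T(1) by (intro exI[of _ "S \<union> T"]) auto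
qed

lemma local_fun_const: "local_fun (\<lambda>_. c)"
  unfolding local_fun_def by (rule exI[of _ "{}"]) auto

lemma local_fun_cyl: "finite S \<Longrightarrow> local_fun (indicator (cyl S e))"
  unfolding local_fun_def by (rule exI[of _ S]) (auto simp: restr_def cyl_def indicator_def)

text \<open>A set decided by the coordinates in \<open>S\<close> is the disjoint union of countably
  many cylinders over \<open>S\<close>.\<close>

lemma emeasure_cyl_partition:
  assumes M: "sets M = sets conf" and S: "finite S" and X: "\<And>\<eta>. restr S \<eta> \<in> X \<longleftrightarrow> \<eta> \<in> X"
  shows "emeasure M X = (\<integral>\<^sup>+\<zeta>. emeasure M (cyl S \<zeta>) \<partial>count_space (range (restr S) \<inter> X))"
proof -
  define I where "I = range (restr S) \<inter> X"
  have I: "countable I" unfolding I_def using countable_range_restr[OF S] by (auto intro: countable_subset)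
  have Xeq: "X = (\<Union>\<zeta>\<in>I. cyl S \<zeta>)"
  proof (intro set_eqI iffI)
    fix \<eta> assume "\<eta> \<in> X"
    then have "restr S \<eta> \<in> I" by (simp add: I_def X)
    moreover have "\<eta> \<in> cyl S (restr S \<eta>)" by (simp add: cyl_def restr_def)
    ultimately show "\<eta> \<in> (\<Union>\<zeta>\<in>I. cyl S \<zeta>)" by blast
  next
    fix \<eta> assume "\<eta> \<in> (\<Union>\<zeta>\<in>I. cyl S \<zeta>)"
    then obtain \<xi> where \<xi>: "restr S \<xi> \<in> X" "\<eta> \<in> cyl S (restr S \<xi>)" by (auto simp: I_def)
    from \<xi>(2) have "restr S \<eta> = restr S \<xi>" by (auto simp: cyl_def restr_def fun_eq_iff)
    with \<xi>(1) show "\<eta> \<in> X" using X[of \<eta>] by (simp only:)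
  qed
  have dis: "disjoint_family_on (cyl S) I"
    unfolding disjoint_family_on_def
  proof (intro ballI impI)
    fix \<zeta> \<xi> assume "\<zeta> \<in> I" "\<xi> \<in> I" "\<zeta> \<noteq> \<xi>"
    then obtain z where "z \<in> S" "\<zeta> z \<noteq> \<xi> z"
      by (auto simp: I_def restr_def fun_eq_iff split: if_splits)
    then show "cyl S \<zeta> \<inter> cyl S \<xi> = {}" by (auto simp: cyl_def)
  qed
  have "emeasure M (\<Union>\<zeta>\<in>I. cyl S \<zeta>) = (\<integral>\<^sup>+\<zeta>. emeasure M (cyl S \<zeta>) \<partial>count_space I)"
    by (rule emeasure_UN_countable[OF _ I dis]) (use cyl_sets[OF S] M in simp)
  then show ?thesis unfolding Xeq[symmetric] unfolding I_def .
qed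

text \<open>Enlarging the base of a cylinder by \<open>S0\<close> loses nothing. This suits
  identities that hold for cylinders whose base contains prescribed sites.\<close>

lemma cylinder_measure_eqI:
  assumes P: "sets P = sets conf" "finite_measure P" and Q: "sets Q = sets conf"
    and S0: "finite S0"
    and eq: "\<And>S e. finite S \<Longrightarrow> S0 \<subseteq> S \<Longrightarrow> emeasure P (cyl S e) = emeasure Q (cyl S e)"
  shows "P = Q"
proof (rule measure_eqI_PiM_infinite[OF P(1) Q _ P(2)])
  fix A :: "'a \<Rightarrow> nat set" and J :: "'a set" assume J: "finite J" "J \<subseteq> UNIV"
  define S where "S = J \<union> S0"
  define X where "X = {\<eta>. \<forall>i\<in>J. \<eta> i \<in> A i}"
  have S: "finite S" "S0 \<subseteq> S" using J S0 by (auto simp: S_def)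
  have "restr S \<eta> \<in> X \<longleftrightarrow> \<eta> \<in> X" for \<eta> by (auto simp: X_def restr_def S_def)
  then have "emeasure P X = emeasure Q X"
    using emeasure_cyl_partition[OF P(1) S(1), of X] emeasure_cyl_partition[OF Q S(1), of X] eq[OF S] by simp
  moreover have "prod_emb UNIV (\<lambda>_. count_space UNIV) J (Pi\<^sub>E J A) = X"
    by (auto simp: prod_emb_def X_def PiE_iff)
  ultimately show "emeasure P (prod_emb UNIV (\<lambda>_. count_space UNIV) J (Pi\<^sub>E J A)) =
      emeasure Q (prod_emb UNIV (\<lambda>_. count_space UNIV) J (Pi\<^sub>E J A))" by simp
qed

text \<open>Approximability in L1 passes from finite-dimensional sets to complements and countable
  disjoint unions, hence to the generated sigma-algebra. Clipping keeps the uniform bound 1 at every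
  stage.\<close>

lemma local_approx_set:
  fixes M :: "('i \<Rightarrow> nat) measure"
  assumes M: "finite_measure M" "sets M = sets conf" and A: "A \<in> sets conf" and e: "0 < e"
  shows "\<exists>u. local_fun u \<and> (\<forall>\<eta>. \<bar>u \<eta>\<bar> \<le> 1) \<and> (\<integral>\<eta>. \<bar>indicator A \<eta> - u \<eta>\<bar> \<partial>M) < e"
proof -
  interpret finite_measure M by fact
  have sp: "space M = UNIV" using sets_eq_imp_space_eq[OF M(2)] by simp
  have meas: "u \<in> borel_measurable M" if "local_fun u" for u
    using local_fun_measurable[OF that] M(2) by (simp cong: measurable_cong_sets)
  have int: "integrable M u" if "local_fun u" "\<And>\<eta>. \<bar>u \<eta>\<bar> \<le> 1" for u
    by (rule integrable_const_bound[of _ 1]) (use that meas in auto)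
  have ii: "integrable M (indicator B :: _ \<Rightarrow> real)" if "B \<in> sets M" for B
    using that by (auto simp: less_top[symmetric])
  have 1: "Int_stable (prod_algebra UNIV (\<lambda>_ :: 'i. count_space (UNIV :: nat set)))"
    by (rule Int_stable_prod_algebra)
  have 2: "prod_algebra UNIV (\<lambda>_ :: 'i. count_space (UNIV :: nat set)) \<subseteq> Pow UNIV" by simp
  have 3: "A \<in> sigma_sets UNIV (prod_algebra UNIV (\<lambda>_. count_space UNIV))"
    using A by (simp add: sets_PiM)
  show ?thesis using 1 2 3 e
  proof (induction arbitrary: e rule: sigma_sets_induct_disjoint)
    case (basic A)
    from basic.hyps obtain J E where J: "A = prod_emb UNIV (\<lambda>_. count_space UNIV) J (Pi\<^sub>E J E)" "finite J"
      by (rule prod_algebraE) auto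
    have A: "A = {\<eta>. \<forall>i\<in>J. \<eta> i \<in> E i}" by (auto simp: J(1) prod_emb_def PiE_iff)
    have "local_fun (indicator A)"
      unfolding local_fun_def A by (rule exI[of _ J]) (auto simp: J(2) restr_def indicator_def)
    then show ?case using basic by (intro exI[of _ "indicator A"]) auto
  next
    case empty
    then show ?case by (intro exI[of _ "\<lambda>_. 0"]) (auto intro: local_fun_const)
  next
    case (compl A)
    then obtain u where u: "local_fun u" "\<And>\<eta>. \<bar>u \<eta>\<bar> \<le> 1" "(\<integral>\<eta>. \<bar>indicator A \<eta> - u \<eta>\<bar> \<partial>M) < e" by meson
    \<comment> \<open>\<open>1 - u\<close> can be as large as 2; cutting it at 1 brings it no
      farther from an indicator.\<close>
    define v where "v \<eta> = min 1 (1 - u \<eta>)" for \<eta>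
    have v: "local_fun v" "\<And>\<eta>. \<bar>v \<eta>\<bar> \<le> 1"
      unfolding v_def using local_fun_combine[OF u(1) u(1), of "\<lambda>x _. min 1 (1 - x)"] u(2)
      by (auto simp: abs_le_iff min_def algebra_simps)
    have A: "A \<in> sets M" using compl.hyps M(2) by (simp add: sets_PiM)
    have "(\<integral>\<eta>. \<bar>indicator (UNIV - A) \<eta> - v \<eta>\<bar> \<partial>M) \<le> (\<integral>\<eta>. \<bar>indicator A \<eta> - u \<eta>\<bar> \<partial>M)"
    proof (rule integral_mono)
      show "integrable M (\<lambda>\<eta>. \<bar>indicator (UNIV - A) \<eta> - v \<eta>\<bar>)" "integrable M (\<lambda>\<eta>. \<bar>indicator A \<eta> - u \<eta>\<bar>)"
        using A sets.compl_sets[OF A] sp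
        by (simp_all add: ii int[OF v] int[OF u(1,2)])
      show "\<bar>indicator (UNIV - A) \<eta> - v \<eta>\<bar> \<le> \<bar>indicator A \<eta> - u \<eta>\<bar>" for \<eta>
        using u(2)[of \<eta>] by (auto simp: v_def indicator_def abs_if min_def split: if_splits)
    qed
    with u(3) v show ?case by (intro exI[of _ v]) auto
  next
    case (union F)
    have F: "F i \<in> sets M" for i using union(2) M(2) by (auto simp: sets_PiM)
    have "(\<lambda>n. \<Sum>i<n. measure M (F i)) \<longlonglongrightarrow> measure M (\<Union>i. F i)"
      using finite_measure_UNION[of F] F union.hyps by (auto simp: sums_def)
    then have "(\<lambda>n. measure M (\<Union>i. F i) - (\<Sum>i<n. measure M (F i))) \<longlonglongrightarrow> 0"
      by (auto intro!: tendsto_eq_intros)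
    from order_tendstoD(2)[OF this, of "e / 2"] union.prems obtain n where
      n: "measure M (\<Union>i. F i) - (\<Sum>i<n. measure M (F i)) < e / 2"
      by (auto simp: eventually_sequentially)
    \<comment> \<open>One half of \<open>e\<close> pays for the tail of the union, the other is
      shared by the \<open>n\<close> retained pieces; \<open>Suc n\<close> also covers
      \<open>n = 0\<close>.\<close>
    have "\<forall>i. \<exists>u. local_fun u \<and> (\<forall>\<eta>. \<bar>u \<eta>\<bar> \<le> 1) \<and> (\<integral>\<eta>. \<bar>indicator (F i) \<eta> - u \<eta>\<bar> \<partial>M) < e / (2 * real (Suc n))"
      using union.IH union.prems by (intro allI) auto
    then obtain u where u: "\<And>i. local_fun (u i)" "\<And>i \<eta>. \<bar>u i \<eta>\<bar> \<le> 1"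
      "\<And>i. (\<integral>\<eta>. \<bar>indicator (F i) \<eta> - u i \<eta>\<bar> \<partial>M) < e / (2 * real (Suc n))" by metis
    define s where "s \<eta> = (\<Sum>i<n. u i \<eta>)" for \<eta>
    define v where "v \<eta> = max (- 1) (min 1 (s \<eta>))" for \<eta>
    have "local_fun (\<lambda>\<eta>. \<Sum>i<m. u i \<eta>)" for m
      by (induction m) (auto intro: local_fun_const local_fun_combine[where F = "(+)"] u)
    then have ls: "local_fun s" by (simp add: s_def[abs_def])
    have v: "local_fun v" "\<And>\<eta>. \<bar>v \<eta>\<bar> \<le> 1"
      unfolding v_def using local_fun_combine[OF ls ls, of "\<lambda>x _. max (- 1) (min 1 x)"] by auto
    let ?U = "\<Union>i. F i" and ?V = "\<Union>i<n. F i"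
    have UV: "?U \<in> sets M" "?V \<in> sets M" using F by auto
    have mV: "measure M ?V = (\<Sum>i<n. measure M (F i))"
      using F union.hyps by (intro finite_measure_finite_Union) (auto simp: disjoint_family_on_def)
    have indV: "indicator ?V \<eta> = (\<Sum>i<n. indicator (F i) \<eta> :: real)" for \<eta>
      using union.hyps by (subst indicator_UN_disjoint) (auto simp: disjoint_family_on_def)
    have "(\<integral>\<eta>. \<bar>indicator ?U \<eta> - v \<eta>\<bar> \<partial>M)
      \<le> (\<integral>\<eta>. (indicator ?U \<eta> - indicator ?V \<eta>) + (\<Sum>i<n. \<bar>indicator (F i) \<eta> - u i \<eta>\<bar>) \<partial>M)"
    proof (rule integral_mono)
      show "integrable M (\<lambda>\<eta>. \<bar>indicator ?U \<eta> - v \<eta>\<bar>)" by (intro integrable_abs Bochner_Integration.integrable_diff ii UV int v)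
      show "integrable M (\<lambda>\<eta>. (indicator ?U \<eta> - indicator ?V \<eta>) + (\<Sum>i<n. \<bar>indicator (F i) \<eta> - u i \<eta>\<bar>))"
        by (intro Bochner_Integration.integrable_add Bochner_Integration.integrable_diff Bochner_Integration.integrable_sum integrable_abs ii UV int u F)
      fix \<eta>
      have "\<bar>indicator ?U \<eta> - v \<eta>\<bar> \<le> \<bar>indicator ?U \<eta> - s \<eta>\<bar>" by (auto simp: v_def indicator_def)
      also have "\<dots> \<le> \<bar>indicator ?U \<eta> - indicator ?V \<eta>\<bar> + \<bar>\<Sum>i<n. indicator (F i) \<eta> - u i \<eta>\<bar>"
        unfolding indV s_def sum_subtractf by linarith
      also have "\<dots> \<le> (indicator ?U \<eta> - indicator ?V \<eta>) + (\<Sum>i<n. \<bar>indicator (F i) \<eta> - u i \<eta>\<bar>)"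
        by (intro add_mono sum_abs) (auto simp: indicator_def)
      finally show "\<bar>indicator ?U \<eta> - v \<eta>\<bar> \<le> (indicator ?U \<eta> - indicator ?V \<eta>) + (\<Sum>i<n. \<bar>indicator (F i) \<eta> - u i \<eta>\<bar>)" .
    qed
    also have "\<dots> = (measure M ?U - measure M ?V) + (\<Sum>i<n. \<integral>\<eta>. \<bar>indicator (F i) \<eta> - u i \<eta>\<bar> \<partial>M)"
      using ii UV F int u by (simp add: Bochner_Integration.integral_add Bochner_Integration.integral_diff Bochner_Integration.integral_sum Bochner_Integration.integrable_sum)
    also have "\<dots> < e / 2 + e / 2"
    proof (rule add_less_le_mono)
      show "measure M ?U - measure M ?V < e / 2" using n by (simp add: mV)
      have "(\<Sum>i<n. \<integral>\<eta>. \<bar>indicator (F i) \<eta> - u i \<eta>\<bar> \<partial>M) \<le> (\<Sum>i<n. e / (2 * real (Suc n)))"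
        using u(3) by (intro sum_mono less_imp_le)
      also have "\<dots> \<le> e / 2" using union.prems by (simp add: field_simps)
      finally show "(\<Sum>i<n. \<integral>\<eta>. \<bar>indicator (F i) \<eta> - u i \<eta>\<bar> \<partial>M) \<le> e / 2" .
    qed
    finally show ?case using v by (intro exI[of _ v]) auto
  qed
qed

text \<open>Preserving the bound \<open>B\<close> matters: later estimates depend on the approximant
  through this bound and L1 distances. The final cut at \<open>B\<close> does not increase the
  distance to \<open>f\<close>.\<close>

lemma local_approx:
  assumes M: "finite_measure M" "sets M = sets conf" and f: "f \<in> borel_measurable M"
    and B: "\<And>\<eta>. \<bar>f \<eta>\<bar> \<le> B" and e: "0 < e"
  obtains u where "local_fun u" "\<And>\<eta>. \<bar>u \<eta>\<bar> \<le> B" "(\<integral>\<eta>. \<bar>f \<eta> - u \<eta>\<bar> \<partial>M) < e"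
proof -
  interpret finite_measure M by fact
  have meas: "u \<in> borel_measurable M" if "local_fun u" for u
    using local_fun_measurable[OF that] M(2) by (simp cong: measurable_cong_sets)
  have int: "integrable M u" if "local_fun u" "\<And>\<eta>. \<bar>u \<eta>\<bar> \<le> c" for u c
    by (rule integrable_const_bound[of _ c]) (use that meas in auto)
  have "integrable M f" by (rule integrable_const_bound[of _ B]) (use B f in auto)
  then have "\<forall>e>0. \<exists>u c. local_fun u \<and> (\<forall>\<eta>. \<bar>u \<eta>\<bar> \<le> c) \<and> (\<integral>\<eta>. \<bar>f \<eta> - u \<eta>\<bar> \<partial>M) < e"
  proof (induction rule: integrable_induct)
    case (base A c)
    show ?case
    proof (intro allI impI)
      fix e :: real assume e: "0 < e"
      have "A \<in> sets conf" using base M(2) by simp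
      from local_approx_set[OF M this, of "e / (\<bar>c\<bar> + 1)"] e obtain u where
        u: "local_fun u" "\<And>\<eta>. \<bar>u \<eta>\<bar> \<le> 1" "(\<integral>\<eta>. \<bar>indicator A \<eta> - u \<eta>\<bar> \<partial>M) < e / (\<bar>c\<bar> + 1)" by auto
      have "(\<integral>\<eta>. \<bar>indicator A \<eta> *\<^sub>R c - c * u \<eta>\<bar> \<partial>M) = (\<integral>\<eta>. \<bar>c\<bar> * \<bar>indicator A \<eta> - u \<eta>\<bar> \<partial>M)"
        by (intro Bochner_Integration.integral_cong) (auto simp: abs_mult[symmetric] algebra_simps)
      also have "\<dots> = \<bar>c\<bar> * (\<integral>\<eta>. \<bar>indicator A \<eta> - u \<eta>\<bar> \<partial>M)" by simp
      also have "\<dots> \<le> \<bar>c\<bar> * (e / (\<bar>c\<bar> + 1))" using u(3) by (intro mult_left_mono) auto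
      also have "\<dots> < e" using e by (simp add: field_simps)
      finally have "(\<integral>\<eta>. \<bar>indicator A \<eta> *\<^sub>R c - c * u \<eta>\<bar> \<partial>M) < e" .
      moreover have "local_fun (\<lambda>\<eta>. c * u \<eta>)" using local_fun_combine[OF u(1) u(1), of "\<lambda>x _. c * x"] .
      moreover have "\<forall>\<eta>. \<bar>c * u \<eta>\<bar> \<le> \<bar>c\<bar>" using u(2) by (auto simp: abs_mult mult_left_le)
      ultimately show "\<exists>u b. local_fun u \<and> (\<forall>\<eta>. \<bar>u \<eta>\<bar> \<le> b) \<and> (\<integral>\<eta>. \<bar>indicator A \<eta> *\<^sub>R c - u \<eta>\<bar> \<partial>M) < e" by blast
    qed
  next
    case (add f g)
    show ?case
    proof (intro allI impI)
      fix e :: real assume e: "0 < e"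
      from add.IH e obtain u c v d where
        u: "local_fun u" "\<And>\<eta>. \<bar>u \<eta>\<bar> \<le> c" "(\<integral>\<eta>. \<bar>f \<eta> - u \<eta>\<bar> \<partial>M) < e / 2" and
        v: "local_fun v" "\<And>\<eta>. \<bar>v \<eta>\<bar> \<le> d" "(\<integral>\<eta>. \<bar>g \<eta> - v \<eta>\<bar> \<partial>M) < e / 2"
        by (meson half_gt_zero)
      note i = int[OF u(1,2)] int[OF v(1,2)]
      have "(\<integral>\<eta>. \<bar>f \<eta> + g \<eta> - (u \<eta> + v \<eta>)\<bar> \<partial>M) \<le> (\<integral>\<eta>. \<bar>f \<eta> - u \<eta>\<bar> + \<bar>g \<eta> - v \<eta>\<bar> \<partial>M)"
        using add.hyps i by (intro integral_mono) auto
      also have "\<dots> < e" using add.hyps i u(3) v(3) by simp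
      finally have "(\<integral>\<eta>. \<bar>f \<eta> + g \<eta> - (u \<eta> + v \<eta>)\<bar> \<partial>M) < e" .
      moreover have "\<forall>\<eta>. \<bar>u \<eta> + v \<eta>\<bar> \<le> c + d" using u(2) v(2) abs_triangle_ineq order_trans add_mono by meson
      ultimately show "\<exists>u b. local_fun u \<and> (\<forall>\<eta>. \<bar>u \<eta>\<bar> \<le> b) \<and> (\<integral>\<eta>. \<bar>f \<eta> + g \<eta> - u \<eta>\<bar> \<partial>M) < e"
        using local_fun_combine[OF u(1) v(1), of "(+)"] by blast
    qed
  next
    case (lim f s)
    show ?case
    proof (intro allI impI)
      fix e :: real assume e: "0 < e"
      have "(\<lambda>i. \<integral>\<eta>. \<bar>f \<eta> - s i \<eta>\<bar> \<partial>M) \<longlonglongrightarrow> (\<integral>\<eta>. 0 \<partial>M)"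
      proof (rule integral_dominated_convergence[where w = "\<lambda>\<eta>. 3 * \<bar>f \<eta>\<bar>"])
        show "AE \<eta> in M. (\<lambda>i. \<bar>f \<eta> - s i \<eta>\<bar>) \<longlonglongrightarrow> 0"
        proof (intro AE_I2 tendsto_rabs_zero)
          fix \<eta> assume "\<eta> \<in> space M"
          from tendsto_diff[OF tendsto_const lim.hyps(2)[OF this], of "f \<eta>"]
          show "(\<lambda>i. f \<eta> - s i \<eta>) \<longlonglongrightarrow> 0" by simp
        qed
        show "AE \<eta> in M. norm \<bar>f \<eta> - s i \<eta>\<bar> \<le> 3 * \<bar>f \<eta>\<bar>" for i
        proof (intro AE_I2)
          fix \<eta> assume "\<eta> \<in> space M"
          then have "\<bar>s i \<eta>\<bar> \<le> 2 * \<bar>f \<eta>\<bar>" using lim.hyps(3) by simp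
          then show "norm \<bar>f \<eta> - s i \<eta>\<bar> \<le> 3 * \<bar>f \<eta>\<bar>" by simp
        qed
      qed (use lim.hyps in \<open>auto intro: borel_measurable_integrable\<close>)
      from order_tendstoD(2)[OF this, of "e / 2"] e obtain i where i: "(\<integral>\<eta>. \<bar>f \<eta> - s i \<eta>\<bar> \<partial>M) < e / 2"
        by (auto simp: eventually_sequentially)
      from lim.IH(1)[of i] e obtain u c where
        u: "local_fun u" "\<And>\<eta>. \<bar>u \<eta>\<bar> \<le> c" "(\<integral>\<eta>. \<bar>s i \<eta> - u \<eta>\<bar> \<partial>M) < e / 2" by (meson half_gt_zero)
      have "(\<integral>\<eta>. \<bar>f \<eta> - u \<eta>\<bar> \<partial>M) \<le> (\<integral>\<eta>. \<bar>f \<eta> - s i \<eta>\<bar> + \<bar>s i \<eta> - u \<eta>\<bar> \<partial>M)"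
        using lim.hyps(1)[of i] lim.hyps(4) int[OF u(1,2)] by (intro integral_mono) auto
      also have "\<dots> < e" using lim.hyps(1)[of i] lim.hyps(4) int[OF u(1,2)] i u(3) by simp
      finally show "\<exists>u b. local_fun u \<and> (\<forall>\<eta>. \<bar>u \<eta>\<bar> \<le> b) \<and> (\<integral>\<eta>. \<bar>f \<eta> - u \<eta>\<bar> \<partial>M) < e" using u by blast
    qed
  qed
  then obtain u c where u: "local_fun u" "\<And>\<eta>. \<bar>u \<eta>\<bar> \<le> c" "(\<integral>\<eta>. \<bar>f \<eta> - u \<eta>\<bar> \<partial>M) < e" using e by blast
  define v where "v \<eta> = max (- B) (min B (u \<eta>))" for \<eta>
  have B0: "0 \<le> B" using B[of undefined] by linarith
  have v: "local_fun v" "\<And>\<eta>. \<bar>v \<eta>\<bar> \<le> B"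
    unfolding v_def using local_fun_combine[OF u(1) u(1), of "\<lambda>x _. max (- B) (min B x)"] B0 by auto
  have "(\<integral>\<eta>. \<bar>f \<eta> - v \<eta>\<bar> \<partial>M) \<le> (\<integral>\<eta>. \<bar>f \<eta> - u \<eta>\<bar> \<partial>M)"
  proof (rule integral_mono)
    show "\<bar>f \<eta> - v \<eta>\<bar> \<le> \<bar>f \<eta> - u \<eta>\<bar>" for \<eta> using B[of \<eta>] by (auto simp: v_def)
  qed (use \<open>integrable M f\<close> int[OF u(1,2)] int[OF v] in auto)
  with u(3) v that show thesis by fastforce
qed


section \<open>The exchange relation\<close>

lemma measurable_move [measurable]: "move x y \<in> conf \<rightarrow>\<^sub>M (conf :: 'd::finite config measure)"
proof (rule measurable_PiM_single')
  fix z
  show "(\<lambda>\<eta>. move x y \<eta> z) \<in> conf \<rightarrow>\<^sub>M count_space UNIV"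
    unfolding move_def Let_def by (cases "z = y"; cases "x = y"; cases "z = x") simp_all
qed auto

definition exchange :: "(nat \<Rightarrow> real) \<Rightarrow> 'd::finite config measure \<Rightarrow> 'd site \<Rightarrow> 'd site \<Rightarrow> bool" where
  "exchange g Q x y \<longleftrightarrow> (\<forall>G\<in>borel_measurable conf.
     (\<integral>\<^sup>+\<eta>. ennreal (g (\<eta> x)) * G (move x y \<eta>) \<partial>Q) = (\<integral>\<^sup>+\<eta>. ennreal (g (\<eta> y)) * G \<eta> \<partial>Q))"

lemma exchangeD:
  "exchange g Q x y \<Longrightarrow> G \<in> borel_measurable conf \<Longrightarrow>
    (\<integral>\<^sup>+\<eta>. ennreal (g (\<eta> x)) * G (move x y \<eta>) \<partial>Q) = (\<integral>\<^sup>+\<eta>. ennreal (g (\<eta> y)) * G \<eta> \<partial>Q)"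
  by (auto simp: exchange_def)

context zero_range
begin

lemma move_move: "1 \<le> \<eta> x \<Longrightarrow> move z y (move x z \<eta>) = move x y \<eta>"
  by (auto simp: fun_eq_iff move_apply)

lemma exchange_refl: "exchange g (Q :: 'd config measure) x x"
  unfolding exchange_def
proof
  fix G :: "'d config \<Rightarrow> ennreal"
  have "ennreal (g (\<eta> x)) * G (move x x \<eta>) = ennreal (g (\<eta> x)) * G \<eta>" for \<eta>
    by (cases "\<eta> x = 0") (simp_all add: move_self)
  then show "(\<integral>\<^sup>+\<eta>. ennreal (g (\<eta> x)) * G (move x x \<eta>) \<partial>Q) = (\<integral>\<^sup>+\<eta>. ennreal (g (\<eta> x)) * G \<eta> \<partial>Q)" by simp
qed

lemma exchange_sym:
  fixes Q :: "'d config measure"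
  assumes "exchange g Q x y"
  shows "exchange g Q y x"
  unfolding exchange_def
proof
  fix G :: "'d config \<Rightarrow> ennreal" assume G: "G \<in> borel_measurable conf"
  have "(\<lambda>\<eta>. G (move y x \<eta>)) \<in> borel_measurable conf" using G by measurable
  from exchangeD[OF assms this]
  have "(\<integral>\<^sup>+\<eta>. ennreal (g (\<eta> y)) * G (move y x \<eta>) \<partial>Q) = (\<integral>\<^sup>+\<eta>. ennreal (g (\<eta> x)) * G (move y x (move x y \<eta>)) \<partial>Q)" by simp
  also have "(\<lambda>\<eta>. ennreal (g (\<eta> x)) * G (move y x (move x y \<eta>))) = (\<lambda>\<eta>. ennreal (g (\<eta> x)) * G \<eta>)"
  proof
    fix \<eta> show "ennreal (g (\<eta> x)) * G (move y x (move x y \<eta>)) = ennreal (g (\<eta> x)) * G \<eta>"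
      by (cases "\<eta> x = 0") (simp_all add: move_move move_self)
  qed
  finally show "(\<integral>\<^sup>+\<eta>. ennreal (g (\<eta> y)) * G (move y x \<eta>) \<partial>Q) = (\<integral>\<^sup>+\<eta>. ennreal (g (\<eta> x)) * G \<eta> \<partial>Q)" .
qed

text \<open>Moving through \<open>z\<close> equals moving directly when \<open>x\<close> is
  occupied; otherwise the rate at \<open>x\<close> is 0.\<close>

lemma exchange_trans:
  fixes Q :: "'d config measure"
  assumes "exchange g Q x z" "exchange g Q z y"
  shows "exchange g Q x y"
  unfolding exchange_def
proof
  fix G :: "'d config \<Rightarrow> ennreal" assume G: "G \<in> borel_measurable conf"
  have "(\<lambda>\<eta>. G (move z y \<eta>)) \<in> borel_measurable conf" using G by measurable
  from exchangeD[OF assms(1) this]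
  have "(\<integral>\<^sup>+\<eta>. ennreal (g (\<eta> x)) * G (move z y (move x z \<eta>)) \<partial>Q) = (\<integral>\<^sup>+\<eta>. ennreal (g (\<eta> z)) * G (move z y \<eta>) \<partial>Q)" .
  also have "\<dots> = (\<integral>\<^sup>+\<eta>. ennreal (g (\<eta> y)) * G \<eta> \<partial>Q)" by (rule exchangeD[OF assms(2) G])
  also have "(\<lambda>\<eta>. ennreal (g (\<eta> x)) * G (move z y (move x z \<eta>))) = (\<lambda>\<eta>. ennreal (g (\<eta> x)) * G (move x y \<eta>))"
  proof
    fix \<eta> show "ennreal (g (\<eta> x)) * G (move z y (move x z \<eta>)) = ennreal (g (\<eta> x)) * G (move x y \<eta>)"
      by (cases "\<eta> x = 0") (simp_all add: move_move)
  qed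
  finally show "(\<integral>\<^sup>+\<eta>. ennreal (g (\<eta> x)) * G (move x y \<eta>) \<partial>Q) = (\<integral>\<^sup>+\<eta>. ennreal (g (\<eta> y)) * G \<eta> \<partial>Q)" .
qed

lemma move_in_cyl_iff:
  assumes "x \<noteq> y" "x \<in> S" "y \<in> S" "1 \<le> \<eta> x" "1 \<le> e y"
  shows "move x y \<eta> \<in> cyl S e \<longleftrightarrow> \<eta> \<in> cyl S (move y x e)"
proof -
  have "move x y \<eta> z = e z \<longleftrightarrow> \<eta> z = move y x e z" if "z \<in> S" for z
    using assms by (auto simp: move_apply)
  then show ?thesis by (auto simp: cyl_def)
qed

lemma move_cyl_weight:
  assumes xy: "x \<noteq> y" and S: "x \<in> S" "y \<in> S" and e: "1 \<le> e y"
  shows "ennreal (g (\<eta> x)) * indicator (cyl S e) (move x y \<eta>) = ennreal (g (Suc (e x))) * indicator (cyl S (move y x e)) \<eta>"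
proof (cases "\<eta> x = 0")
  case True
  then have "\<eta> \<notin> cyl S (move y x e)" using S xy by (auto simp: cyl_def move_apply)
  then show ?thesis using True by simp
next
  case F: False
  then have "move x y \<eta> \<in> cyl S e \<longleftrightarrow> \<eta> \<in> cyl S (move y x e)"
    using move_in_cyl_iff[OF xy, of S \<eta> e] S e by auto
  moreover have "\<eta> x = Suc (e x)" if "\<eta> \<in> cyl S (move y x e)"
    using that S xy by (auto simp: cyl_def move_apply)
  ultimately show ?thesis by (auto simp: indicator_def)
qed

text \<open>Compares \<open>Q\<close> weighted by the rate at \<open>y\<close> with the image under
  the move of \<open>Q\<close> weighted by the rate at \<open>x\<close>; finiteness of the former
  lets cylinders decide.\<close>

lemma exchange_cylI:
  fixes Q :: "'d config measure"
  assumes Q: "finite_measure Q" "sets Q = sets conf" and fin: "(\<integral>\<^sup>+\<eta>. ennreal (g (\<eta> y)) \<partial>Q) < \<infinity>"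
    and xy: "x \<noteq> y"
    and eq: "\<And>S e. finite S \<Longrightarrow> x \<in> S \<Longrightarrow> y \<in> S \<Longrightarrow> 1 \<le> e y \<Longrightarrow>
      g (Suc (e x)) * measure Q (cyl S (move y x e)) = g (e y) * measure Q (cyl S e)"
  shows "exchange g Q x y"
proof -
  interpret Q: finite_measure Q by fact
  have mQ [measurable_cong]: "sets Q = sets conf" by fact
  have sp: "space Q = UNIV" using sets_eq_imp_space_eq[OF Q(2)] by simp
  have [measurable]: "(\<lambda>\<eta>. ennreal (g (\<eta> z))) \<in> borel_measurable Q" for z by measurable
  define P1 where "P1 = density Q (\<lambda>\<eta>. ennreal (g (\<eta> y)))"
  define P2 where "P2 = distr (density Q (\<lambda>\<eta>. ennreal (g (\<eta> x)))) conf (move x y)"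
  have sd: "sets (density Q f) = sets conf" for f using Q(2) by simp
  have mv: "move x y \<in> density Q (\<lambda>\<eta>. ennreal (g (\<eta> x))) \<rightarrow>\<^sub>M conf"
    using measurable_move by (subst measurable_cong_sets[OF sd refl])
  have "P1 = P2"
  proof (rule cylinder_measure_eqI[where ?S0.0 = "{x, y}"])
    show "finite_measure P1"
    proof (rule finite_measureI)
      have "emeasure P1 (space Q) = (\<integral>\<^sup>+\<eta>. ennreal (g (\<eta> y)) * indicator (space Q) \<eta> \<partial>Q)"
        unfolding P1_def by (rule emeasure_density) measurable
      then show "emeasure P1 (space P1) \<noteq> \<infinity>" using fin by (simp add: P1_def sp)
    qed
    fix S e assume S: "finite S" "{x, y} \<subseteq> S"
    have cs [measurable]: "cyl S f \<in> sets Q" for f using cyl_sets[OF S(1)] Q(2) by simp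
    have 1: "emeasure P1 (cyl S e) = ennreal (g (e y) * measure Q (cyl S e))"
    proof -
      have "emeasure P1 (cyl S e) = (\<integral>\<^sup>+\<eta>. ennreal (g (\<eta> y)) * indicator (cyl S e) \<eta> \<partial>Q)"
        unfolding P1_def by (rule emeasure_density) measurable
      also have "\<dots> = (\<integral>\<^sup>+\<eta>. ennreal (g (e y)) * indicator (cyl S e) \<eta> \<partial>Q)"
        using S by (intro nn_integral_cong) (auto simp: indicator_def cyl_def)
      also have "\<dots> = ennreal (g (e y) * measure Q (cyl S e))"
        by (subst nn_integral_cmult_indicator) (auto simp: Q.emeasure_eq_measure ennreal_mult)
      finally show ?thesis .
    qed
    have pre: "move x y -` cyl S e \<in> sets Q"
      using measurable_sets[OF measurable_move cyl_sets[OF S(1)], of x y e] Q(2) by simp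
    have "emeasure P2 (cyl S e) = emeasure (density Q (\<lambda>\<eta>. ennreal (g (\<eta> x)))) (move x y -` cyl S e)"
      unfolding P2_def by (subst emeasure_distr[OF mv cyl_sets[OF S(1)]]) (simp add: sp)
    also have "\<dots> = (\<integral>\<^sup>+\<eta>. ennreal (g (\<eta> x)) * indicator (move x y -` cyl S e) \<eta> \<partial>Q)"
      by (rule emeasure_density[OF _ pre]) measurable
    also have "\<dots> = ennreal (g (e y) * measure Q (cyl S e))"
    proof (cases "e y = 0")
      \<comment> \<open>A move to \<open>y\<close> leaves \<open>y\<close> occupied, so both sides
        vanish; this is why \<open>eq\<close> asks for \<open>1 \<le> e y\<close>.\<close>
      case True
      have "ennreal (g (\<eta> x)) * indicator (move x y -` cyl S e) \<eta> = 0" for \<eta>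
        using True S by (auto simp: indicator_def cyl_def move_apply split: if_splits)
      then have "(\<lambda>\<eta>. ennreal (g (\<eta> x)) * indicator (move x y -` cyl S e) \<eta>) = (\<lambda>\<eta>. 0)" by (rule ext)
      then show ?thesis unfolding True by simp
    next
      case False
      have "ennreal (g (\<eta> x)) * indicator (move x y -` cyl S e) \<eta> = ennreal (g (Suc (e x))) * indicator (cyl S (move y x e)) \<eta>" for \<eta>
        using move_cyl_weight[OF xy, of S e \<eta>] S False by (simp add: indicator_def)
      then have "(\<integral>\<^sup>+\<eta>. ennreal (g (\<eta> x)) * indicator (move x y -` cyl S e) \<eta> \<partial>Q)
          = ennreal (g (Suc (e x)) * measure Q (cyl S (move y x e)))"
        by (simp add: nn_integral_cmult_indicator Q.emeasure_eq_measure ennreal_mult)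
      then show ?thesis using eq[OF S(1), of e] S False by simp
    qed
    finally show "emeasure P1 (cyl S e) = emeasure P2 (cyl S e)" using 1 by simp
  qed (auto simp: P1_def P2_def Q(2))
  then have PP: "(\<integral>\<^sup>+\<eta>. G \<eta> \<partial>P1) = (\<integral>\<^sup>+\<eta>. G \<eta> \<partial>P2)" for G by simp
  show ?thesis
    unfolding exchange_def
  proof
    fix G :: "'d config \<Rightarrow> ennreal" assume G [measurable]: "G \<in> borel_measurable conf"
    have "(\<integral>\<^sup>+\<eta>. ennreal (g (\<eta> y)) * G \<eta> \<partial>Q) = (\<integral>\<^sup>+\<eta>. G \<eta> \<partial>P1)"
      unfolding P1_def by (rule nn_integral_density[symmetric]) measurable
    also have "\<dots> = (\<integral>\<^sup>+\<eta>. G (move x y \<eta>) \<partial>density Q (\<lambda>\<eta>. ennreal (g (\<eta> x))))"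
      unfolding PP P2_def by (rule nn_integral_distr[OF mv]) (use G in simp)
    also have "\<dots> = (\<integral>\<^sup>+\<eta>. ennreal (g (\<eta> x)) * G (move x y \<eta>) \<partial>Q)"
      by (rule nn_integral_density) measurable
    finally show "(\<integral>\<^sup>+\<eta>. ennreal (g (\<eta> x)) * G (move x y \<eta>) \<partial>Q) = (\<integral>\<^sup>+\<eta>. ennreal (g (\<eta> y)) * G \<eta> \<partial>Q)" by simp
  qed
qed

lemma exchange_cylD:
  fixes Q :: "'d config measure"
  assumes ex: "exchange g Q x y" and Q: "finite_measure Q" "sets Q = sets conf" and xy: "x \<noteq> y"
    and S: "finite S" "x \<in> S" "y \<in> S" and e: "1 \<le> e y"
  shows "g (Suc (e x)) * measure Q (cyl S (move y x e)) = g (e y) * measure Q (cyl S e)"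
proof -
  interpret Q: finite_measure Q by fact
  have cs [measurable]: "cyl S f \<in> sets Q" for f using cyl_sets[OF S(1)] Q(2) by simp
  have "(\<integral>\<^sup>+\<eta>. ennreal (g (\<eta> x)) * indicator (cyl S e) (move x y \<eta>) \<partial>Q) = (\<integral>\<^sup>+\<eta>. ennreal (g (\<eta> y)) * indicator (cyl S e) \<eta> \<partial>Q)"
    by (rule exchangeD[OF ex]) (use cyl_sets[OF S(1)] in simp)
  also have "(\<lambda>\<eta>. ennreal (g (\<eta> y)) * indicator (cyl S e) \<eta>) = (\<lambda>\<eta>. ennreal (g (e y)) * indicator (cyl S e) \<eta>)"
    using S by (auto simp: indicator_def cyl_def)
  also have "(\<lambda>\<eta>. ennreal (g (\<eta> x)) * indicator (cyl S e) (move x y \<eta>)) = (\<lambda>\<eta>. ennreal (g (Suc (e x))) * indicator (cyl S (move y x e)) \<eta>)"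
    by (intro ext move_cyl_weight xy S(2,3) e)
  finally have "ennreal (g (Suc (e x)) * measure Q (cyl S (move y x e))) = ennreal (g (e y) * measure Q (cyl S e))"
    by (simp add: nn_integral_cmult_indicator Q.emeasure_eq_measure ennreal_mult)
  then show ?thesis by (subst (asm) ennreal_inj) auto
qed

section \<open>Measurability on \<open>Omega'\<close> and local functions\<close>

lemma measurable_nn_mass: "(\<lambda>\<eta>. \<integral>\<^sup>+x. ennreal (real (\<eta> x) * \<beta> p x) \<partial>count_space UNIV) \<in> borel_measurable (conf :: 'd config measure)"
proof (rule sigma_finite_measure.borel_measurable_nn_integral)
  show "sigma_finite_measure (count_space (UNIV :: 'd site set))"
    by (rule sigma_finite_measure_count_space_countable) simp
  show "(\<lambda>(\<eta>, x). ennreal (real (\<eta> x) * \<beta> p x)) \<in> borel_measurable ((conf :: 'd config measure) \<Otimes>\<^sub>M count_space UNIV)"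
    unfolding case_prod_beta
    by (rule measurable_compose_countable[of "\<lambda>x \<omega>. ennreal (real (fst \<omega> x) * \<beta> p x)" _ _ snd]) measurable
qed

lemma Omega'_sets: "Omega' p \<in> sets conf"
proof -
  note [measurable] = measurable_nn_mass
  have "Omega' p = {\<eta>\<in>space conf. (\<integral>\<^sup>+x. ennreal (real (\<eta> x) * \<beta> p x) \<partial>count_space UNIV) < \<infinity>}"
    by (auto simp: Omega'_iff integrable_iff_bounded abs_mult)
  also have "\<dots> \<in> sets conf" by measurable
  finally show ?thesis .
qed

lemma mass_measurable: "mass \<in> borel_measurable conf"
proof -
  have "mass = (\<lambda>\<eta>. enn2real (\<integral>\<^sup>+x. ennreal (real (\<eta> x) * \<beta> p x) \<partial>count_space UNIV))"
    unfolding mass_def by (intro ext integral_eq_nn_integral) auto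
  then show ?thesis using measurable_nn_mass by simp
qed

text \<open>On \<open>Omega'\<close> a Lipschitz function is the limit of its values at truncations,
  which depend on finitely many coordinates.\<close>

lemma Lip_measurable:
  assumes u: "u \<in> Lip p"
  shows "u \<in> borel_measurable conf"
proof -
  obtain C where C: "lip_bound p u C" using u by (auto simp: Lip_def)
  have tr: "trunc n \<eta> = restr {x. to_nat (x :: 'd site) < n} \<eta>" for n \<eta> by (simp add: trunc_def restr_def)
  show "u \<in> borel_measurable conf"
  proof (rule borel_measurable_LIMSEQ_real)
    show "(\<lambda>n. indicator (Omega' p) \<eta> * u (trunc n \<eta>)) \<longlonglongrightarrow> u \<eta>" if "\<eta> \<in> space conf" for \<eta>
    proof (cases "\<eta> \<in> Omega' p")
      case True
      then show ?thesis using lip_trunc[OF C True] by simp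
    next
      case False
      then show ?thesis using u by (simp add: Lip_def)
    qed
    show "(\<lambda>\<eta>. indicator (Omega' p) \<eta> * u (trunc n \<eta>)) \<in> borel_measurable conf" for n
    proof (rule borel_measurable_times)
      show "indicator (Omega' p) \<in> borel_measurable conf" using Omega'_sets by simp
      show "(\<lambda>\<eta>. u (trunc n \<eta>)) \<in> borel_measurable conf"
        unfolding tr by (rule measurable_compose[OF measurable_restr[OF finite_to_nat_less]]) simp
    qed
  qed
qed

lemma local_fun_lip:
  assumes u: "local_fun u" and B: "\<And>\<eta>. \<bar>u \<eta>\<bar> \<le> B"
  shows "(\<lambda>\<eta>. indicator (Omega' p) \<eta> * u \<eta>) \<in> Lip p" "\<exists>C. lip_bound p (\<lambda>\<eta>. indicator (Omega' p) \<eta> * u \<eta>) C"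
proof -
  obtain S where S: "finite S" "\<And>\<eta>. u (restr S \<eta>) = u \<eta>" using u by (auto simp: local_fun_def)
  have B0: "0 \<le> B" using B[of undefined] by linarith
  \<comment> \<open>Configurations that differ on \<open>S\<close> are at distance at least
    \<open>b\<close>, and those that agree on \<open>S\<close> have the same value; this yields the
    constant \<open>2 * B / b\<close>.\<close>
  define b where "b = (if S = {} then 1 else Min (\<beta> p ` S))"
  have b: "0 < b" "\<And>x. x \<in> S \<Longrightarrow> b \<le> \<beta> p x" using S(1) by (auto simp: b_def)
  have "lip_bound p (\<lambda>\<eta>. indicator (Omega' p) \<eta> * u \<eta>) (2 * B / b)"
    unfolding lip_bound_def
  proof (intro conjI ballI)
    show "0 \<le> 2 * B / b" using B0 b by simp
    fix \<eta> \<zeta> assume o: "\<eta> \<in> Omega' p" "\<zeta> \<in> Omega' p"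
    show "\<bar>indicator (Omega' p) \<eta> * u \<eta> - indicator (Omega' p) \<zeta> * u \<zeta>\<bar> \<le> 2 * B / b * config_dist p \<eta> \<zeta>"
    proof (cases "restr S \<eta> = restr S \<zeta>")
      case True
      then have "u \<eta> = u \<zeta>" using S(2) by metis
      then show ?thesis using o B0 b config_dist_nonneg[OF o] by simp
    next
      case False
      then obtain z where z: "z \<in> S" "\<eta> z \<noteq> \<zeta> z" by (auto simp: restr_def fun_eq_iff split: if_splits)
      have "b \<le> \<beta> p z" by (rule b(2)[OF z(1)])
      also have "\<dots> \<le> (\<integral>x. of_bool (x = z) * \<beta> p x \<partial>count_space UNIV)" by simp
      also have "\<dots> \<le> config_dist p \<eta> \<zeta>"
        unfolding config_dist_eq[OF o] using z(2)
        by (intro integral_mono integrable_dist[OF o] count_space_point mult_right_mono) auto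
      finally have "b \<le> config_dist p \<eta> \<zeta>" .
      then have "2 * B / b * b \<le> 2 * B / b * config_dist p \<eta> \<zeta>" using B0 b by (intro mult_left_mono) auto
      moreover have "\<bar>u \<eta> - u \<zeta>\<bar> \<le> 2 * B" using B[of \<eta>] B[of \<zeta>] by linarith
      ultimately show ?thesis using o b by simp
    qed
  qed
  then show "\<exists>C. lip_bound p (\<lambda>\<eta>. indicator (Omega' p) \<eta> * u \<eta>) C" by blast
  then show "(\<lambda>\<eta>. indicator (Omega' p) \<eta> * u \<eta>) \<in> Lip p" by (auto simp: Lip_def)
qed

end


section \<open>The product measure\<close>

locale zero_range_equilibrium = zero_range_process g p a0 P
  for g :: "nat \<Rightarrow> real" and p :: "'d::finite site \<Rightarrow> real" and a0 :: real
    and P :: "real \<Rightarrow> 'd observable \<Rightarrow> 'd observable" +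
  fixes \<psi> :: real
  assumes \<psi>: "\<psi> \<in> fugacities g"
begin

abbreviation q :: "nat \<Rightarrow> real" where "q \<equiv> pmf (\<kappa> g \<psi>)"

text \<open>The measure \<nu>, parametrized by its fugacity instead of its density.\<close>

definition N :: "'d config measure" where
  "N = PiM UNIV (\<lambda>_. measure_pmf (\<kappa> g \<psi>))"

lemma sets_N [measurable_cong, simp]: "sets N = sets conf"
  unfolding N_def by (intro sets_PiM_cong) auto

lemma space_N [simp]: "space N = UNIV"
  using sets_eq_imp_space_eq[OF sets_N] by simp

lemma measurable_N [simp]: "(f \<in> borel_measurable N) = (f \<in> borel_measurable conf)"
  by (simp cong: measurable_cong_sets)

sublocale N: prob_space N
  unfolding N_def by (rule prob_space_PiM) (rule measure_pmf.prob_space_axioms)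

lemma product_prob: "product_prob_space (\<lambda>_. measure_pmf (\<kappa> g \<psi>))"
  by unfold_locales

lemma measure_N_UNIV [simp]: "measure N UNIV = 1"
  using N.prob_space by simp

lemma measure_N_cyl:
  assumes "finite S"
  shows "measure N (cyl S e) = (\<Prod>z\<in>S. q (e z))"
proof -
  have "emeasure N {\<eta>\<in>space N. \<forall>z\<in>S. \<eta> z \<in> {e z}} = (\<Prod>z\<in>S. emeasure (measure_pmf (\<kappa> g \<psi>)) {e z})"
    unfolding N_def by (rule product_prob_space.emeasure_PiM_Collect[OF product_prob]) (use assms in auto)
  then have "emeasure N (cyl S e) = ennreal (\<Prod>z\<in>S. q (e z))"
    by (simp add: cyl_def emeasure_pmf_single prod_ennreal)
  then show ?thesis by (simp add: N.emeasure_eq_measure prod_nonneg)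
qed

lemma nn_integral_coordinate: "(\<integral>\<^sup>+\<eta>. f (\<eta> x) \<partial>N) = (\<integral>\<^sup>+k. f k \<partial>measure_pmf (\<kappa> g \<psi>))"
proof -
  have "distr N (measure_pmf (\<kappa> g \<psi>)) (\<lambda>\<eta>. \<eta> x) = measure_pmf (\<kappa> g \<psi>)"
    unfolding N_def by (rule product_prob_space.PiM_component[OF product_prob]) simp
  then have "(\<integral>\<^sup>+k. f k \<partial>measure_pmf (\<kappa> g \<psi>)) = (\<integral>\<^sup>+k. f k \<partial>distr N (measure_pmf (\<kappa> g \<psi>)) (\<lambda>\<eta>. \<eta> x))" by simp
  also have "\<dots> = (\<integral>\<^sup>+\<eta>. f (\<eta> x) \<partial>N)"
    by (rule nn_integral_distr) (auto simp: N_def intro: measurable_component_singleton)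
  finally show ?thesis by simp
qed

definition m1 :: real where "m1 = density_of g \<psi>"

lemma m1_nonneg [simp]: "0 \<le> m1"
  by (simp add: m1_def density_of_def)

lemma nn_integral_occupation: "(\<integral>\<^sup>+\<eta>. ennreal (real (\<eta> x)) \<partial>N) = ennreal m1"
  unfolding nn_integral_coordinate[of "\<lambda>k. ennreal (real k)"] m1_def density_of_def
  by (rule nn_integral_eq_integral[OF \<kappa>_moment(1)[OF \<psi>]]) auto

lemma nn_integral_g: "(\<integral>\<^sup>+\<eta>. ennreal (g (\<eta> x)) \<partial>N) \<le> ennreal (a0 * m1)"
proof -
  have "(\<integral>\<^sup>+\<eta>. ennreal (g (\<eta> x)) \<partial>N) \<le> (\<integral>\<^sup>+\<eta>. ennreal a0 * ennreal (real (\<eta> x)) \<partial>N)"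
    using g_le by (intro nn_integral_mono) (simp add: ennreal_mult[symmetric] a0_nonneg)
  also have "\<dots> = ennreal (a0 * m1)"
    by (subst nn_integral_cmult) (simp_all add: nn_integral_occupation ennreal_mult a0_nonneg)
  finally show ?thesis .
qed

text \<open>The 2 is the total weight of \<beta>. Finiteness of the mean puts almost every
  configuration into \<open>Omega'\<close>.\<close>

lemma nn_integral_mass: "(\<integral>\<^sup>+\<eta>. (\<integral>\<^sup>+x. ennreal (real (\<eta> x) * \<beta> p x) \<partial>count_space UNIV) \<partial>N) = ennreal (2 * m1)"
proof -
  interpret S: pair_sigma_finite "count_space (UNIV :: 'd site set)" N
    by (intro pair_sigma_finite.intro sigma_finite_measure_count_space_countable N.sigma_finite_measure_axioms) simp
  have "(\<integral>\<^sup>+\<eta>. (\<integral>\<^sup>+x. ennreal (real (\<eta> x) * \<beta> p x) \<partial>count_space UNIV) \<partial>N)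
      = (\<integral>\<^sup>+x. (\<integral>\<^sup>+\<eta>. ennreal (real (\<eta> x) * \<beta> p x) \<partial>N) \<partial>count_space UNIV)"
    by (rule S.Fubini') (simp add: measurable_pair_measure_countable1)
  also have "\<dots> = (\<integral>\<^sup>+x. ennreal m1 * ennreal (\<beta> p x) \<partial>count_space UNIV)"
    by (intro nn_integral_cong) (simp add: ennreal_mult nn_integral_multc nn_integral_occupation)
  also have "\<dots> = ennreal (2 * m1)"
    by (subst nn_integral_cmult) (simp_all add: \<beta>_sum ennreal_mult' mult.commute)
  finally show ?thesis .
qed

lemma AE_Omega': "AE \<eta> in N. \<eta> \<in> Omega' p"
proof -
  have "AE \<eta> in N. (\<integral>\<^sup>+x. ennreal (real (\<eta> x) * \<beta> p x) \<partial>count_space UNIV) \<noteq> \<infinity>"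
    by (rule nn_integral_PInf_AE) (use measurable_nn_mass nn_integral_mass in auto)
  then show ?thesis
    by eventually_elim (auto simp: Omega'_iff integrable_iff_bounded abs_mult top.not_eq_extremum)
qed

lemma integrable_mass: "integrable N mass"
proof (rule integrableI_nonneg)
  show "mass \<in> borel_measurable N" using mass_measurable by simp
  have "(\<integral>\<^sup>+\<eta>. ennreal (mass \<eta>) \<partial>N) = (\<integral>\<^sup>+\<eta>. (\<integral>\<^sup>+x. ennreal (real (\<eta> x) * \<beta> p x) \<partial>count_space UNIV) \<partial>N)"
  proof (rule nn_integral_cong_AE)
    show "AE \<eta> in N. ennreal (mass \<eta>) = (\<integral>\<^sup>+x. ennreal (real (\<eta> x) * \<beta> p x) \<partial>count_space UNIV)"
      using AE_Omega'
    proof eventually_elim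
      case (elim \<eta>)
      then show ?case unfolding mass_def by (intro nn_integral_eq_integral[symmetric]) (auto simp: Omega'_iff)
    qed
  qed
  then show "(\<integral>\<^sup>+\<eta>. ennreal (mass \<eta>) \<partial>N) < \<infinity>" by (simp add: nn_integral_mass)
qed auto

text \<open>Detailed balance is used once at \<open>x\<close> and once at \<open>y\<close>, and the
  two factors \<psi> cancel.\<close>

lemma exchange_N: "exchange g N x y"
proof (cases "x = y")
  case False
  show ?thesis
  proof (rule exchange_cylI[OF N.finite_measure_axioms sets_N _ False])
    show "(\<integral>\<^sup>+\<eta>. ennreal (g (\<eta> y)) \<partial>N) < \<infinity>" by (rule le_less_trans[OF nn_integral_g]) simp
    fix S and e :: "'d config" assume S: "finite S" "x \<in> S" "y \<in> S" "1 \<le> e y"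
    define R where "R = S - {x} - {y}"
    have R: "S = insert x (insert y R)" "x \<notin> insert y R" "y \<notin> R" "finite R" using S False by (auto simp: R_def)
    have "(\<Prod>z\<in>R. q (move y x e z)) = (\<Prod>z\<in>R. q (e z))"
      using R by (intro prod.cong) (auto simp: move_apply)
    then have 1: "measure N (cyl S (move y x e)) = q (Suc (e x)) * (q (e y - 1) * (\<Prod>z\<in>R. q (e z)))"
      unfolding measure_N_cyl[OF S(1)] using R False by (simp add: move_apply)
    have 2: "measure N (cyl S e) = q (e x) * (q (e y) * (\<Prod>z\<in>R. q (e z)))"
      unfolding measure_N_cyl[OF S(1)] using R by simp
    have b: "g (Suc (e x)) * q (Suc (e x)) = \<psi> * q (e x)" by (rule \<kappa>_detailed_balance[OF \<psi>])
    have c: "g (e y) * q (e y) = \<psi> * q (e y - 1)"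
      using \<kappa>_detailed_balance[OF \<psi>, of "e y - 1"] S(4) by simp
    have "g (Suc (e x)) * measure N (cyl S (move y x e)) = (g (Suc (e x)) * q (Suc (e x))) * (q (e y - 1) * (\<Prod>z\<in>R. q (e z)))"
      unfolding 1 by simp
    also have "\<dots> = (\<psi> * q (e y - 1)) * (q (e x) * (\<Prod>z\<in>R. q (e z)))" unfolding b by simp
    also have "\<dots> = g (e y) * measure N (cyl S e)" unfolding 2 c[symmetric] by simp
    finally show "g (Suc (e x)) * measure N (cyl S (move y x e)) = g (e y) * measure N (cyl S e)" .
  qed
qed (simp add: exchange_refl)

text \<open>Independence kills the cross terms, so the average has variance at most
  \<open>1 / card Y\<close>. The estimate is in L1 because it will be paired with bounded
  densities.\<close>

lemma weak_law:
  assumes Y: "finite Y" "Y \<noteq> {}"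
  shows "(\<integral>\<eta>. \<bar>(\<Sum>y\<in>Y. of_bool (\<eta> y = j)) / real (card Y) - q j\<bar> \<partial>N) \<le> 1 / sqrt (real (card Y))"
proof -
  define n where "n = real (card Y)"
  have n: "0 < n" using Y by (simp add: n_def card_gt_0_iff)
  define X where "X y \<eta> = of_bool (\<eta> y = j) - q j" for y and \<eta> :: "'d config"
  have q01: "0 \<le> q j" "q j \<le> 1" by (auto simp: pmf_le_1)
  have X1: "\<bar>X y \<eta>\<bar> \<le> 1" for y \<eta> using q01 by (auto simp: X_def)
  have Xm [measurable]: "X y \<in> borel_measurable conf" for y unfolding X_def[abs_def] by measurable
  have iXX: "integrable N (\<lambda>\<eta>. X y \<eta> * X z \<eta>)" for y z
    by (rule N.integrable_const_bound[of _ 1]) (use X1 in \<open>auto simp: abs_mult mult_le_one\<close>)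
  have ic: "integrable N (indicator (cyl S e) :: _ \<Rightarrow> real)" if "finite S" for S e
    using cyl_sets[OF that] by (auto simp: N.emeasure_eq_measure)
  have ob: "of_bool (\<eta> y = j) = (indicator (cyl {y} (\<lambda>_. j)) \<eta> :: real)" for y and \<eta> :: "'d config"
    by (simp add: cyl_def indicator_def)
  have obb: "of_bool (\<eta> y = j) * of_bool (\<eta> z = j) = (indicator (cyl {y, z} (\<lambda>_. j)) \<eta> :: real)" for y z and \<eta> :: "'d config"
    by (simp add: cyl_def indicator_def)
  have cov: "(\<integral>\<eta>. X y \<eta> * X z \<eta> \<partial>N) = 0" if "y \<noteq> z" for y z
  proof -
    have "(\<integral>\<eta>. X y \<eta> * X z \<eta> \<partial>N) = (\<integral>\<eta>. indicator (cyl {y, z} (\<lambda>_. j)) \<eta> - q j * indicator (cyl {y} (\<lambda>_. j)) \<eta>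
        - q j * indicator (cyl {z} (\<lambda>_. j)) \<eta> + q j * q j \<partial>N)"
      unfolding obb[symmetric] ob[symmetric] X_def by (simp add: algebra_simps)
    also have "\<dots> = measure N (cyl {y, z} (\<lambda>_. j)) - q j * measure N (cyl {y} (\<lambda>_. j)) - q j * measure N (cyl {z} (\<lambda>_. j)) + q j * q j"
      using ic[of "{y, z}" "\<lambda>_. j"] ic[of "{y}" "\<lambda>_. j"] ic[of "{z}" "\<lambda>_. j"] by (simp add: measure_N_UNIV)
    also have "\<dots> = 0" using that by (simp add: measure_N_cyl)
    finally show ?thesis .
  qed
  have var: "(\<integral>\<eta>. X y \<eta> * X y \<eta> \<partial>N) \<le> 1" for y
  proof -
    have "(\<integral>\<eta>. X y \<eta> * X y \<eta> \<partial>N) \<le> (\<integral>\<eta>. 1 \<partial>N)"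
    proof (intro integral_mono iXX)
      show "X y \<eta> * X y \<eta> \<le> 1" for \<eta>
        using mult_mono[OF X1[of y \<eta>] X1[of y \<eta>]] by simp
    qed simp
    then show ?thesis by (simp add: measure_N_UNIV)
  qed
  define A where "A \<eta> = (\<Sum>y\<in>Y. X y \<eta>) / n" for \<eta>
  have A: "A \<eta> = (\<Sum>y\<in>Y. of_bool (\<eta> y = j)) / real (card Y) - q j" for \<eta>
    using n by (simp add: A_def X_def sum_subtractf n_def field_simps)
  have Am [measurable]: "A \<in> borel_measurable conf" unfolding A_def[abs_def] by measurable
  have A2: "(A \<eta>)\<^sup>2 = (\<Sum>y\<in>Y. \<Sum>z\<in>Y. X y \<eta> * X z \<eta>) / n\<^sup>2" for \<eta>
    by (simp add: A_def power_divide power2_eq_square sum_product)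
  have iA2: "integrable N (\<lambda>\<eta>. (A \<eta>)\<^sup>2)" unfolding A2 by (intro integrable_divide Bochner_Integration.integrable_sum iXX)
  have "(\<integral>\<eta>. (A \<eta>)\<^sup>2 \<partial>N) = (\<Sum>y\<in>Y. \<Sum>z\<in>Y. \<integral>\<eta>. X y \<eta> * X z \<eta> \<partial>N) / n\<^sup>2"
    unfolding A2 using iXX by (simp add: Bochner_Integration.integral_sum Bochner_Integration.integrable_sum)
  also have "(\<Sum>y\<in>Y. \<Sum>z\<in>Y. \<integral>\<eta>. X y \<eta> * X z \<eta> \<partial>N) = (\<Sum>y\<in>Y. \<integral>\<eta>. X y \<eta> * X y \<eta> \<partial>N)"
  proof (rule sum.cong[OF refl])
    fix y assume y: "y \<in> Y"
    have "(\<Sum>z\<in>Y. \<integral>\<eta>. X y \<eta> * X z \<eta> \<partial>N) = (\<Sum>z\<in>Y. if z = y then \<integral>\<eta>. X y \<eta> * X y \<eta> \<partial>N else 0)"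
      using cov by (intro sum.cong) auto
    then show "(\<Sum>z\<in>Y. \<integral>\<eta>. X y \<eta> * X z \<eta> \<partial>N) = (\<integral>\<eta>. X y \<eta> * X y \<eta> \<partial>N)" using y Y by simp
  qed
  also have "(\<Sum>y\<in>Y. \<integral>\<eta>. X y \<eta> * X y \<eta> \<partial>N) / n\<^sup>2 \<le> (\<Sum>y\<in>Y. 1) / n\<^sup>2"
    using var by (intro divide_right_mono sum_mono) auto
  also have "\<dots> = 1 / n" using n by (simp add: n_def power2_eq_square)
  finally have A2le: "(\<integral>\<eta>. (A \<eta>)\<^sup>2 \<partial>N) \<le> 1 / n" .
  \<comment> \<open>Young's inequality, with the weight that balances its two terms, passes from the
    second moment to the first.\<close>
  define t where "t = sqrt n"
  have t: "0 < t" "t * t = n" using n by (simp_all add: t_def)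
  have pt: "\<bar>A \<eta>\<bar> \<le> t / 2 * (A \<eta>)\<^sup>2 + 1 / (2 * t)" for \<eta>
  proof -
    have "0 \<le> (t * \<bar>A \<eta>\<bar> - 1)\<^sup>2" by simp
    then have "2 * t * \<bar>A \<eta>\<bar> \<le> t * t * (A \<eta>)\<^sup>2 + 1" by (simp add: power2_eq_square algebra_simps)
    then show ?thesis using t(1) by (simp add: field_simps)
  qed
  have "(\<integral>\<eta>. \<bar>A \<eta>\<bar> \<partial>N) \<le> (\<integral>\<eta>. t / 2 * (A \<eta>)\<^sup>2 + 1 / (2 * t) \<partial>N)"
  proof (rule integral_mono)
    have i: "integrable N (\<lambda>\<eta>. t / 2 * (A \<eta>)\<^sup>2 + 1 / (2 * t))" using iA2 by simp
    then show "integrable N (\<lambda>\<eta>. t / 2 * (A \<eta>)\<^sup>2 + 1 / (2 * t))" .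
    show "integrable N (\<lambda>\<eta>. \<bar>A \<eta>\<bar>)"
      by (rule Bochner_Integration.integrable_bound[OF i]) (use pt in \<open>auto intro: order_trans[OF _ abs_ge_self]\<close>)
  qed (rule pt)
  also have "\<dots> = t / 2 * (\<integral>\<eta>. (A \<eta>)\<^sup>2 \<partial>N) + 1 / (2 * t)" using iA2 by (simp add: measure_N_UNIV)
  also have "\<dots> \<le> t / 2 * (1 / n) + 1 / (2 * t)" using A2le t by (intro add_right_mono mult_left_mono) auto
  also have "\<dots> = 1 / t" using t by (simp add: t(2)[symmetric])
  finally show ?thesis by (simp add: A t_def n_def)
qed

end


section \<open>Stationary Markov semigroups\<close>

locale stationary_semigroup = prob_space M
  for M :: "'a measure" +
  fixes R :: "real \<Rightarrow> ('a \<Rightarrow> real) \<Rightarrow> 'a \<Rightarrow> real"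
  assumes markov: "L2_markov_semigroup M R"
    and stationary: "\<And>t f B. 0 \<le> t \<Longrightarrow> f \<in> borel_measurable M \<Longrightarrow> (\<And>x. \<bar>f x\<bar> \<le> B) \<Longrightarrow>
      (\<integral>x. R t f x \<partial>M) = (\<integral>x. f x \<partial>M)"
begin

definition bdd :: "('a \<Rightarrow> real) \<Rightarrow> bool" where
  "bdd f \<longleftrightarrow> f \<in> borel_measurable M \<and> (\<exists>B. \<forall>x. \<bar>f x\<bar> \<le> B)"

lemma bdd_measurable [measurable_dest]: "bdd f \<Longrightarrow> f \<in> borel_measurable M"
  by (simp add: bdd_def)

lemma bddI: "f \<in> borel_measurable M \<Longrightarrow> (\<And>x. \<bar>f x\<bar> \<le> B) \<Longrightarrow> bdd f"
  by (auto simp: bdd_def)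

lemma bdd_const: "bdd (\<lambda>_. c)"
  by (rule bddI[of _ "\<bar>c\<bar>"]) auto

lemma bdd_add: "bdd f \<Longrightarrow> bdd h \<Longrightarrow> bdd (\<lambda>x. f x + h x)"
proof -
  assume f: "bdd f" and h: "bdd h"
  then obtain B C where "\<And>x. \<bar>f x\<bar> \<le> B" "\<And>x. \<bar>h x\<bar> \<le> C" by (auto simp: bdd_def)
  then have "\<bar>f x + h x\<bar> \<le> B + C" for x using abs_triangle_ineq[of "f x" "h x"] by (meson add_mono order_trans)
  then show ?thesis using f h by (intro bddI) (auto simp: bdd_def)
qed

lemma bdd_mult: "bdd f \<Longrightarrow> bdd h \<Longrightarrow> bdd (\<lambda>x. f x * h x)"
proof -
  assume f: "bdd f" and h: "bdd h"
  then obtain B C where "\<And>x. \<bar>f x\<bar> \<le> B" "\<And>x. \<bar>h x\<bar> \<le> C" by (auto simp: bdd_def)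
  then have "\<bar>f x * h x\<bar> \<le> B * C" for x unfolding abs_mult by (intro mult_mono) (auto intro: order_trans[OF abs_ge_zero])
  then show ?thesis using f h by (intro bddI) (auto simp: bdd_def)
qed

lemma bdd_cmult: "bdd f \<Longrightarrow> bdd (\<lambda>x. c * f x)"
  by (rule bdd_mult[OF bdd_const])

lemma bdd_diff: "bdd f \<Longrightarrow> bdd h \<Longrightarrow> bdd (\<lambda>x. f x - h x)"
  using bdd_add[of f "\<lambda>x. (- 1) * h x"] bdd_cmult[of h "- 1"] by simp

lemma bdd_abs: "bdd f \<Longrightarrow> bdd (\<lambda>x. \<bar>f x\<bar>)"
  by (rule bdd_def[THEN iffD2]) (auto simp: bdd_def)

lemma bdd_integrable: "bdd f \<Longrightarrow> integrable M f"
  unfolding bdd_def by (elim conjE exE) (rule integrable_const_bound, auto)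

lemma bdd_L2: "bdd f \<Longrightarrow> f \<in> L2 M"
  using bdd_integrable[OF bdd_mult[of f f]] by (simp add: L2_def power2_eq_square bdd_measurable)

lemma R_props:
  "\<forall>t\<ge>0. \<forall>f\<in>L2 M. R t f \<in> L2 M"
  "\<forall>t\<ge>0. \<forall>f\<in>L2 M. \<forall>h\<in>L2 M. \<forall>a b. AE x in M. R t (\<lambda>y. a * f y + b * h y) x = a * R t f x + b * R t h x"
  "\<forall>t\<ge>0. \<forall>f\<in>L2 M. (AE x in M. 0 \<le> f x) \<longrightarrow> (AE x in M. 0 \<le> R t f x)"
  "\<forall>t\<ge>0. AE x in M. R t (\<lambda>_. 1) x = 1"
  by (rule markov[unfolded L2_markov_semigroup_def, THEN conjunct1]
      markov[unfolded L2_markov_semigroup_def, THEN conjunct2, THEN conjunct1]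
      markov[unfolded L2_markov_semigroup_def, THEN conjunct2, THEN conjunct2, THEN conjunct2, THEN conjunct2, THEN conjunct2, THEN conjunct1]
      markov[unfolded L2_markov_semigroup_def, THEN conjunct2, THEN conjunct2, THEN conjunct2, THEN conjunct2, THEN conjunct2, THEN conjunct2])+

lemma R_L2:
  assumes "0 \<le> t" "f \<in> L2 M"
  shows "R t f \<in> L2 M" "R t f \<in> borel_measurable M" "integrable M (\<lambda>x. (R t f x)\<^sup>2)" "integrable M (R t f)"
proof -
  show 1: "R t f \<in> L2 M" using R_props(1) assms by simp
  from 1 show 2: "R t f \<in> borel_measurable M" "integrable M (\<lambda>x. (R t f x)\<^sup>2)" by (simp_all add: L2_def)
  show "integrable M (R t f)" by (rule square_integrable_imp_integrable[OF 2])
qed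

lemma R_linear:
  "0 \<le> t \<Longrightarrow> f \<in> L2 M \<Longrightarrow> h \<in> L2 M \<Longrightarrow> AE x in M. R t (\<lambda>y. a * f y + b * h y) x = a * R t f x + b * R t h x"
  using R_props(2) by simp

lemma R_pos: "0 \<le> t \<Longrightarrow> f \<in> L2 M \<Longrightarrow> AE x in M. 0 \<le> f x \<Longrightarrow> AE x in M. 0 \<le> R t f x"
  using R_props(3) by simp

lemma R_one: "0 \<le> t \<Longrightarrow> AE x in M. R t (\<lambda>_. 1) x = 1"
  using R_props(4) by simp

lemma R_diff: "0 \<le> t \<Longrightarrow> bdd f \<Longrightarrow> bdd h \<Longrightarrow> AE x in M. R t (\<lambda>y. f y - h y) x = R t f x - R t h x"
  using R_linear[of t f h 1 "- 1"] by (simp add: bdd_L2)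

lemma R_abs_le:
  assumes t: "0 \<le> t" and f: "bdd f"
  shows "AE x in M. \<bar>R t f x\<bar> \<le> R t (\<lambda>y. \<bar>f y\<bar>) x"
proof -
  note af = bdd_abs[OF f]
  have 1: "AE x in M. 0 \<le> R t (\<lambda>y. 1 * \<bar>f y\<bar> + 1 * f y) x"
    by (rule R_pos[OF t bdd_L2[OF bdd_add[OF bdd_cmult[OF af] bdd_cmult[OF f]]]]) auto
  have 2: "AE x in M. 0 \<le> R t (\<lambda>y. 1 * \<bar>f y\<bar> + (- 1) * f y) x"
    by (rule R_pos[OF t bdd_L2[OF bdd_add[OF bdd_cmult[OF af] bdd_cmult[OF f]]]]) auto
  show ?thesis using 1 2 R_linear[OF t bdd_L2[OF af] bdd_L2[OF f], of 1 1] R_linear[OF t bdd_L2[OF af] bdd_L2[OF f], of 1 "- 1"]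
    by eventually_elim auto
qed

text \<open>L1 is the norm in which bounded functions are approximated by Lipschitz ones, so the
  semigroup has to be controlled in it.\<close>

lemma R_L1_contraction:
  assumes t: "0 \<le> t" and f: "bdd f"
  shows "(\<integral>x. \<bar>R t f x\<bar> \<partial>M) \<le> (\<integral>x. \<bar>f x\<bar> \<partial>M)"
proof -
  have "(\<integral>x. \<bar>R t f x\<bar> \<partial>M) \<le> (\<integral>x. R t (\<lambda>y. \<bar>f y\<bar>) x \<partial>M)"
    by (intro integral_mono_AE integrable_abs R_L2(4)[OF t] bdd_L2 bdd_abs f R_abs_le[OF t f])
  also have "\<dots> = (\<integral>x. \<bar>f x\<bar> \<partial>M)"
    using bdd_abs[OF f] by (auto simp: bdd_def intro!: stationary[OF t])
  finally show ?thesis .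
qed

text \<open>With no transition kernel at hand, positivity is applied to \<open>(f - a)^2\<close> for
  rational \<open>a\<close> only; the countably many null sets are united before optimizing over
  \<open>a\<close>.\<close>

lemma R_jensen:
  assumes t: "0 \<le> t" and f: "bdd f"
  shows "AE x in M. (R t f x)\<^sup>2 \<le> R t (\<lambda>y. f y * f y) x"
proof -
  note L = bdd_L2[OF bdd_mult[OF f f]] bdd_L2[OF f] bdd_L2[OF bdd_const[of 1]]
  have "AE x in M. 0 \<le> R t (\<lambda>y. f y * f y) x - 2 * a * R t f x + a\<^sup>2" for a
  proof -
    have b: "bdd (\<lambda>y. 1 * (f y * f y) + (- 2 * a) * f y)"
      by (intro bdd_add bdd_cmult bdd_mult f)
    have "AE x in M. 0 \<le> R t (\<lambda>y. 1 * (1 * (f y * f y) + (- 2 * a) * f y) + a\<^sup>2 * 1) x"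
    proof (rule R_pos[OF t bdd_L2[OF bdd_add[OF bdd_cmult[OF b] bdd_const]]], rule AE_I2)
      fix x
      have "0 \<le> (f x - a)\<^sup>2" by simp
      then show "0 \<le> 1 * (1 * (f x * f x) + (- 2 * a) * f x) + a\<^sup>2 * 1"
        by (simp add: power2_eq_square algebra_simps)
    qed
    then show ?thesis
      using R_linear[OF t bdd_L2[OF b] L(3), of 1 "a\<^sup>2"] R_linear[OF t L(1,2), of 1 "- 2 * a"] R_one[OF t]
      by eventually_elim simp
  qed
  then have "AE x in M. \<forall>a\<in>\<rat>. 0 \<le> R t (\<lambda>y. f y * f y) x - 2 * a * R t f x + a\<^sup>2"
    using countable_rat by (subst AE_ball_countable) auto
  then show ?thesis
  proof eventually_elim
    case (elim x)
    define c d where "c = R t f x" and "d = R t (\<lambda>y. f y * f y) x"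
    have "c\<^sup>2 \<le> d"
    proof (rule ccontr)
      assume "\<not> c\<^sup>2 \<le> d"
      then have pos: "0 < c\<^sup>2 - d" by simp
      then obtain a where a: "a \<in> \<rat>" "c < a" "a < c + sqrt (c\<^sup>2 - d)" using Rats_dense_in_real[of c "c + sqrt (c\<^sup>2 - d)"] by auto
      then have "(a - c)\<^sup>2 < (sqrt (c\<^sup>2 - d))\<^sup>2" by (intro power_strict_mono) auto
      then have "(a - c)\<^sup>2 < c\<^sup>2 - d" using pos by simp
      then have "d - 2 * a * c + a\<^sup>2 < 0" by (simp add: power2_eq_square algebra_simps)
      with elim a(1) show False by (auto simp: c_def d_def)
    qed
    then show ?case by (simp add: c_def d_def)
  qed
qed

text \<open>
  For \<open>\<phi>\<close> fixed by the adjoint, \<open>R t \<phi> = \<phi>\<close> and the variance of \<open>\<phi>\<close> under the kernel of \<open>R t\<close>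
  vanishes; the Cauchy-Schwarz inequality for this conditional covariance then gives the claim.
\<close>
lemma R_product:
  assumes t: "0 \<le> t" and \<phi>: "bdd \<phi>" and f: "bdd f"
    and inv: "\<And>f. bdd f \<Longrightarrow> (\<integral>x. R t f x * \<phi> x \<partial>M) = (\<integral>x. f x * \<phi> x \<partial>M)"
  shows "AE x in M. R t (\<lambda>y. f y * \<phi> y) x = R t f x * \<phi> x"
proof -
  note \<phi>L = bdd_L2[OF \<phi>] and \<phi>2 = bdd_mult[OF \<phi> \<phi>]
  note iR = R_L2(4)[OF t] and iR2 = R_L2(3)[OF t]
  have iRphi: "integrable M (\<lambda>x. R t \<phi> x * \<phi> x)"
  proof -
    obtain B where B: "\<And>x. \<bar>\<phi> x\<bar> \<le> B" using \<phi> by (auto simp: bdd_def)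
    show ?thesis
    proof (rule Bochner_Integration.integrable_bound[OF integrable_mult_right[OF iR[OF \<phi>L], of B]])
      show "(\<lambda>x. R t \<phi> x * \<phi> x) \<in> borel_measurable M" using R_L2(2)[OF t \<phi>L] bdd_measurable[OF \<phi>] by measurable
      show "AE x in M. norm (R t \<phi> x * \<phi> x) \<le> norm (B * R t \<phi> x)"
        using B order_trans[OF abs_ge_zero B] by (auto simp: abs_mult mult.commute[of _ "\<bar>\<phi> _\<bar>"] intro!: mult_right_mono)
    qed
  qed
  have jens: "(\<integral>x. (R t \<phi> x)\<^sup>2 \<partial>M) \<le> (\<integral>x. \<phi> x * \<phi> x \<partial>M)"
  proof -
    have "(\<integral>x. (R t \<phi> x)\<^sup>2 \<partial>M) \<le> (\<integral>x. R t (\<lambda>y. \<phi> y * \<phi> y) x \<partial>M)"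
      by (intro integral_mono_AE iR2 iR \<phi>L bdd_L2 \<phi>2 R_jensen t \<phi>)
    also have "\<dots> = (\<integral>x. \<phi> x * \<phi> x \<partial>M)" using \<phi>2 by (auto simp: bdd_def intro!: stationary[OF t])
    finally show ?thesis .
  qed
  \<comment> \<open>In the expanded square \<open>inv\<close> with \<open>f = \<phi>\<close>
    evaluates the mixed term and \<open>jens\<close> bounds the first one, so the whole is at most
    0.\<close>
  have "(\<integral>x. (R t \<phi> x - \<phi> x)\<^sup>2 \<partial>M) = (\<integral>x. (R t \<phi> x)\<^sup>2 \<partial>M) - 2 * (\<integral>x. R t \<phi> x * \<phi> x \<partial>M) + (\<integral>x. \<phi> x * \<phi> x \<partial>M)"
    using iR2[OF \<phi>L] iRphi bdd_integrable[OF \<phi>2]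
    by (simp add: power2_diff mult.assoc power2_eq_square[of "\<phi> _"])
  also have "\<dots> \<le> 0" using jens inv[OF \<phi>] by simp
  finally have le0: "(\<integral>x. (R t \<phi> x - \<phi> x)\<^sup>2 \<partial>M) \<le> 0" .
  have isq: "integrable M (\<lambda>x. (R t \<phi> x - \<phi> x)\<^sup>2)"
    using iR2[OF \<phi>L] iRphi bdd_integrable[OF \<phi>2] by (simp add: power2_diff mult.assoc power2_eq_square[of "\<phi> _"])
  have fixed: "AE x in M. R t \<phi> x = \<phi> x"
  proof -
    have "AE x in M. (R t \<phi> x - \<phi> x)\<^sup>2 = 0"
      using antisym[OF le0 integral_nonneg_AE] by (subst integral_nonneg_eq_0_iff_AE[OF isq, symmetric]) auto
    then show ?thesis by eventually_elim simp
  qed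
  \<comment> \<open>\<open>R_jensen\<close> compares two functions which here have equal integrals,
    so equality holds almost everywhere.\<close>
  have var0: "AE x in M. R t (\<lambda>y. \<phi> y * \<phi> y) x = (R t \<phi> x)\<^sup>2"
  proof -
    have nn: "AE x in M. 0 \<le> R t (\<lambda>y. \<phi> y * \<phi> y) x - (R t \<phi> x)\<^sup>2" using R_jensen[OF t \<phi>] by eventually_elim simp
    have "(\<integral>x. (R t \<phi> x)\<^sup>2 \<partial>M) = (\<integral>x. \<phi> x * \<phi> x \<partial>M)"
    proof (rule integral_cong_AE)
      show "AE x in M. (R t \<phi> x)\<^sup>2 = \<phi> x * \<phi> x" using fixed by eventually_elim (simp add: power2_eq_square)
    qed (use R_L2(2)[OF t \<phi>L] bdd_measurable[OF \<phi>] in measurable)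
    moreover have "(\<integral>x. R t (\<lambda>y. \<phi> y * \<phi> y) x \<partial>M) = (\<integral>x. \<phi> x * \<phi> x \<partial>M)"
      using \<phi>2 by (auto simp: bdd_def intro!: stationary[OF t])
    ultimately have "(\<integral>x. R t (\<lambda>y. \<phi> y * \<phi> y) x - (R t \<phi> x)\<^sup>2 \<partial>M) = 0"
      using iR[OF bdd_L2[OF \<phi>2]] iR2[OF \<phi>L] by simp
    then have "AE x in M. R t (\<lambda>y. \<phi> y * \<phi> y) x - (R t \<phi> x)\<^sup>2 = 0"
      using integral_nonneg_eq_0_iff_AE[OF _ nn] iR[OF bdd_L2[OF \<phi>2]] iR2[OF \<phi>L] by auto
    then show ?thesis by eventually_elim simp
  qed
  \<comment> \<open>Nonnegative variance of \<open>f + s * \<phi>\<close>. By \<open>var0\<close>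
    the term quadratic in \<open>s\<close> vanishes; an affine function of \<open>s\<close> stays
    nonnegative only if its slope, the covariance, is 0. Integers \<open>s\<close> suffice for this
    and are countable.\<close>
  have cs: "AE x in M. 0 \<le> (R t (\<lambda>y. f y * f y) x - (R t f x)\<^sup>2) + 2 * real_of_int s * (R t (\<lambda>y. f y * \<phi> y) x - R t f x * R t \<phi> x)" for s :: int
  proof -
    let ?s = "real_of_int s"
    have bs: "bdd (\<lambda>y. 1 * f y + ?s * \<phi> y)" by (intro bdd_add bdd_cmult f \<phi>)
    have b1: "bdd (\<lambda>y. 2 * ?s * (f y * \<phi> y) + ?s\<^sup>2 * (\<phi> y * \<phi> y))" by (intro bdd_add bdd_cmult bdd_mult f \<phi>)
    have "(\<lambda>y. (1 * f y + ?s * \<phi> y) * (1 * f y + ?s * \<phi> y)) = (\<lambda>y. 1 * (f y * f y) + 1 * (2 * ?s * (f y * \<phi> y) + ?s\<^sup>2 * (\<phi> y * \<phi> y)))"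
      by (auto simp: power2_eq_square algebra_simps)
    note j = R_jensen[OF t bs, unfolded this]
    show ?thesis
      using j R_linear[OF t bdd_L2[OF bdd_mult[OF f f]] bdd_L2[OF b1], of 1 1]
        R_linear[OF t bdd_L2[OF bdd_mult[OF f \<phi>]] bdd_L2[OF \<phi>2], of "2 * ?s" "?s\<^sup>2"]
        R_linear[OF t bdd_L2[OF f] \<phi>L, of 1 ?s] var0
    proof eventually_elim
      case (elim x)
      then show ?case by (simp add: power2_eq_square algebra_simps)
    qed
  qed
  have "AE x in M. \<forall>s::int. 0 \<le> (R t (\<lambda>y. f y * f y) x - (R t f x)\<^sup>2) + 2 * real_of_int s * (R t (\<lambda>y. f y * \<phi> y) x - R t f x * R t \<phi> x)"
    using cs by (subst AE_all_countable) auto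
  with fixed show ?thesis
  proof eventually_elim
    case (elim x)
    define a b where "a = R t (\<lambda>y. f y * f y) x - (R t f x)\<^sup>2" and "b = R t (\<lambda>y. f y * \<phi> y) x - R t f x * R t \<phi> x"
    have ab: "0 \<le> a + 2 * real_of_int s * b" for s :: int using elim(2) by (auto simp: a_def b_def)
    have "b = 0"
    proof (rule ccontr)
      assume b: "b \<noteq> 0"
      obtain n :: nat where n: "a < real n * \<bar>b\<bar>" using reals_Archimedean3[of "\<bar>b\<bar>"] b by auto
      have "\<bar>b\<bar> \<le> 2 * \<bar>b\<bar>" by simp
      then have "real n * \<bar>b\<bar> \<le> real n * (2 * \<bar>b\<bar>)" by (intro mult_left_mono) auto
      then show False using ab[of "int n"] ab[of "- int n"] n by (cases "0 < b") auto
    qed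
    then show ?case using elim(1) by (simp add: b_def)
  qed
qed

end


section \<open>Duality of the generator\<close>

locale zero_range_L2 = zero_range_equilibrium g p a0 P \<psi>
  for g :: "nat \<Rightarrow> real" and p :: "'d::finite site \<Rightarrow> real" and a0 :: real
    and P :: "real \<Rightarrow> 'd observable \<Rightarrow> 'd observable" and \<psi> :: real +
  fixes R :: "real \<Rightarrow> 'd observable \<Rightarrow> 'd observable"
  assumes L2_ext: "L2_extension p N P R"
    and R_stationary: "\<And>t f B. 0 \<le> t \<Longrightarrow> f \<in> borel_measurable conf \<Longrightarrow> (\<And>x. \<bar>f x\<bar> \<le> B) \<Longrightarrow>
      (\<integral>x. R t f x \<partial>N) = (\<integral>x. f x \<partial>N)"
begin

sublocale S: stationary_semigroup N R
proof
  show "L2_markov_semigroup N R" using L2_ext by (simp add: L2_extension_def)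
qed (use R_stationary in auto)

lemma R_eq_P: "0 \<le> t \<Longrightarrow> f \<in> Lip p \<Longrightarrow> AE \<eta> in N. R t f \<eta> = P t f \<eta>"
  using L2_ext by (simp add: L2_extension_def)

lemma blip_measurable: "blip C M u \<Longrightarrow> u \<in> borel_measurable conf"
  using Lip_measurable blipD(1) by blast

lemma blip_bdd: "blip C M u \<Longrightarrow> S.bdd u"
  using blip_measurable[of C M u] blipD(3)[of C M u] by (intro S.bddI[of _ M]) auto

lemma P_bdd: "0 \<le> t \<Longrightarrow> blip C M u \<Longrightarrow> S.bdd (P t u)"
  using blip_bdd[OF blip_P] by blast

lemma integrable_times_bdd:
  assumes f: "integrable N f" and k: "S.bdd k"
  shows "integrable N (\<lambda>\<eta>. f \<eta> * k \<eta>)"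
proof -
  obtain B where B: "\<And>x. \<bar>k x\<bar> \<le> B" using k by (auto simp: S.bdd_def)
  have B0: "0 \<le> B" using B[of undefined] by linarith
  show ?thesis
  proof (rule Bochner_Integration.integrable_bound[OF integrable_mult_right[OF f, of B]])
    show "(\<lambda>\<eta>. f \<eta> * k \<eta>) \<in> borel_measurable N"
      by (intro borel_measurable_times borel_measurable_integrable[OF f] S.bdd_measurable[OF k])
    show "AE x in N. norm (f x * k x) \<le> norm (B * f x)"
      using B B0 by (auto simp: abs_mult mult.commute[of B] intro!: mult_left_mono)
  qed
qed

text \<open>Set to 0 off \<open>Omega'\<close>, so that measurability and the bound by the mass hold
  for all configurations.\<close>

definition Lm :: "'d observable \<Rightarrow> 'd observable" where
  "Lm u \<eta> = indicator (Omega' p) \<eta> * generator g p u \<eta>"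

text \<open>Measurability comes from the difference quotients of the semigroup instead of the
  infinite sum over jumps.\<close>

lemma Lm_measurable:
  assumes u: "blip C M u"
  shows "Lm u \<in> borel_measurable conf"
proof (rule borel_measurable_LIMSEQ_real)
  define s where "s n = 1 / real (Suc n)" for n
  have s: "0 < s n" for n by (simp add: s_def)
  have "s \<longlonglongrightarrow> 0" unfolding s_def by (rule LIMSEQ_Suc[OF lim_1_over_n])
  then have fl: "filterlim s (at_right 0) sequentially"
    using s by (auto simp: filterlim_at intro!: always_eventually) (metis less_irrefl)
  show "(\<lambda>n. indicator (Omega' p) \<eta> * ((P (s n) u \<eta> - u \<eta>) / s n)) \<longlonglongrightarrow> Lm u \<eta>" if "\<eta> \<in> space conf" for \<eta>
  proof (cases "\<eta> \<in> Omega' p")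
    case True
    show ?thesis
      using filterlim_compose[OF P_right_derivative[OF u True] fl] True by (simp add: Lm_def)
  qed (simp add: Lm_def)
  show "(\<lambda>\<eta>. indicator (Omega' p) \<eta> * ((P (s n) u \<eta> - u \<eta>) / s n)) \<in> borel_measurable conf" for n
    using blip_measurable[OF u] blip_measurable[OF blip_P[OF less_imp_le[OF s] u]] Omega'_sets
    by (intro borel_measurable_times borel_measurable_divide borel_measurable_diff) auto
qed

lemma Lm_bound: "blip C M u \<Longrightarrow> \<bar>Lm u \<eta>\<bar> \<le> 3 * a0 * C * mass \<eta>"
  using generator_bound[OF blipD(2), of C M u \<eta>] a0_nonneg blipD(4)[of C M u]
  by (cases "\<eta> \<in> Omega' p") (auto simp: Lm_def)

lemma Lm_integrable:
  assumes u: "blip C M u"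
  shows "integrable N (Lm u)"
  by (rule Bochner_Integration.integrable_bound[OF integrable_mult_right[OF integrable_mass, of "3 * a0 * C"]])
    (use Lm_measurable[OF u] Lm_bound[OF u] in \<open>auto intro: order_trans[OF _ abs_ge_self]\<close>)

lemma small_time_bound_AE:
  assumes "0 \<le> t" "blip C M u"
  shows "AE \<eta> in N. \<bar>P t u \<eta> - u \<eta>\<bar> \<le> 3 * a0 * (C * exp (4 * a0 * t)) * mass \<eta> * t"
  using AE_Omega' by eventually_elim (rule small_time_bound[OF assms])

lemma small_time_integral:
  assumes t: "0 \<le> t" and u: "blip C M u"
  shows "(\<integral>\<eta>. \<bar>P t u \<eta> - u \<eta>\<bar> \<partial>N) \<le> 3 * a0 * (C * exp (4 * a0 * t)) * (\<integral>\<eta>. mass \<eta> \<partial>N) * t"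
proof -
  have "(\<integral>\<eta>. \<bar>P t u \<eta> - u \<eta>\<bar> \<partial>N) \<le> (\<integral>\<eta>. 3 * a0 * (C * exp (4 * a0 * t)) * mass \<eta> * t \<partial>N)"
    using small_time_bound_AE[OF t u] integrable_mass
      S.bdd_integrable[OF S.bdd_abs[OF S.bdd_diff[OF P_bdd[OF t u] blip_bdd[OF u]]]]
    by (intro integral_mono_AE) auto
  then show ?thesis by simp
qed

text \<open>The small-time bound dominates the difference quotients by a multiple of the mass, so
  the pointwise derivative passes under the integral.\<close>

lemma Lm_limit:
  assumes u: "blip C M u" and k: "S.bdd k"
  shows "((\<lambda>s. (\<integral>\<eta>. (P s u \<eta> - u \<eta>) * k \<eta> \<partial>N) / s) \<longlongrightarrow> (\<integral>\<eta>. Lm u \<eta> * k \<eta> \<partial>N)) (at_right 0)"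
proof (rule tendsto_at_right_sequentially[of 0 1])
  fix s :: "nat \<Rightarrow> real" assume s: "\<And>n. 0 < s n" "\<And>n. s n < 1" "s \<longlonglongrightarrow> 0"
  have s0: "0 \<le> s n" for n using s(1)[of n] by simp
  have fl: "filterlim s (at_right 0) sequentially"
    using s by (auto simp: filterlim_at intro!: always_eventually) (metis less_irrefl)
  obtain B where B: "\<And>x. \<bar>k x\<bar> \<le> B" using k by (auto simp: S.bdd_def)
  have B0: "0 \<le> B" using B[of undefined] by linarith
  have C0: "0 \<le> C" by (rule blipD(4)[OF u])
  have "(\<lambda>n. \<integral>\<eta>. (P (s n) u \<eta> - u \<eta>) / s n * k \<eta> \<partial>N) \<longlonglongrightarrow> (\<integral>\<eta>. Lm u \<eta> * k \<eta> \<partial>N)"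
  proof (rule integral_dominated_convergence[where w = "\<lambda>\<eta>. 3 * a0 * (C * exp (4 * a0)) * mass \<eta> * B"])
    show "(\<lambda>\<eta>. Lm u \<eta> * k \<eta>) \<in> borel_measurable N"
      using Lm_measurable[OF u] S.bdd_measurable[OF k] by simp
    show "(\<lambda>\<eta>. (P (s n) u \<eta> - u \<eta>) / s n * k \<eta>) \<in> borel_measurable N" for n
      by (intro borel_measurable_times borel_measurable_divide borel_measurable_diff S.bdd_measurable P_bdd[OF s0 u] blip_bdd[OF u] k borel_measurable_const)
    show "integrable N (\<lambda>\<eta>. 3 * a0 * (C * exp (4 * a0)) * mass \<eta> * B)" using integrable_mass by simp
    show "AE \<eta> in N. (\<lambda>n. (P (s n) u \<eta> - u \<eta>) / s n * k \<eta>) \<longlonglongrightarrow> Lm u \<eta> * k \<eta>"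
      using AE_Omega'
    proof eventually_elim
      case (elim \<eta>)
      show ?case using tendsto_mult[OF filterlim_compose[OF P_right_derivative[OF u elim] fl] tendsto_const, of "k \<eta>"] elim by (simp add: Lm_def)
    qed
    show "AE \<eta> in N. norm ((P (s n) u \<eta> - u \<eta>) / s n * k \<eta>) \<le> 3 * a0 * (C * exp (4 * a0)) * mass \<eta> * B" for n
      using small_time_bound_AE[OF s0[of n] u]
    proof eventually_elim
      case (elim \<eta>)
      have "\<bar>(P (s n) u \<eta> - u \<eta>) / s n\<bar> \<le> 3 * a0 * (C * exp (4 * a0 * s n)) * mass \<eta>"
        using elim s(1)[of n] by (simp add: abs_divide pos_divide_le_eq)
      also have "\<dots> \<le> 3 * a0 * (C * exp (4 * a0)) * mass \<eta>"
        using a0_nonneg C0 s(2)[of n] mult_left_mono[of "s n" 1 "4 * a0"]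
        by (intro mult_right_mono mult_left_mono) auto
      finally have "\<bar>(P (s n) u \<eta> - u \<eta>) / s n\<bar> * \<bar>k \<eta>\<bar> \<le> 3 * a0 * (C * exp (4 * a0)) * mass \<eta> * B"
        using B C0 a0_nonneg by (intro mult_mono) auto
      then show ?case by (simp add: abs_mult)
    qed
  qed
  then show "(\<lambda>n. (\<integral>\<eta>. (P (s n) u \<eta> - u \<eta>) * k \<eta> \<partial>N) / s n) \<longlonglongrightarrow> (\<integral>\<eta>. Lm u \<eta> * k \<eta> \<partial>N)" by simp
qed simp

text \<open>Stationarity makes the difference quotients tested against 1 vanish identically.\<close>

lemma integral_Lm:
  assumes u: "blip C M u"
  shows "(\<integral>\<eta>. Lm u \<eta> \<partial>N) = 0"
proof -
  have z: "(\<integral>\<eta>. (P s u \<eta> - u \<eta>) * 1 \<partial>N) / s = 0" if s: "0 < s" for s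
  proof -
    have "(\<integral>\<eta>. P s u \<eta> \<partial>N) = (\<integral>\<eta>. R s u \<eta> \<partial>N)"
    proof (rule integral_cong_AE)
      show "AE \<eta> in N. P s u \<eta> = R s u \<eta>" using R_eq_P[OF less_imp_le[OF s] blipD(1)[OF u]] by eventually_elim simp
    qed (use S.bdd_measurable[OF P_bdd[OF less_imp_le[OF s] u]] S.R_L2(2)[OF less_imp_le[OF s] S.bdd_L2[OF blip_bdd[OF u]]] in auto)
    also have "\<dots> = (\<integral>\<eta>. u \<eta> \<partial>N)"
      by (rule R_stationary[OF less_imp_le[OF s] blip_measurable[OF u] blipD(3)[OF u]])
    finally show ?thesis
      using S.bdd_integrable[OF P_bdd[OF less_imp_le[OF s] u]] S.bdd_integrable[OF blip_bdd[OF u]] by simp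
  qed
  have "((\<lambda>s. (\<integral>\<eta>. (P s u \<eta> - u \<eta>) * 1 \<partial>N) / s) \<longlongrightarrow> (\<integral>\<eta>. Lm u \<eta> * 1 \<partial>N)) (at_right 0)"
    by (rule Lm_limit[OF u S.bdd_const])
  moreover have "((\<lambda>s. (\<integral>\<eta>. (P s u \<eta> - u \<eta>) * 1 \<partial>N) / s) \<longlongrightarrow> 0) (at_right 0)"
    by (rule tendsto_eventually) (use z in \<open>auto simp: eventually_at_right_field intro!: exI[of _ 1]\<close>)
  ultimately show ?thesis using tendsto_unique[OF trivial_limit_at_right_real] by fastforce
qed

lemma integrable_g: "integrable N (\<lambda>\<eta>. g (\<eta> z))"
  by (intro integrableI_nonneg) (auto intro: le_less_trans[OF nn_integral_g])

text \<open>The exchange formula for nonnegative functions is applied to the positive and the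
  negative part of \<open>G\<close>.\<close>

lemma exchange_integral:
  assumes G: "S.bdd G"
  shows "integrable N (\<lambda>\<eta>. g (\<eta> x) * G (move x y \<eta>))" "integrable N (\<lambda>\<eta>. g (\<eta> y) * G \<eta>)"
    "(\<integral>\<eta>. g (\<eta> x) * G (move x y \<eta>) \<partial>N) = (\<integral>\<eta>. g (\<eta> y) * G \<eta> \<partial>N)"
proof -
  have Gm [measurable]: "G \<in> borel_measurable conf" using S.bdd_measurable[OF G] by simp
  obtain B where B: "\<And>x. \<bar>G x\<bar> \<le> B" using G by (auto simp: S.bdd_def)
  have Gmove: "S.bdd (\<lambda>\<eta>. G (move x y \<eta>))"
    by (rule S.bddI[of _ B]) (use B in auto)
  show i: "integrable N (\<lambda>\<eta>. g (\<eta> x) * G (move x y \<eta>))" "integrable N (\<lambda>\<eta>. g (\<eta> y) * G \<eta>)"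
    by (intro integrable_times_bdd integrable_g Gmove G)+
  have e: "(\<integral>\<^sup>+\<eta>. ennreal (g (\<eta> x) * F (move x y \<eta>)) \<partial>N) = (\<integral>\<^sup>+\<eta>. ennreal (g (\<eta> y) * F \<eta>) \<partial>N)"
    if F: "F \<in> borel_measurable conf" for F
    using exchangeD[OF exchange_N, of "\<lambda>\<eta>. ennreal (F \<eta>)" x y] F by (simp add: ennreal_mult')
  show "(\<integral>\<eta>. g (\<eta> x) * G (move x y \<eta>) \<partial>N) = (\<integral>\<eta>. g (\<eta> y) * G \<eta> \<partial>N)"
    unfolding real_lebesgue_integral_def[OF i(1)] real_lebesgue_integral_def[OF i(2)]
    using e[of G] e[of "\<lambda>\<eta>. - G \<eta>"] by simp
qed

section \<open>Interchanging the sum over jumps with the expectation\<close>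

definition unit_cost :: "'d site \<times> 'd site \<Rightarrow> real" where
  "unit_cost = (\<lambda>(x, y). p y * (\<beta> p x + \<beta> p (x + y)))"

lemma unit_cost_nonneg [simp]: "0 \<le> unit_cost xy"
  by (auto simp: unit_cost_def split: prod.split intro!: mult_nonneg_nonneg add_nonneg_nonneg)

lemma unit_cost_integrable: "integrable (count_space UNIV) unit_cost"
proof (rule integrableI_nonneg)
  have "(\<integral>\<^sup>+xy. ennreal (unit_cost xy) \<partial>count_space UNIV) \<le> 3 * (\<integral>\<^sup>+x. ennreal (1 * \<beta> p x) \<partial>count_space UNIV)"
    using weighted_jump_sum[of "\<lambda>_. 1"] by (simp add: unit_cost_def case_prod_beta')
  also have "\<dots> < \<infinity>" by (simp add: \<beta>_sum ennreal_mult_less_top)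
  finally show "(\<integral>\<^sup>+xy. ennreal (unit_cost xy) \<partial>count_space UNIV) < \<infinity>" .
qed auto

lemma integral_g_le: "(\<integral>\<eta>. g (\<eta> z) \<partial>N) \<le> a0 * m1"
proof -
  have "ennreal (\<integral>\<eta>. g (\<eta> z) \<partial>N) \<le> ennreal (a0 * m1)"
    using nn_integral_g[of z] by (subst nn_integral_eq_integral[OF integrable_g, symmetric]) auto
  then show ?thesis using a0_nonneg by (subst (asm) ennreal_le_iff) auto
qed

text \<open>\<open>z\<close> selects the site whose rate governs the jump. Mean rates are at most
  \<open>a0 * m1\<close> at every site, so absolute convergence reduces to summability of
  \<open>unit_cost\<close>.\<close>

lemma swap_jump_integral:
  fixes F :: "'d site \<times> 'd site \<Rightarrow> 'd config \<Rightarrow> real"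
  assumes m: "\<And>xy. F xy \<in> borel_measurable conf"
    and b: "\<And>x y. AE \<eta> in N. \<bar>F (x, y) \<eta>\<bar> \<le> c * unit_cost (x, y) * g (\<eta> (z (x, y)))"
    and c: "0 \<le> c"
  shows "integrable N (\<lambda>\<eta>. \<integral>xy. F xy \<eta> \<partial>count_space UNIV)"
    "(\<integral>\<eta>. (\<integral>xy. F xy \<eta> \<partial>count_space UNIV) \<partial>N) = (\<integral>xy. (\<integral>\<eta>. F xy \<eta> \<partial>N) \<partial>count_space UNIV)"
proof -
  interpret Q: pair_sigma_finite "count_space (UNIV :: ('d site \<times> 'd site) set)" N
    by (intro pair_sigma_finite.intro sigma_finite_measure_count_space_countable N.sigma_finite_measure_axioms) simp
  have Fm: "(\<lambda>(xy, \<eta>). F xy \<eta>) \<in> borel_measurable (count_space UNIV \<Otimes>\<^sub>M N)"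
    by (rule measurable_pair_measure_countable1) (use m in auto)
  have b': "AE \<eta> in N. \<bar>F xy \<eta>\<bar> \<le> c * unit_cost xy * g (\<eta> (z xy))" for xy using b by (cases xy) auto
  have iF: "integrable N (F xy)" for xy
    by (rule Bochner_Integration.integrable_bound[OF integrable_mult_right[OF integrable_g[of "z xy"], of "c * unit_cost xy"]])
      (use m b' c in \<open>auto simp: abs_mult elim!: eventually_mono\<close>)
  have le: "(\<integral>\<eta>. \<bar>F xy \<eta>\<bar> \<partial>N) \<le> c * (a0 * m1) * unit_cost xy" for xy
  proof -
    have "(\<integral>\<eta>. \<bar>F xy \<eta>\<bar> \<partial>N) \<le> (\<integral>\<eta>. c * unit_cost xy * g (\<eta> (z xy)) \<partial>N)"
      using b' iF integrable_g by (intro integral_mono_AE) auto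
    also have "\<dots> \<le> c * unit_cost xy * (a0 * m1)"
      using integral_g_le[of "z xy"] c by (simp add: mult_left_mono)
    finally show ?thesis by (simp add: mult_ac)
  qed
  have "integrable (count_space UNIV) (\<lambda>xy. \<integral>\<eta>. norm (F xy \<eta>) \<partial>N)"
    by (rule Bochner_Integration.integrable_bound[OF integrable_mult_right[OF unit_cost_integrable, of "c * (a0 * m1)"]])
      (use le c a0_nonneg in \<open>auto simp: abs_mult intro!: AE_I2 order_trans[OF le]\<close>)
  then have i: "integrable (count_space UNIV \<Otimes>\<^sub>M N) (\<lambda>(xy, \<eta>). F xy \<eta>)"
    by (intro Q.Fubini_integrable Fm) (auto simp: iF)
  show "integrable N (\<lambda>\<eta>. \<integral>xy. F xy \<eta> \<partial>count_space UNIV)" using Q.integrable_snd[OF i] by simp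
  show "(\<integral>\<eta>. (\<integral>xy. F xy \<eta> \<partial>count_space UNIV) \<partial>N) = (\<integral>xy. (\<integral>\<eta>. F xy \<eta> \<partial>N) \<partial>count_space UNIV)"
    using Q.Fubini_integral[OF i] by simp
qed

definition adj_term :: "'d observable \<Rightarrow> 'd config \<Rightarrow> 'd site \<times> 'd site \<Rightarrow> real" where
  "adj_term h \<eta> = (\<lambda>(x, y). p y * g (\<eta> (x + y)) * (h (move (x + y) x \<eta>) - h \<eta>))"

text \<open>The generator of the zero-range process with reflected jump law: a particle at
  \<open>x + y\<close> jumps to \<open>x\<close> with the weight \<open>p y\<close>.\<close>

definition adj :: "'d observable \<Rightarrow> 'd observable" where
  "adj h \<eta> = (\<integral>xy. adj_term h \<eta> xy \<partial>count_space UNIV)"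

lemma adj_term_bound:
  assumes h: "lip_bound p h C" and \<eta>: "\<eta> \<in> Omega' p"
  shows "\<bar>adj_term h \<eta> (x, y)\<bar> \<le> C * unit_cost (x, y) * g (\<eta> (x + y))"
proof (cases "\<eta> (x + y) = 0")
  case False
  have "\<bar>h (move (x + y) x \<eta>) - h \<eta>\<bar> \<le> C * config_dist p (move (x + y) x \<eta>) \<eta>"
    by (rule lip_boundD[OF h move_mass(1)[OF \<eta>] \<eta>])
  also have "\<dots> \<le> C * (\<beta> p (x + y) + \<beta> p x)"
    using False by (intro mult_left_mono move_dist[OF \<eta>] lip_bound_nonneg[OF h]) simp
  finally have "p y * g (\<eta> (x + y)) * \<bar>h (move (x + y) x \<eta>) - h \<eta>\<bar> \<le> p y * g (\<eta> (x + y)) * (C * (\<beta> p (x + y) + \<beta> p x))"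
    by (intro mult_left_mono) auto
  then show ?thesis by (simp add: adj_term_def unit_cost_def abs_mult mult_ac add.commute)
qed (simp add: adj_term_def)

lemma adj_term_measurable:
  assumes "h \<in> borel_measurable conf"
  shows "(\<lambda>\<eta>. adj_term h \<eta> xy) \<in> borel_measurable conf"
  unfolding adj_term_def case_prod_beta using assms by measurable

text \<open>\<open>\<beta>_step\<close> controls the jumps of \<open>p\<close> but not the reflected
  ones, so there is no pointwise bound by the mass as for \<open>Lm\<close>; integrability rests on
  the uniform bound for mean rates.\<close>

lemma adj_integrable:
  assumes h: "blip C M h"
  shows "integrable N (adj h)"
  unfolding adj_def[abs_def]
proof (rule swap_jump_integral(1)[where c = C and z = "\<lambda>(x, y). x + y"])
  show "AE \<eta> in N. \<bar>adj_term h \<eta> (x, y)\<bar> \<le> C * unit_cost (x, y) * g (\<eta> (case (x, y) of (x, y) \<Rightarrow> x + y))" for x y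
    using AE_Omega' by eventually_elim (use adj_term_bound[OF blipD(2)[OF h]] in simp)
qed (use blip_measurable[OF h] blipD(4)[OF h] adj_term_measurable in auto)

text \<open>Needed to apply the generator to a product in the duality formula.\<close>

lemma blip_mult:
  assumes u: "blip C M u" and h: "blip D B h"
  shows "blip (B * C + M * D) (M * B) (\<lambda>\<eta>. u \<eta> * h \<eta>)"
proof -
  have lip: "lip_bound p (\<lambda>\<eta>. u \<eta> * h \<eta>) (B * C + M * D)"
    unfolding lip_bound_def
  proof (intro conjI ballI)
    show "0 \<le> B * C + M * D" using blipD(4,5)[OF u] blipD(4,5)[OF h] by simp
    fix \<eta> \<zeta> assume o: "\<eta> \<in> Omega' p" "\<zeta> \<in> Omega' p"
    have "\<bar>u \<eta> * h \<eta> - u \<zeta> * h \<zeta>\<bar> = \<bar>h \<eta> * (u \<eta> - u \<zeta>) + u \<zeta> * (h \<eta> - h \<zeta>)\<bar>" by (simp add: algebra_simps)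
    also have "\<dots> \<le> \<bar>h \<eta>\<bar> * \<bar>u \<eta> - u \<zeta>\<bar> + \<bar>u \<zeta>\<bar> * \<bar>h \<eta> - h \<zeta>\<bar>"
      unfolding abs_mult[symmetric] by (rule abs_triangle_ineq)
    also have "\<dots> \<le> B * (C * config_dist p \<eta> \<zeta>) + M * (D * config_dist p \<eta> \<zeta>)"
      using blipD(3,5)[OF u] blipD(3,5)[OF h] lip_boundD[OF blipD(2)[OF u] o] lip_boundD[OF blipD(2)[OF h] o]
      by (intro add_mono mult_mono) auto
    finally show "\<bar>u \<eta> * h \<eta> - u \<zeta> * h \<zeta>\<bar> \<le> (B * C + M * D) * config_dist p \<eta> \<zeta>" by (simp add: algebra_simps)
  qed
  moreover have "u \<eta> * h \<eta> = 0" if "\<eta> \<notin> Omega' p" for \<eta> using blipD(1)[OF u] that by (simp add: Lip_def)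
  moreover have "\<bar>u \<eta> * h \<eta>\<bar> \<le> M * B" for \<eta>
    unfolding abs_mult using blipD(3,5)[OF u] blipD(3,5)[OF h] by (intro mult_mono) auto
  ultimately show ?thesis unfolding blip_def Lip_def by blast
qed

text \<open>
  Since the integral of \<open>L (u * h)\<close> vanishes, the integral of \<open>h * L u\<close> is minus that of the sum
  of \<open>rate * u (dest) * (h (dest) - h)\<close>, which converges absolutely; each summand is transported by
  the exchange formula.
\<close>
lemma generator_duality:
  assumes u: "blip C M u" and h: "blip D B h"
  shows "(\<integral>\<eta>. Lm u \<eta> * h \<eta> \<partial>N) = (\<integral>\<eta>. u \<eta> * adj h \<eta> \<partial>N)"
proof -
  note uh = blip_mult[OF u h]
  have um [measurable]: "u \<in> borel_measurable conf" and hm [measurable]: "h \<in> borel_measurable conf"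
    using blip_measurable u h by auto
  \<comment> \<open>The difference between \<open>L (u * h)\<close> and \<open>h * L u\<close>, jump
    by jump.\<close>
  define F where "F xy \<eta> = rate \<eta> xy * (u (dest \<eta> xy) * (h (dest \<eta> xy) - h \<eta>))" for xy \<eta>
  have Fm: "F xy \<in> borel_measurable conf" for xy
    unfolding F_def rate_def dest_def case_prod_beta by measurable
  have jt: "\<bar>jump_term h \<eta> (x, y)\<bar> \<le> D * unit_cost (x, y) * g (\<eta> x)" if "\<eta> \<in> Omega' p" for \<eta> x y
    using jump_term_bound[OF blipD(2)[OF h] that, of "(x, y)"] by (simp add: cost_def unit_cost_def mult_ac)
  have Fb: "AE \<eta> in N. \<bar>F (x, y) \<eta>\<bar> \<le> M * D * unit_cost (x, y) * g (\<eta> (fst (x, y)))" for x y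
    using AE_Omega'
  proof eventually_elim
    case (elim \<eta>)
    have "\<bar>F (x, y) \<eta>\<bar> = \<bar>u (dest \<eta> (x, y))\<bar> * \<bar>jump_term h \<eta> (x, y)\<bar>"
      by (simp add: F_def jump_term_eq abs_mult mult_ac)
    also have "\<dots> \<le> M * (D * unit_cost (x, y) * g (\<eta> x))"
      using jt[OF elim] blipD(3,5)[OF u] by (intro mult_mono) auto
    finally show ?case by (simp add: mult_ac)
  qed
  have MD: "0 \<le> M * D" using blipD(5)[OF u] blipD(4)[OF h] by simp
  note Fswap = swap_jump_integral[where F = F and z = fst, OF Fm Fb MD]
  have pt: "AE \<eta> in N. Lm u \<eta> * h \<eta> = Lm (\<lambda>\<eta>. u \<eta> * h \<eta>) \<eta> - (\<integral>xy. F xy \<eta> \<partial>count_space UNIV)"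
    using AE_Omega'
  proof eventually_elim
    case (elim \<eta>)
    note i = jump_term_integrable[OF blipD(2)[OF u] elim] jump_term_integrable[OF blipD(2)[OF uh] elim]
    have "Lm u \<eta> * h \<eta> = (\<integral>xy. jump_term u \<eta> xy * h \<eta> \<partial>count_space UNIV)"
      using elim by (simp add: Lm_def generator_eq[OF blipD(2)[OF u] elim])
    moreover have "Lm (\<lambda>\<eta>. u \<eta> * h \<eta>) \<eta> = (\<integral>xy. jump_term (\<lambda>\<eta>. u \<eta> * h \<eta>) \<eta> xy \<partial>count_space UNIV)"
      using elim by (simp add: Lm_def generator_eq[OF blipD(2)[OF uh] elim])
    moreover have "F xy \<eta> = jump_term (\<lambda>\<eta>. u \<eta> * h \<eta>) \<eta> xy - jump_term u \<eta> xy * h \<eta>" for xy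
      by (simp add: F_def jump_term_eq algebra_simps)
    ultimately show ?case using i by simp
  qed
  have tm: "(\<integral>\<eta>. F xy \<eta> \<partial>N) = - (\<integral>\<eta>. u \<eta> * adj_term h \<eta> xy \<partial>N)" for xy
  proof (cases xy)
    case (Pair x y)
    \<comment> \<open>Evaluated after the jump, \<open>G\<close> reproduces the summand of
      \<open>F\<close>, because the reverse move restores the initial configuration.\<close>
    define G where "G \<zeta> = u \<zeta> * (h \<zeta> - h (move (x + y) x \<zeta>))" for \<zeta>
    have "S.bdd (\<lambda>\<zeta>. h (move (x + y) x \<zeta>))" by (rule S.bddI[of _ B]) (use blipD(3)[OF h] in auto)
    then have G: "S.bdd G" unfolding G_def[abs_def] by (intro S.bdd_mult S.bdd_diff blip_bdd[OF u] blip_bdd[OF h])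
    have "F xy \<eta> = p y * (g (\<eta> x) * G (move x (x + y) \<eta>))" for \<eta>
      by (cases "\<eta> x = 0") (simp_all add: Pair F_def rate_def dest_def G_def move_move move_self mult_ac)
    then have "(\<integral>\<eta>. F xy \<eta> \<partial>N) = p y * (\<integral>\<eta>. g (\<eta> x) * G (move x (x + y) \<eta>) \<partial>N)" by simp
    also have "\<dots> = p y * (\<integral>\<eta>. g (\<eta> (x + y)) * G \<eta> \<partial>N)" by (simp add: exchange_integral(3)[OF G])
    also have "\<dots> = (\<integral>\<eta>. - (u \<eta> * adj_term h \<eta> xy) \<partial>N)"
      unfolding integral_mult_right_zero[symmetric]
      by (intro Bochner_Integration.integral_cong refl) (simp add: Pair G_def adj_term_def algebra_simps)
    finally show ?thesis by simp
  qed
  have uam: "(\<lambda>\<eta>. u \<eta> * adj_term h \<eta> xy) \<in> borel_measurable conf" for xy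
    by (intro borel_measurable_times um adj_term_measurable hm)
  have uab: "AE \<eta> in N. \<bar>u \<eta> * adj_term h \<eta> (x, y)\<bar> \<le> M * D * unit_cost (x, y) * g (\<eta> ((\<lambda>(x, y). x + y) (x, y)))" for x y
    using AE_Omega'
  proof eventually_elim
    case (elim \<eta>)
    have "\<bar>u \<eta>\<bar> * \<bar>adj_term h \<eta> (x, y)\<bar> \<le> M * (D * unit_cost (x, y) * g (\<eta> (x + y)))"
      using adj_term_bound[OF blipD(2)[OF h] elim] blipD(3,5)[OF u] by (intro mult_mono) auto
    then show ?case by (simp add: abs_mult mult_ac)
  qed
  note uaswap = swap_jump_integral[where F = "\<lambda>xy \<eta>. u \<eta> * adj_term h \<eta> xy" and z = "\<lambda>(x, y). x + y", OF uam uab MD]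
  have "(\<integral>\<eta>. Lm u \<eta> * h \<eta> \<partial>N) = (\<integral>\<eta>. Lm (\<lambda>\<eta>. u \<eta> * h \<eta>) \<eta> - (\<integral>xy. F xy \<eta> \<partial>count_space UNIV) \<partial>N)"
  proof (rule integral_cong_AE[OF _ _ pt])
    show "(\<lambda>\<eta>. Lm u \<eta> * h \<eta>) \<in> borel_measurable N" using Lm_measurable[OF u] by simp
    show "(\<lambda>\<eta>. Lm (\<lambda>\<eta>. u \<eta> * h \<eta>) \<eta> - (\<integral>xy. F xy \<eta> \<partial>count_space UNIV)) \<in> borel_measurable N"
      using Lm_integrable[OF uh] Fswap(1) by (intro borel_measurable_diff borel_measurable_integrable)
  qed
  also have "\<dots> = - (\<integral>xy. (\<integral>\<eta>. F xy \<eta> \<partial>N) \<partial>count_space UNIV)"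
    using Lm_integrable[OF uh] Fswap by (simp add: integral_Lm[OF uh])
  also have "\<dots> = (\<integral>\<eta>. (\<integral>xy. u \<eta> * adj_term h \<eta> xy \<partial>count_space UNIV) \<partial>N)"
    unfolding tm uaswap(2) by simp
  also have "\<dots> = (\<integral>\<eta>. u \<eta> * adj h \<eta> \<partial>N)" by (simp add: adj_def)
  finally show ?thesis .
qed

end


section \<open>Weak derivative of the semigroup\<close>

context zero_range_L2
begin

text \<open>\<open>adj h\<close> may be unbounded, so smallness in L1 alone does not make a pairing
  with it small. For functions bounded by \<open>B\<close>, cutting \<open>k\<close> at a high level
  costs at most \<delta>, uniformly.\<close>

lemma integral_times_small:
  fixes k :: "'d config \<Rightarrow> real"
  assumes k: "integrable N k" and \<delta>: "0 < \<delta>" and B: "0 \<le> B"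
  obtains c where "0 \<le> c" "\<And>w. w \<in> borel_measurable N \<Longrightarrow> (AE \<eta> in N. \<bar>w \<eta>\<bar> \<le> B) \<Longrightarrow>
    \<bar>\<integral>\<eta>. w \<eta> * k \<eta> \<partial>N\<bar> \<le> c * (\<integral>\<eta>. \<bar>w \<eta>\<bar> \<partial>N) + \<delta>"
proof -
  have km [measurable]: "k \<in> borel_measurable N" using k by (rule borel_measurable_integrable)
  define r where "r n \<eta> = (if real n < \<bar>k \<eta>\<bar> then \<bar>k \<eta>\<bar> else 0)" for n :: nat and \<eta>
  have rm [measurable]: "r n \<in> borel_measurable N" for n unfolding r_def[abs_def] by measurable
  have ri: "integrable N (r n)" for n
    by (rule Bochner_Integration.integrable_bound[OF k]) (auto simp: r_def)
  have "(\<lambda>n. \<integral>\<eta>. r n \<eta> \<partial>N) \<longlonglongrightarrow> (\<integral>\<eta>. 0 \<partial>N)"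
  proof (rule integral_dominated_convergence[where w = "\<lambda>\<eta>. \<bar>k \<eta>\<bar>"])
    show "AE \<eta> in N. (\<lambda>n. r n \<eta>) \<longlonglongrightarrow> 0"
    proof (intro AE_I2 tendsto_eventually)
      fix \<eta>
      obtain m :: nat where "\<bar>k \<eta>\<bar> \<le> real m" using real_arch_simple by blast
      then show "\<forall>\<^sub>F n in sequentially. r n \<eta> = 0"
        by (intro eventually_sequentiallyI[of m]) (auto simp: r_def)
    qed
  qed (use k in \<open>auto simp: r_def\<close>)
  moreover have "0 < \<delta> / (B + 1)" using \<delta> B by simp
  ultimately have "\<forall>\<^sub>F n in sequentially. dist (\<integral>\<eta>. r n \<eta> \<partial>N) (\<integral>\<eta>. 0 \<partial>N) < \<delta> / (B + 1)"
    by (rule tendstoD)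
  then obtain n where "\<bar>\<integral>\<eta>. r n \<eta> \<partial>N\<bar> < \<delta> / (B + 1)"
    unfolding eventually_sequentially dist_real_def by fastforce
  then have "B * (\<integral>\<eta>. r n \<eta> \<partial>N) \<le> B * (\<delta> / (B + 1))" using B by (intro mult_left_mono) auto
  also have "\<dots> \<le> \<delta>" using \<delta> B by (simp add: field_simps)
  finally have n: "B * (\<integral>\<eta>. r n \<eta> \<partial>N) \<le> \<delta>" .
  show thesis
  proof (rule that[of "real n"])
    fix w assume w [measurable]: "w \<in> borel_measurable N" and wB: "AE \<eta> in N. \<bar>w \<eta>\<bar> \<le> B"
    have iw: "integrable N w" by (rule N.integrable_const_bound[of _ B]) (use wB in auto)
    have iwk: "integrable N (\<lambda>\<eta>. w \<eta> * k \<eta>)"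
    proof (rule Bochner_Integration.integrable_bound[OF integrable_mult_right[OF k, of B]])
      show "AE \<eta> in N. norm (w \<eta> * k \<eta>) \<le> norm (B * k \<eta>)"
        using wB by eventually_elim (use B in \<open>auto simp: abs_mult intro!: mult_right_mono\<close>)
    qed measurable
    have "\<bar>\<integral>\<eta>. w \<eta> * k \<eta> \<partial>N\<bar> \<le> (\<integral>\<eta>. \<bar>w \<eta> * k \<eta>\<bar> \<partial>N)" by (rule integral_abs_bound)
    also have "\<dots> \<le> (\<integral>\<eta>. real n * \<bar>w \<eta>\<bar> + B * r n \<eta> \<partial>N)"
    proof (rule integral_mono_AE)
      show "AE \<eta> in N. \<bar>w \<eta> * k \<eta>\<bar> \<le> real n * \<bar>w \<eta>\<bar> + B * r n \<eta>"
        using wB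
      proof eventually_elim
        case (elim \<eta>)
        show ?case
        proof (cases "real n < \<bar>k \<eta>\<bar>")
          case True
          have "\<bar>w \<eta>\<bar> * \<bar>k \<eta>\<bar> \<le> B * \<bar>k \<eta>\<bar>" using elim by (intro mult_right_mono) auto
          moreover have "0 \<le> real n * \<bar>w \<eta>\<bar>" by simp
          moreover have "r n \<eta> = \<bar>k \<eta>\<bar>" using True by (simp add: r_def)
          ultimately show ?thesis by (simp only: abs_mult)
        next
          case False
          then have "\<bar>w \<eta>\<bar> * \<bar>k \<eta>\<bar> \<le> \<bar>w \<eta>\<bar> * real n" by (intro mult_left_mono) auto
          then show ?thesis using False by (simp add: r_def abs_mult mult.commute)
        qed
      qed
    qed (use iwk iw ri in auto)
    also have "\<dots> = real n * (\<integral>\<eta>. \<bar>w \<eta>\<bar> \<partial>N) + B * (\<integral>\<eta>. r n \<eta> \<partial>N)" using iw ri by simp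
    finally show "\<bar>\<integral>\<eta>. w \<eta> * k \<eta> \<partial>N\<bar> \<le> real n * (\<integral>\<eta>. \<bar>w \<eta>\<bar> \<partial>N) + \<delta>" using n by simp
  qed simp
qed

text \<open>The forward equation: by \<open>generator_duality\<close> the right derivative of the
  pairing of \<open>P t u\<close> with \<open>h\<close> is the pairing of \<open>P t u\<close> with
  \<open>adj h\<close>. Hence the Lipschitz constant of \<open>u\<close> does not enter the
  bound.\<close>

lemma forward_estimate:
  assumes u: "blip C M u" and h: "blip D B h" and T: "0 \<le> T"
    and E: "\<And>t. 0 \<le> t \<Longrightarrow> t < T \<Longrightarrow> \<bar>\<integral>\<eta>. (P t u \<eta> - u \<eta>) * adj h \<eta> \<partial>N\<bar> \<le> E"
  shows "\<bar>(\<integral>\<eta>. (P T u \<eta> - u \<eta>) * h \<eta> \<partial>N) - T * (\<integral>\<eta>. u \<eta> * adj h \<eta> \<partial>N)\<bar> \<le> E * T"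
proof -
  note hb = blip_bdd[OF h]
  have iPh: "integrable N (\<lambda>\<eta>. P t u \<eta> * h \<eta>)" if "0 \<le> t" for t
    by (rule S.bdd_integrable[OF S.bdd_mult[OF P_bdd[OF that u] hb]])
  have iadj: "integrable N (\<lambda>\<eta>. f \<eta> * adj h \<eta>)" if "S.bdd f" for f
    using integrable_times_bdd[OF adj_integrable[OF h] that] by (simp add: mult.commute)
  define I where "I = (\<integral>\<eta>. u \<eta> * adj h \<eta> \<partial>N)"
  define H where "H t = (\<integral>\<eta>. P t u \<eta> * h \<eta> \<partial>N)" for t
  have H_diff: "H (t + s) - H t = (\<integral>\<eta>. (P s (P t u) \<eta> - P t u \<eta>) * h \<eta> \<partial>N)" if ts: "0 \<le> t" "0 \<le> s" for t s
  proof -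
    have Pst: "P (t + s) u = P s (P t u)" using P_add[OF ts(2,1) blipD(1)[OF u]] by (simp add: add.commute)
    have "H (t + s) - H t = (\<integral>\<eta>. P (t + s) u \<eta> * h \<eta> - P t u \<eta> * h \<eta> \<partial>N)"
      unfolding H_def using iPh[of "t + s"] iPh[of t] ts by simp
    then show ?thesis by (simp add: Pst left_diff_distrib)
  qed
  define c where "c = 3 * a0 * (C * exp (4 * a0 * T)) * (\<integral>\<eta>. mass \<eta> \<partial>N) * B"
  have "continuous_on {0..T} H"
  proof (rule right_lipschitz_continuous_on)
    show "((\<lambda>s. c * s) \<longlongrightarrow> 0) (at_right 0)" by (auto intro!: tendsto_eq_intros)
    fix t s :: real assume ts: "0 \<le> t" "0 < s" "t + s \<le> T"
    note v = blip_P[OF ts(1) u]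
    have bd: "S.bdd (\<lambda>\<eta>. P s (P t u) \<eta> - P t u \<eta>)"
      by (intro S.bdd_diff P_bdd[OF _ v] blip_bdd[OF v]) (use ts in simp)
    have "\<bar>H (t + s) - H t\<bar> \<le> (\<integral>\<eta>. \<bar>(P s (P t u) \<eta> - P t u \<eta>) * h \<eta>\<bar> \<partial>N)"
      using ts by (subst H_diff) (auto intro: integral_abs_bound)
    also have "\<dots> \<le> (\<integral>\<eta>. \<bar>P s (P t u) \<eta> - P t u \<eta>\<bar> * B \<partial>N)"
      using blipD(3)[OF h] S.bdd_integrable[OF S.bdd_abs[OF bd]] S.bdd_integrable[OF S.bdd_abs[OF S.bdd_mult[OF bd hb]]]
      by (intro integral_mono) (auto simp: abs_mult intro!: mult_left_mono)
    also have "\<dots> = (\<integral>\<eta>. \<bar>P s (P t u) \<eta> - P t u \<eta>\<bar> \<partial>N) * B" by simp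
    also have "\<dots> \<le> (3 * a0 * ((C * exp (4 * a0 * t)) * exp (4 * a0 * s)) * (\<integral>\<eta>. mass \<eta> \<partial>N) * s) * B"
      using small_time_integral[OF _ v, of s] ts blipD(5)[OF h] by (intro mult_right_mono) auto
    also have "(C * exp (4 * a0 * t)) * exp (4 * a0 * s) = C * exp (4 * a0 * (t + s))"
      by (simp add: exp_add distrib_left)
    also have "(3 * a0 * (C * exp (4 * a0 * (t + s))) * (\<integral>\<eta>. mass \<eta> \<partial>N) * s) * B
      \<le> (3 * a0 * (C * exp (4 * a0 * T)) * (\<integral>\<eta>. mass \<eta> \<partial>N) * s) * B"
      using ts a0_nonneg blipD(4)[OF u] blipD(5)[OF h] mult_left_mono[OF ts(3), of "4 * a0"]
      by (intro mult_right_mono mult_left_mono) auto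
    finally show "\<bar>H (t + s) - H t\<bar> \<le> c * s" by (simp add: c_def mult_ac)
  qed
  then have cont: "continuous_on {0..T} (\<lambda>t. H t - t * I)" by (intro continuous_intros)
  have "\<bar>(H T - T * I) - (H 0 - 0 * I)\<bar> \<le> E * T"
  proof (rule right_growth_bound[where D = "\<lambda>t. \<integral>\<eta>. (P t u \<eta> - u \<eta>) * adj h \<eta> \<partial>N", OF T cont _ E])
    fix t assume t: "0 \<le> t" "t < T"
    note v = blip_P[OF t(1) u]
    have "((\<lambda>s. (\<integral>\<eta>. (P s (P t u) \<eta> - P t u \<eta>) * h \<eta> \<partial>N) / s - I) \<longlongrightarrow> (\<integral>\<eta>. Lm (P t u) \<eta> * h \<eta> \<partial>N) - I) (at_right 0)"
      by (intro tendsto_diff tendsto_const Lm_limit[OF v hb])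
    also have "(\<integral>\<eta>. Lm (P t u) \<eta> * h \<eta> \<partial>N) - I = (\<integral>\<eta>. (P t u \<eta> - u \<eta>) * adj h \<eta> \<partial>N)"
      unfolding generator_duality[OF v h] I_def left_diff_distrib
      using iadj[OF P_bdd[OF t(1) u]] iadj[OF blip_bdd[OF u]] by simp
    finally show "((\<lambda>s. (H (t + s) - (t + s) * I - (H t - t * I)) / s) \<longlongrightarrow> (\<integral>\<eta>. (P t u \<eta> - u \<eta>) * adj h \<eta> \<partial>N)) (at_right 0)"
    proof (rule Lim_transform_eventually)
      have "(\<integral>\<eta>. (P s (P t u) \<eta> - P t u \<eta>) * h \<eta> \<partial>N) / s - I = (H (t + s) - (t + s) * I - (H t - t * I)) / s" if "0 < s" for s
        using H_diff[OF t(1) less_imp_le[OF that]] that by (simp add: field_simps)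
      then show "\<forall>\<^sub>F s in at_right 0. (\<integral>\<eta>. (P s (P t u) \<eta> - P t u \<eta>) * h \<eta> \<partial>N) / s - I = (H (t + s) - (t + s) * I - (H t - t * I)) / s"
        by (auto simp: eventually_at_right_field intro!: exI[of _ 1])
    qed
  qed
  also have "(H T - T * I) - (H 0 - 0 * I) = (\<integral>\<eta>. (P T u \<eta> - u \<eta>) * h \<eta> \<partial>N) - T * I"
    unfolding H_def left_diff_distrib
    using iPh[OF T] iPh[of 0] by (simp add: P_0[OF blipD(1)[OF u]])
  finally show ?thesis by (simp add: I_def)
qed

lemma blip_local:
  assumes "local_fun u" "\<And>\<eta>. \<bar>u \<eta>\<bar> \<le> B"
  obtains C where "blip C B (\<lambda>\<eta>. indicator (Omega' p) \<eta> * u \<eta>)"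
proof -
  have B0: "0 \<le> B" using assms(2)[of undefined] by linarith
  obtain C where "lip_bound p (\<lambda>\<eta>. indicator (Omega' p) \<eta> * u \<eta>) C" using local_fun_lip(2)[OF assms] by blast
  moreover have "\<bar>indicator (Omega' p) \<eta> * u \<eta>\<bar> \<le> B" for \<eta> using assms(2)[of \<eta>] B0 by (auto simp: indicator_def)
  ultimately show thesis using local_fun_lip(1)[OF assms] by (intro that[of C]) (simp add: blip_def)
qed

lemma blip_approx:
  assumes f: "f \<in> borel_measurable conf" "\<And>\<eta>. \<bar>f \<eta>\<bar> \<le> B" and e: "0 < e"
  obtains C u where "blip C B u" "(\<integral>\<eta>. \<bar>f \<eta> - u \<eta>\<bar> \<partial>N) < e"
proof -
  obtain v where v: "local_fun v" "\<And>\<eta>. \<bar>v \<eta>\<bar> \<le> B" "(\<integral>\<eta>. \<bar>f \<eta> - v \<eta>\<bar> \<partial>N) < e"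
    by (rule local_approx[OF N.finite_measure_axioms sets_N _ f(2) e]) (use f in auto)
  obtain C where C: "blip C B (\<lambda>\<eta>. indicator (Omega' p) \<eta> * v \<eta>)" by (rule blip_local[OF v(1,2)])
  have "(\<integral>\<eta>. \<bar>f \<eta> - indicator (Omega' p) \<eta> * v \<eta>\<bar> \<partial>N) = (\<integral>\<eta>. \<bar>f \<eta> - v \<eta>\<bar> \<partial>N)"
  proof (rule integral_cong_AE)
    show "AE \<eta> in N. \<bar>f \<eta> - indicator (Omega' p) \<eta> * v \<eta>\<bar> = \<bar>f \<eta> - v \<eta>\<bar>"
      using AE_Omega' by eventually_elim simp
  qed (use f(1) blip_measurable[OF C] local_fun_measurable[OF v(1)] in auto)
  with v(3) show thesis by (intro that[OF C]) simp
qed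

text \<open>
  The estimate for Lipschitz \<open>u\<close> depends on \<open>u\<close> only through \<open>L\<^sup>1\<close> norms and the bound \<open>M\<close>, and
  hence passes to the limit \<open>f\<close>.
\<close>
lemma weak_derivative:
  assumes f: "f \<in> borel_measurable conf" "\<And>\<eta>. \<bar>f \<eta>\<bar> \<le> M" and h: "blip D B h"
  shows "((\<lambda>t. (\<integral>\<eta>. (R t f \<eta> - f \<eta>) * h \<eta> \<partial>N) / t) \<longlongrightarrow> (\<integral>\<eta>. f \<eta> * adj h \<eta> \<partial>N)) (at_right 0)"
proof (rule tendstoI)
  fix e :: real assume e: "0 < e"
  have fb: "S.bdd f" using f by (intro S.bddI[of _ M]) auto
  note hb = blip_bdd[OF h]
  have M0: "0 \<le> M" using f(2)[of undefined] by linarith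
  have B0: "0 \<le> B" by (rule blipD(5)[OF h])
  obtain c where c: "0 \<le> c" "\<And>w. w \<in> borel_measurable N \<Longrightarrow> (AE \<eta> in N. \<bar>w \<eta>\<bar> \<le> 2 * M) \<Longrightarrow>
    \<bar>\<integral>\<eta>. w \<eta> * adj h \<eta> \<partial>N\<bar> \<le> c * (\<integral>\<eta>. \<bar>w \<eta>\<bar> \<partial>N) + e / 8"
    by (rule integral_times_small[OF adj_integrable[OF h], of "e / 8" "2 * M"]) (use e M0 in auto)
  have iadj: "integrable N (\<lambda>\<eta>. w \<eta> * adj h \<eta>)" if "S.bdd w" for w
    using integrable_times_bdd[OF adj_integrable[OF h] that] by (simp add: mult.commute)
  \<comment> \<open>Prepared for the bound \<open>5 * \<delta>\<close> on the L1 norm of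
    \<open>P t u - u\<close>: once \<delta> from \<open>v\<close>, and twice the distance
    \<open>2 * \<delta>\<close> between \<open>u\<close> and \<open>v\<close>.\<close>
  define \<delta> where "\<delta> = e / (40 * (c + 1))"
  have \<delta>: "0 < \<delta>" "5 * c * \<delta> \<le> e / 8"
    using e c(1) by (auto simp: \<delta>_def field_simps)
  \<comment> \<open>Transfers the small-time estimate from \<open>v\<close> to \<open>u\<close> by
    L1 contraction, whatever the Lipschitz constant of \<open>u\<close>.\<close>
  have l1: "(\<integral>\<eta>. \<bar>P t u \<eta> - u \<eta>\<bar> \<partial>N) \<le> (\<integral>\<eta>. \<bar>P t v \<eta> - v \<eta>\<bar> \<partial>N) + 2 * (\<integral>\<eta>. \<bar>u \<eta> - v \<eta>\<bar> \<partial>N)"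
    if t: "0 \<le> t" and u: "blip C M u" and v: "blip C' M v" for t u v C C'
  proof -
    have duv: "S.bdd (\<lambda>y. u y - v y)" by (intro S.bdd_diff blip_bdd[OF u] blip_bdd[OF v])
    have bs: "S.bdd (\<lambda>\<eta>. P t v \<eta> - v \<eta>)" "S.bdd (\<lambda>\<eta>. P t u \<eta> - u \<eta>)"
      by (intro S.bdd_diff P_bdd[OF t u] P_bdd[OF t v] blip_bdd[OF u] blip_bdd[OF v])+
    have "(\<integral>\<eta>. \<bar>P t u \<eta> - u \<eta>\<bar> \<partial>N) \<le> (\<integral>\<eta>. \<bar>P t v \<eta> - v \<eta>\<bar> + \<bar>R t (\<lambda>y. u y - v y) \<eta>\<bar> + \<bar>u \<eta> - v \<eta>\<bar> \<partial>N)"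
    proof (rule integral_mono_AE)
      show "integrable N (\<lambda>\<eta>. \<bar>P t u \<eta> - u \<eta>\<bar>)" by (rule S.bdd_integrable[OF S.bdd_abs[OF bs(2)]])
      show "integrable N (\<lambda>\<eta>. \<bar>P t v \<eta> - v \<eta>\<bar> + \<bar>R t (\<lambda>y. u y - v y) \<eta>\<bar> + \<bar>u \<eta> - v \<eta>\<bar>)"
        by (intro Bochner_Integration.integrable_add integrable_abs S.bdd_integrable[OF bs(1)] S.R_L2(4)[OF t S.bdd_L2[OF duv]] S.bdd_integrable[OF duv])
      show "AE \<eta> in N. \<bar>P t u \<eta> - u \<eta>\<bar> \<le> \<bar>P t v \<eta> - v \<eta>\<bar> + \<bar>R t (\<lambda>y. u y - v y) \<eta>\<bar> + \<bar>u \<eta> - v \<eta>\<bar>"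
        using R_eq_P[OF t blipD(1)[OF u]] R_eq_P[OF t blipD(1)[OF v]] S.R_diff[OF t blip_bdd[OF u] blip_bdd[OF v]]
        by eventually_elim linarith
    qed
    also have "\<dots> = (\<integral>\<eta>. \<bar>P t v \<eta> - v \<eta>\<bar> \<partial>N) + (\<integral>\<eta>. \<bar>R t (\<lambda>y. u y - v y) \<eta>\<bar> \<partial>N) + (\<integral>\<eta>. \<bar>u \<eta> - v \<eta>\<bar> \<partial>N)"
      using S.bdd_integrable[OF bs(1)] S.R_L2(4)[OF t S.bdd_L2[OF duv]] S.bdd_integrable[OF duv]
      by (simp add: Bochner_Integration.integrable_add)
    also have "\<dots> \<le> (\<integral>\<eta>. \<bar>P t v \<eta> - v \<eta>\<bar> \<partial>N) + 2 * (\<integral>\<eta>. \<bar>u \<eta> - v \<eta>\<bar> \<partial>N)"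
      using S.R_L1_contraction[OF t duv] by simp
    finally show ?thesis .
  qed
  \<comment> \<open>\<open>v\<close> is fixed before the time scale \<open>T0\<close>. The sharper
    approximant \<open>u\<close> below depends on \<open>T\<close>, and its Lipschitz constant may
    blow up as \<open>T\<close> tends to 0.\<close>
  obtain C0 v where v: "blip C0 M v" "(\<integral>\<eta>. \<bar>f \<eta> - v \<eta>\<bar> \<partial>N) < \<delta>"
    by (rule blip_approx[OF f \<delta>(1)])
  define c0 where "c0 = 3 * a0 * (C0 * exp (4 * a0)) * (\<integral>\<eta>. mass \<eta> \<partial>N)"
  have c0: "0 \<le> c0" using a0_nonneg blipD(4)[OF v(1)] by (simp add: c0_def)
  define T0 where "T0 = min 1 (\<delta> / (c0 + 1))"
  have T0: "0 < T0" "T0 \<le> 1" "c0 * T0 \<le> \<delta>"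
  proof -
    show "0 < T0" "T0 \<le> 1" using \<delta>(1) c0 by (auto simp: T0_def)
    have "c0 * T0 \<le> c0 * (\<delta> / (c0 + 1))" using c0 by (intro mult_left_mono) (auto simp: T0_def)
    also have "\<dots> \<le> \<delta>" using c0 \<delta>(1) by (simp add: field_simps)
    finally show "c0 * T0 \<le> \<delta>" .
  qed
  have vsmall: "(\<integral>\<eta>. \<bar>P t v \<eta> - v \<eta>\<bar> \<partial>N) \<le> \<delta>" if t: "0 \<le> t" "t \<le> T0" for t
  proof -
    have "(\<integral>\<eta>. \<bar>P t v \<eta> - v \<eta>\<bar> \<partial>N) \<le> 3 * a0 * (C0 * exp (4 * a0 * t)) * (\<integral>\<eta>. mass \<eta> \<partial>N) * t"
      by (rule small_time_integral[OF t(1) v(1)])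
    also have "\<dots> \<le> c0 * T0"
      unfolding c0_def using t T0 a0_nonneg blipD(4)[OF v(1)] mult_left_mono[of t 1 "4 * a0"]
      by (intro mult_mono mult_left_mono) auto
    finally show ?thesis using T0(3) by linarith
  qed
  have main: "\<bar>(\<integral>\<eta>. (R T f \<eta> - f \<eta>) * h \<eta> \<partial>N) / T - (\<integral>\<eta>. f \<eta> * adj h \<eta> \<partial>N)\<bar> < e" if T: "0 < T" "T \<le> T0" for T
  proof -
    have T0': "0 \<le> T" using T by simp
    \<comment> \<open>The accuracy has to be of order \<open>T\<close>, since the error will be
      divided by \<open>T\<close>.\<close>
    define r where "r = min \<delta> (T * e / (8 * (B + 1)))"
    have r: "0 < r" "r \<le> \<delta>" "2 * B * r \<le> T * e / 4"
    proof -
      show "0 < r" "r \<le> \<delta>" using \<delta>(1) T e B0 by (auto simp: r_def)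
      have "2 * B * r \<le> 2 * B * (T * e / (8 * (B + 1)))" using B0 by (intro mult_left_mono) (auto simp: r_def)
      also have "\<dots> \<le> T * e / 4" using B0 T e by (simp add: field_simps)
      finally show "2 * B * r \<le> T * e / 4" .
    qed
    obtain C u where u: "blip C M u" "(\<integral>\<eta>. \<bar>f \<eta> - u \<eta>\<bar> \<partial>N) < r"
      by (rule blip_approx[OF f r(1)])
    note ub = blip_bdd[OF u(1)] and vb = blip_bdd[OF v(1)]
    have fu: "S.bdd (\<lambda>\<eta>. f \<eta> - u \<eta>)" and fv: "S.bdd (\<lambda>\<eta>. f \<eta> - v \<eta>)" and uv: "S.bdd (\<lambda>\<eta>. u \<eta> - v \<eta>)"
      by (intro S.bdd_diff fb ub vb)+
    have uv2: "(\<integral>\<eta>. \<bar>u \<eta> - v \<eta>\<bar> \<partial>N) \<le> 2 * \<delta>"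
    proof -
      have "(\<integral>\<eta>. \<bar>u \<eta> - v \<eta>\<bar> \<partial>N) \<le> (\<integral>\<eta>. \<bar>f \<eta> - u \<eta>\<bar> + \<bar>f \<eta> - v \<eta>\<bar> \<partial>N)"
        using S.bdd_integrable[OF S.bdd_abs[OF fu]] S.bdd_integrable[OF S.bdd_abs[OF fv]] S.bdd_integrable[OF S.bdd_abs[OF uv]]
        by (intro integral_mono) auto
      also have "\<dots> = (\<integral>\<eta>. \<bar>f \<eta> - u \<eta>\<bar> \<partial>N) + (\<integral>\<eta>. \<bar>f \<eta> - v \<eta>\<bar> \<partial>N)"
        using S.bdd_integrable[OF S.bdd_abs[OF fu]] S.bdd_integrable[OF S.bdd_abs[OF fv]] by simp
      finally show ?thesis using u(2) v(2) r(2) by linarith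
    qed
    have A: "\<bar>(\<integral>\<eta>. (P T u \<eta> - u \<eta>) * h \<eta> \<partial>N) - T * (\<integral>\<eta>. u \<eta> * adj h \<eta> \<partial>N)\<bar> \<le> (e / 4) * T"
    proof (rule forward_estimate[OF u(1) h T0'])
      fix t assume t: "0 \<le> t" "t < T"
      have "\<bar>\<integral>\<eta>. (P t u \<eta> - u \<eta>) * adj h \<eta> \<partial>N\<bar> \<le> c * (\<integral>\<eta>. \<bar>P t u \<eta> - u \<eta>\<bar> \<partial>N) + e / 8"
      proof (rule c(2))
        show "(\<lambda>\<eta>. P t u \<eta> - u \<eta>) \<in> borel_measurable N" using S.bdd_measurable[OF P_bdd[OF t(1) u(1)]] S.bdd_measurable[OF ub] by simp
        show "AE \<eta> in N. \<bar>P t u \<eta> - u \<eta>\<bar> \<le> 2 * M"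
        proof (rule AE_I2)
          fix \<eta> show "\<bar>P t u \<eta> - u \<eta>\<bar> \<le> 2 * M" using P_bound[OF t(1) u(1), of \<eta>] blipD(3)[OF u(1), of \<eta>] by linarith
        qed
      qed
      also have "c * (\<integral>\<eta>. \<bar>P t u \<eta> - u \<eta>\<bar> \<partial>N) \<le> c * (5 * \<delta>)"
        using l1[OF t(1) u(1) v(1)] vsmall[OF t(1)] t T uv2 by (intro mult_left_mono c(1)) linarith
      finally show "\<bar>\<integral>\<eta>. (P t u \<eta> - u \<eta>) * adj h \<eta> \<partial>N\<bar> \<le> e / 4" using \<delta>(2) by simp
    qed
    have Bd: "\<bar>(\<integral>\<eta>. (R T f \<eta> - f \<eta>) * h \<eta> \<partial>N) - (\<integral>\<eta>. (P T u \<eta> - u \<eta>) * h \<eta> \<partial>N)\<bar> \<le> T * e / 4"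
    proof -
      note iRfu = S.R_L2(4)[OF T0' S.bdd_L2[OF fu]] and ifu = S.bdd_integrable[OF fu]
      have i1: "integrable N (\<lambda>\<eta>. (R T f \<eta> - f \<eta>) * h \<eta>)" "integrable N (\<lambda>\<eta>. (P T u \<eta> - u \<eta>) * h \<eta>)"
        by (intro integrable_times_bdd[OF _ hb] Bochner_Integration.integrable_diff S.R_L2(4)[OF T0' S.bdd_L2[OF fb]] S.bdd_integrable fb ub P_bdd[OF T0' u(1)])+
      have "\<bar>(\<integral>\<eta>. (R T f \<eta> - f \<eta>) * h \<eta> \<partial>N) - (\<integral>\<eta>. (P T u \<eta> - u \<eta>) * h \<eta> \<partial>N)\<bar>
        = \<bar>\<integral>\<eta>. (R T f \<eta> - f \<eta>) * h \<eta> - (P T u \<eta> - u \<eta>) * h \<eta> \<partial>N\<bar>" using i1 by simp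
      also have "\<dots> \<le> (\<integral>\<eta>. \<bar>(R T f \<eta> - f \<eta>) * h \<eta> - (P T u \<eta> - u \<eta>) * h \<eta>\<bar> \<partial>N)" by (rule integral_abs_bound)
      also have "\<dots> \<le> (\<integral>\<eta>. B * (\<bar>R T (\<lambda>y. f y - u y) \<eta>\<bar> + \<bar>f \<eta> - u \<eta>\<bar>) \<partial>N)"
      proof (rule integral_mono_AE)
        show "AE \<eta> in N. \<bar>(R T f \<eta> - f \<eta>) * h \<eta> - (P T u \<eta> - u \<eta>) * h \<eta>\<bar> \<le> B * (\<bar>R T (\<lambda>y. f y - u y) \<eta>\<bar> + \<bar>f \<eta> - u \<eta>\<bar>)"
          using R_eq_P[OF T0' blipD(1)[OF u(1)]] S.R_diff[OF T0' fb ub]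
        proof eventually_elim
          case (elim \<eta>)
          have "(R T f \<eta> - f \<eta>) * h \<eta> - (P T u \<eta> - u \<eta>) * h \<eta> = h \<eta> * (R T (\<lambda>y. f y - u y) \<eta> - (f \<eta> - u \<eta>))"
            unfolding elim by (simp add: algebra_simps)
          then show ?case
            using blipD(3)[OF h, of \<eta>] B0 abs_triangle_ineq4[of "R T (\<lambda>y. f y - u y) \<eta>" "f \<eta> - u \<eta>"]
            by (simp only: abs_mult) (intro mult_mono, auto)
        qed
      qed (use i1 iRfu ifu in auto)
      also have "\<dots> = B * ((\<integral>\<eta>. \<bar>R T (\<lambda>y. f y - u y) \<eta>\<bar> \<partial>N) + (\<integral>\<eta>. \<bar>f \<eta> - u \<eta>\<bar> \<partial>N))"
        using iRfu ifu by simp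
      also have "\<dots> \<le> B * (2 * r)"
        using S.R_L1_contraction[OF T0' fu] u(2) B0 by (intro mult_left_mono) auto
      finally show ?thesis using r(3) by simp
    qed
    have Cc: "\<bar>(\<integral>\<eta>. f \<eta> * adj h \<eta> \<partial>N) - (\<integral>\<eta>. u \<eta> * adj h \<eta> \<partial>N)\<bar> \<le> e / 4"
    proof -
      have "(\<integral>\<eta>. f \<eta> * adj h \<eta> \<partial>N) - (\<integral>\<eta>. u \<eta> * adj h \<eta> \<partial>N) = (\<integral>\<eta>. (f \<eta> - u \<eta>) * adj h \<eta> \<partial>N)"
        unfolding left_diff_distrib using iadj[OF fb] iadj[OF ub] by simp
      also have "\<bar>\<dots>\<bar> \<le> c * (\<integral>\<eta>. \<bar>f \<eta> - u \<eta>\<bar> \<partial>N) + e / 8"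
      proof (rule c(2)[OF S.bdd_measurable[OF fu]], rule AE_I2)
        fix \<eta> show "\<bar>f \<eta> - u \<eta>\<bar> \<le> 2 * M" using f(2)[of \<eta>] blipD(3)[OF u(1), of \<eta>] by linarith
      qed
      also have "c * (\<integral>\<eta>. \<bar>f \<eta> - u \<eta>\<bar> \<partial>N) \<le> c * (5 * \<delta>)"
        using u(2) r(2) \<delta>(1) by (intro mult_left_mono c(1)) linarith
      finally show ?thesis using \<delta>(2) by simp
    qed
    define X Y Z W where "X = (\<integral>\<eta>. (R T f \<eta> - f \<eta>) * h \<eta> \<partial>N)" and "Y = (\<integral>\<eta>. (P T u \<eta> - u \<eta>) * h \<eta> \<partial>N)"
      and "Z = (\<integral>\<eta>. u \<eta> * adj h \<eta> \<partial>N)" and "W = (\<integral>\<eta>. f \<eta> * adj h \<eta> \<partial>N)"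
    have "T * \<bar>W - Z\<bar> \<le> T * (e / 4)" using Cc T by (intro mult_left_mono) (auto simp: W_def Z_def)
    then have "\<bar>T * W - T * Z\<bar> \<le> T * (e / 4)" using T by (simp add: abs_mult right_diff_distrib[symmetric])
    moreover have "\<bar>Y - T * Z\<bar> \<le> T * e / 4" using A by (simp add: Y_def Z_def mult_ac)
    moreover have "\<bar>X - Y\<bar> \<le> T * e / 4" using Bd by (simp add: X_def Y_def)
    moreover have "0 < T * e" using T e by simp
    ultimately have "\<bar>X - T * W\<bar> < T * e" by (simp add: abs_if split: if_splits)
    then have "\<bar>X - T * W\<bar> / T < e" using T by (simp add: pos_divide_less_eq mult.commute)
    moreover have "X / T - W = (X - T * W) / T" using T by (simp add: field_simps)
    ultimately show ?thesis using T by (simp add: X_def W_def abs_divide)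
  qed
  show "\<forall>\<^sub>F t in at_right 0. dist ((\<integral>\<eta>. (R t f \<eta> - f \<eta>) * h \<eta> \<partial>N) / t) (\<integral>\<eta>. f \<eta> * adj h \<eta> \<partial>N) < e"
    unfolding eventually_at_right_field dist_real_def using main T0(1) by (intro exI[of _ T0]) auto
qed

text \<open>By \<open>R_product\<close> one function of \<open>t\<close> has two forms. With
  \<open>f * \<phi>\<close> evolving, which is not Lipschitz, the derivative needs
  \<open>weak_derivative\<close>; with \<open>f\<close> evolving and \<phi> absorbed by the test
  function, \<open>Lm_limit\<close> applies.\<close>

lemma invariant_density_identity:
  assumes \<phi>: "S.bdd \<phi>" and inv: "\<And>t f. 0 \<le> t \<Longrightarrow> S.bdd f \<Longrightarrow> (\<integral>x. R t f x * \<phi> x \<partial>N) = (\<integral>x. f x * \<phi> x \<partial>N)"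
    and f: "blip C M f" and h: "blip D B h"
  shows "(\<integral>\<eta>. f \<eta> * \<phi> \<eta> * adj h \<eta> \<partial>N) = (\<integral>\<eta>. Lm f \<eta> * (h \<eta> * \<phi> \<eta>) \<partial>N)"
proof -
  note fb = blip_bdd[OF f] and hb = blip_bdd[OF h]
  have f\<phi>: "S.bdd (\<lambda>\<eta>. f \<eta> * \<phi> \<eta>)" by (rule S.bdd_mult[OF fb \<phi>])
  then obtain K where K: "\<And>\<eta>. \<bar>f \<eta> * \<phi> \<eta>\<bar> \<le> K" by (auto simp: S.bdd_def)
  have eq: "(\<integral>\<eta>. (R t (\<lambda>\<eta>. f \<eta> * \<phi> \<eta>) \<eta> - f \<eta> * \<phi> \<eta>) * h \<eta> \<partial>N) = (\<integral>\<eta>. (P t f \<eta> - f \<eta>) * (h \<eta> * \<phi> \<eta>) \<partial>N)"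
    if t: "0 \<le> t" for t
  proof (rule integral_cong_AE)
    have "AE \<eta> in N. R t (\<lambda>y. f y * \<phi> y) \<eta> = R t f \<eta> * \<phi> \<eta>"
      by (rule S.R_product[OF t \<phi> fb]) (rule inv[OF t])
    then show "AE \<eta> in N. (R t (\<lambda>\<eta>. f \<eta> * \<phi> \<eta>) \<eta> - f \<eta> * \<phi> \<eta>) * h \<eta> = (P t f \<eta> - f \<eta>) * (h \<eta> * \<phi> \<eta>)"
      using R_eq_P[OF t blipD(1)[OF f]]
      by eventually_elim (simp add: algebra_simps)
    show "(\<lambda>\<eta>. (R t (\<lambda>\<eta>. f \<eta> * \<phi> \<eta>) \<eta> - f \<eta> * \<phi> \<eta>) * h \<eta>) \<in> borel_measurable N"
      by (intro borel_measurable_times borel_measurable_diff S.R_L2(2)[OF t S.bdd_L2[OF f\<phi>]] S.bdd_measurable fb \<phi> hb)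
    show "(\<lambda>\<eta>. (P t f \<eta> - f \<eta>) * (h \<eta> * \<phi> \<eta>)) \<in> borel_measurable N"
      by (intro borel_measurable_times borel_measurable_diff S.bdd_measurable P_bdd[OF t f] fb \<phi> hb)
  qed
  have "((\<lambda>t. (\<integral>\<eta>. (R t (\<lambda>\<eta>. f \<eta> * \<phi> \<eta>) \<eta> - f \<eta> * \<phi> \<eta>) * h \<eta> \<partial>N) / t) \<longlongrightarrow> (\<integral>\<eta>. f \<eta> * \<phi> \<eta> * adj h \<eta> \<partial>N)) (at_right 0)"
    by (rule weak_derivative[OF _ K h]) (use S.bdd_measurable[OF f\<phi>] in simp)
  moreover have "((\<lambda>t. (\<integral>\<eta>. (R t (\<lambda>\<eta>. f \<eta> * \<phi> \<eta>) \<eta> - f \<eta> * \<phi> \<eta>) * h \<eta> \<partial>N) / t) \<longlongrightarrow> (\<integral>\<eta>. Lm f \<eta> * (h \<eta> * \<phi> \<eta>) \<partial>N)) (at_right 0)"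
    by (rule Lim_transform_eventually[OF Lm_limit[OF f S.bdd_mult[OF hb \<phi>]]])
      (use eq in \<open>auto simp: eventually_at_right_field intro!: exI[of _ 1]\<close>)
  ultimately show ?thesis by (rule tendsto_unique[OF trivial_limit_at_right_real])
qed

end


section \<open>Extremality\<close>

lemma nstep_nonneg:
  assumes "\<And>z. 0 \<le> p z"
  shows "0 \<le> nstep p n x y"
  by (induction n arbitrary: x) (auto intro!: infsum_nonneg mult_nonneg_nonneg assms)

text \<open>A positive \<open>n\<close>-step probability contains a path of steps of positive
  probability, along which \<open>E\<close> is propagated.\<close>

lemma irreducible_walk_induct:
  assumes s: "irreducible_walk s" "\<And>z. 0 \<le> s z"
    and refl: "\<And>x. E x x" and trans: "\<And>x y z. E x z \<Longrightarrow> E z y \<Longrightarrow> E x y"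
    and step: "\<And>x y. 0 < s (y - x) \<Longrightarrow> E x y"
  shows "E x y"
proof -
  have "E x y" if "0 < nstep s n x y" for n
    using that
  proof (induction n arbitrary: x)
    case 0
    then show ?case by (cases "x = y") (auto intro: refl)
  next
    case (Suc n)
    have "\<exists>z. s (z - x) * nstep s n z y \<noteq> 0"
    proof (rule ccontr)
      assume "\<not> (\<exists>z. s (z - x) * nstep s n z y \<noteq> 0)"
      then have "(\<lambda>z. s (z - x) * nstep s n z y) = (\<lambda>_. 0)" by auto
      then show False using Suc.prems by simp
    qed
    then obtain z where "s (z - x) \<noteq> 0" "nstep s n z y \<noteq> 0" by auto
    then have "0 < s (z - x)" "0 < nstep s n z y"
      using s(2)[of "z - x"] nstep_nonneg[of s n z y, OF s(2)] by linarith+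
    then show ?case using Suc.IH step trans by blast
  qed
  then show ?thesis using s(1) by (auto simp: irreducible_walk_def)
qed

lemma infinite_sites: "infinite (UNIV :: 'd::finite site set)"
proof -
  have "inj (\<lambda>n::int. (\<chi> i. n) :: 'd site)" by (auto simp: inj_def vec_eq_iff)
  from finite_imageD[OF _ this] have "infinite (range (\<lambda>n::int. (\<chi> i. n) :: 'd site))"
    using infinite_UNIV_int by blast
  then show ?thesis by (rule infinite_super[OF subset_UNIV])
qed

context zero_range
begin

text \<open>The two cylinders differ by one particle less at \<open>y\<close> and one more at
  \<open>x\<close>, and a single move can achieve this in one way only.\<close>

lemma move_determined:
  assumes xy: "x \<noteq> y" "x \<in> S" "y \<in> S" and e: "1 \<le> e y" and \<eta>: "\<eta> \<in> cyl S e"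
    and m: "move u v \<eta> \<in> cyl S (move y x e)"
  shows "u = y \<and> v = x"
proof -
  have y: "\<eta> y = e y" "move u v \<eta> y = e y - 1" and x: "\<eta> x = e x" "move u v \<eta> x = Suc (e x)"
    using \<eta> m xy by (auto simp: cyl_def move_apply)
  have "u = y" using y e by (auto simp: move_apply split: if_splits)
  moreover have "v = x" using x by (auto simp: move_apply split: if_splits)
  ultimately show ?thesis by simp
qed

end

context zero_range_L2
begin

lemma integral_jump_point: "(\<integral>xy. of_bool (xy = ab) * (f xy :: real) \<partial>count_space UNIV) = f ab"
proof -
  have "(\<lambda>xy. of_bool (xy = ab) * f xy) = (\<lambda>xy. indicator {ab} xy *\<^sub>R f ab)" by (auto simp: indicator_def)
  then show ?thesis by simp
qed

text \<open>
  The only jump between the disjoint cylinders \<open>cyl S e\<close> and \<open>cyl S (move y x e)\<close> is the one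
  between \<open>y\<close> and \<open>x\<close>, so that it is isolated by \<open>invariant_density_identity\<close>.
\<close>
lemma exchange_cylinders:
  assumes \<phi>: "S.bdd \<phi>" and inv: "\<And>t f. 0 \<le> t \<Longrightarrow> S.bdd f \<Longrightarrow> (\<integral>x. R t f x * \<phi> x \<partial>N) = (\<integral>x. f x * \<phi> x \<partial>N)"
    and p: "0 < p (y - x)" and xy: "x \<noteq> y" and S: "finite S" "x \<in> S" "y \<in> S" and e: "1 \<le> e y"
  shows "g (Suc (e x)) * (\<integral>\<eta>. indicator (cyl S (move y x e)) \<eta> * \<phi> \<eta> \<partial>N)
    = g (e y) * (\<integral>\<eta>. indicator (cyl S e) \<eta> * \<phi> \<eta> \<partial>N)"
proof -
  define e' where "e' = move y x e"
  define f where "f \<eta> = indicator (Omega' p) \<eta> * (indicator (cyl S e) \<eta> :: real)" for \<eta>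
  define h where "h \<eta> = indicator (Omega' p) \<eta> * (indicator (cyl S e') \<eta> :: real)" for \<eta>
  obtain C where f: "blip C 1 f"
    using blip_local[OF local_fun_cyl[OF S(1)], of e 1] by (auto simp: f_def[abs_def] indicator_def)
  obtain D where h: "blip D 1 h"
    using blip_local[OF local_fun_cyl[OF S(1)], of e' 1] by (auto simp: h_def[abs_def] indicator_def)
  have e': "1 \<le> e' x" "move x y e' = e" "e' x = Suc (e x)"
    using e xy by (auto simp: e'_def move_move move_self) (auto simp: move_apply)
  have disj: "\<eta> \<notin> cyl S e'" if "\<eta> \<in> cyl S e" for \<eta>
  proof
    assume "\<eta> \<in> cyl S e'"
    then have "\<eta> x = e' x" "\<eta> x = e x" using that S(2) by (auto simp: cyl_def)
    then show False using e'(3) by simp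
  qed
  \<comment> \<open>On \<open>cyl S e\<close> the function \<open>h\<close> vanishes, so
    \<open>adj h\<close> sees only jumps into \<open>cyl S e'\<close>. The reversed jump from
    \<open>y\<close> to \<open>x\<close> carries the index \<open>(x, y - x)\<close>.\<close>
  have lhs: "AE \<eta> in N. f \<eta> * \<phi> \<eta> * adj h \<eta> = p (y - x) * g (e y) * (indicator (cyl S e) \<eta> * \<phi> \<eta>)"
    using AE_Omega'
  proof eventually_elim
    case (elim \<eta>)
    show ?case
    proof (cases "\<eta> \<in> cyl S e")
      case True
      have "adj_term h \<eta> ab = of_bool (ab = (x, y - x)) * (p (y - x) * g (e y))" for ab
      proof (cases "ab = (x, y - x)")
        case T: True
        have "\<eta> y = e y" using True S by (auto simp: cyl_def)
        moreover have "move y x \<eta> \<in> cyl S e'"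
          using move_in_cyl_iff[of y x S \<eta> e'] True xy S e e' calculation by simp
        ultimately show ?thesis
          using T elim disj[OF True] by (simp add: adj_term_def h_def move_mass(1))
      next
        case False
        obtain a b where ab: "ab = (a, b)" by (cases ab)
        have "move (a + b) a \<eta> \<notin> cyl S e'"
        proof
          assume "move (a + b) a \<eta> \<in> cyl S e'"
          then have "a + b = y" "a = x"
            using move_determined[OF xy S(2,3) e True, of "a + b" a] unfolding e'_def by blast+
          then have "a = x" "b = y - x" by auto
          then show False using False ab by simp
        qed
        then show ?thesis using False disj[OF True] by (simp add: ab adj_term_def h_def)
      qed
      then have "adj_term h \<eta> = (\<lambda>ab. of_bool (ab = (x, y - x)) * (p (y - x) * g (e y)))" by (rule ext)
      then have "adj h \<eta> = p (y - x) * g (e y)" unfolding adj_def by (simp only: integral_jump_point)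
      then show ?thesis using True elim by (simp add: f_def)
    qed (simp add: f_def)
  qed
  \<comment> \<open>The same index, now for the forward jump to \<open>y\<close> from
    \<open>x\<close>, where there are \<open>Suc (e x)\<close> particles.\<close>
  have rhs: "AE \<eta> in N. Lm f \<eta> * (h \<eta> * \<phi> \<eta>) = p (y - x) * g (Suc (e x)) * (indicator (cyl S e') \<eta> * \<phi> \<eta>)"
    using AE_Omega'
  proof eventually_elim
    case (elim \<eta>)
    show ?case
    proof (cases "\<eta> \<in> cyl S e'")
      case True
      then have ne: "\<eta> \<notin> cyl S e" using disj by blast
      have "jump_term f \<eta> ab = of_bool (ab = (x, y - x)) * (p (y - x) * g (Suc (e x)))" for ab
      proof (cases "ab = (x, y - x)")
        case T: True
        have "\<eta> x = Suc (e x)" using True S e'(3) by (auto simp: cyl_def)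
        moreover have "move x y \<eta> \<in> cyl S e"
          using move_in_cyl_iff[of x y S \<eta> e] True xy S e calculation by (simp add: e'_def)
        ultimately show ?thesis
          using T elim ne by (simp add: jump_term_def f_def move_mass(1))
      next
        case False
        obtain a b where ab: "ab = (a, b)" by (cases ab)
        have "move a (a + b) \<eta> \<notin> cyl S e"
        proof
          assume "move a (a + b) \<eta> \<in> cyl S e"
          then have "move a (a + b) \<eta> \<in> cyl S (move x y e')" by (simp only: e'(2))
          then have "a = x" "a + b = y"
            using move_determined[OF xy(1)[symmetric] S(3,2) e'(1) True, of a "a + b"] by blast+
          then have "a = x" "b = y - x" by auto
          then show False using False ab by simp
        qed
        then show ?thesis using False ne by (simp add: ab jump_term_def f_def)
      qed
      then have "jump_term f \<eta> = (\<lambda>ab. of_bool (ab = (x, y - x)) * (p (y - x) * g (Suc (e x))))" by (rule ext)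
      then have "generator g p f \<eta> = p (y - x) * g (Suc (e x))"
        unfolding generator_eq[OF blipD(2)[OF f] elim] by (simp only: integral_jump_point)
      then have "Lm f \<eta> = p (y - x) * g (Suc (e x))" using elim by (simp add: Lm_def)
      then show ?thesis using True elim by (simp add: h_def)
    qed (simp add: h_def)
  qed
  have m: "(\<lambda>\<eta>. indicator (cyl S e'') \<eta> * \<phi> \<eta>) \<in> borel_measurable N" for e''
    using S.bdd_measurable[OF \<phi>] cyl_sets[OF S(1)] by simp
  have "(\<integral>\<eta>. p (y - x) * g (e y) * (indicator (cyl S e) \<eta> * \<phi> \<eta>) \<partial>N) = (\<integral>\<eta>. f \<eta> * \<phi> \<eta> * adj h \<eta> \<partial>N)"
  proof (rule integral_cong_AE[symmetric, OF _ _ lhs])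
    show "(\<lambda>\<eta>. f \<eta> * \<phi> \<eta> * adj h \<eta>) \<in> borel_measurable N"
      by (intro borel_measurable_times S.bdd_measurable[OF blip_bdd[OF f]] S.bdd_measurable[OF \<phi>] borel_measurable_integrable[OF adj_integrable[OF h]])
  qed (intro borel_measurable_times borel_measurable_const m)
  also have "\<dots> = (\<integral>\<eta>. Lm f \<eta> * (h \<eta> * \<phi> \<eta>) \<partial>N)"
    by (rule invariant_density_identity[OF \<phi> inv f h])
  also have "\<dots> = (\<integral>\<eta>. p (y - x) * g (Suc (e x)) * (indicator (cyl S e') \<eta> * \<phi> \<eta>) \<partial>N)"
  proof (rule integral_cong_AE[OF _ _ rhs])
    show "(\<lambda>\<eta>. Lm f \<eta> * (h \<eta> * \<phi> \<eta>)) \<in> borel_measurable N"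
      by (intro borel_measurable_times S.bdd_measurable[OF blip_bdd[OF h]] S.bdd_measurable[OF \<phi>] borel_measurable_integrable[OF Lm_integrable[OF f]])
  qed (intro borel_measurable_times borel_measurable_const m)
  finally show ?thesis using p by (simp add: e'_def)
qed

text \<open>Nothing is known about independence under \<open>Q\<close>; the density bound
  \<open>c\<close> transfers the L1 law of large numbers from \<open>N\<close>, uniformly in the
  event \<open>A\<close>.\<close>

lemma cylinder_average:
  assumes Q: "prob_space Q" "sets Q = sets conf" and dens: "Q = density N (\<lambda>\<eta>. ennreal (\<phi> \<eta>))"
    "\<phi> \<in> borel_measurable conf" "\<And>\<eta>. 0 \<le> \<phi> \<eta>" "\<And>\<eta>. \<phi> \<eta> \<le> c"
    and Y: "finite Y" "Y \<noteq> {}" and A: "A \<in> sets conf"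
  shows "\<bar>(\<Sum>y\<in>Y. measure Q (A \<inter> {\<eta>. \<eta> y = j})) / real (card Y) - q j * measure Q A\<bar> \<le> c / sqrt (real (card Y))"
proof -
  interpret Q: prob_space Q by fact
  have mQ [measurable_cong]: "sets Q = sets conf" by fact
  define X where "X \<eta> = (\<Sum>y\<in>Y. of_bool (\<eta> y = j)) / real (card Y) - q j" for \<eta> :: "'d config"
  have c0: "0 \<le> c" using dens(3)[of undefined] dens(4)[of undefined] by linarith
  have Xm [measurable]: "X \<in> borel_measurable conf" unfolding X_def[abs_def] by measurable
  have sy: "{\<eta>. \<eta> y = j} \<in> sets conf" for y :: "'d site"
    using cyl_sets[of "{y}" "\<lambda>_. j"] by (simp add: cyl_def)
  have AQ: "A \<in> sets Q" "A \<inter> {\<eta>. \<eta> y = j} \<in> sets Q" for y using A sy Q(2) by auto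
  have ii: "integrable Q (indicator B :: _ \<Rightarrow> real)" if "B \<in> sets Q" for B
    using that by (auto simp: Q.emeasure_eq_measure)
  have "indicator A \<eta> * X \<eta> = (\<Sum>y\<in>Y. indicator (A \<inter> {\<eta>. \<eta> y = j}) \<eta>) / real (card Y) - q j * indicator A \<eta>" for \<eta>
    by (simp add: X_def indicator_def)
  then have eq: "(\<integral>\<eta>. indicator A \<eta> * X \<eta> \<partial>Q) = (\<Sum>y\<in>Y. measure Q (A \<inter> {\<eta>. \<eta> y = j})) / real (card Y) - q j * measure Q A"
    using ii AQ sets.sets_into_space[OF AQ(1)]
    by (simp add: Bochner_Integration.integral_sum Bochner_Integration.integrable_sum Int_absorb2 sets.Int_space_eq2)
  have Xb: "S.bdd X"
  proof (rule S.bddI[of _ 2])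
    fix \<eta>
    have "(\<Sum>y\<in>Y. of_bool (\<eta> y = j)) \<le> (\<Sum>y\<in>Y. 1 :: real)" by (intro sum_mono) auto
    then have "(\<Sum>y\<in>Y. of_bool (\<eta> y = j)) / real (card Y) \<le> 1" using Y by (simp add: pos_divide_le_eq card_gt_0_iff)
    moreover have "0 \<le> (\<Sum>y\<in>Y. of_bool (\<eta> y = j)) / real (card Y)" by (intro divide_nonneg_nonneg sum_nonneg) auto
    moreover have "0 \<le> q j" "q j \<le> 1" by (auto simp: pmf_le_1)
    ultimately show "\<bar>X \<eta>\<bar> \<le> 2" unfolding X_def by linarith
  qed simp
  have \<phi>b: "S.bdd \<phi>" by (rule S.bddI[of _ c]) (use dens in auto)
  have "\<bar>\<integral>\<eta>. indicator A \<eta> * X \<eta> \<partial>Q\<bar> = \<bar>\<integral>\<eta>. \<phi> \<eta> * (indicator A \<eta> * X \<eta>) \<partial>N\<bar>"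
    unfolding dens(1) using dens A by (subst integral_density) auto
  also have "\<dots> \<le> (\<integral>\<eta>. \<bar>\<phi> \<eta> * (indicator A \<eta> * X \<eta>)\<bar> \<partial>N)" by (rule integral_abs_bound)
  also have "\<dots> \<le> (\<integral>\<eta>. c * \<bar>X \<eta>\<bar> \<partial>N)"
  proof (rule integral_mono)
    have "S.bdd (\<lambda>\<eta>. indicator A \<eta>)" by (rule S.bddI[of _ 1]) (use A in \<open>auto simp: indicator_def\<close>)
    then show "integrable N (\<lambda>\<eta>. \<bar>\<phi> \<eta> * (indicator A \<eta> * X \<eta>)\<bar>)"
      by (intro S.bdd_integrable S.bdd_abs S.bdd_mult \<phi>b Xb)
    show "integrable N (\<lambda>\<eta>. c * \<bar>X \<eta>\<bar>)" by (intro S.bdd_integrable S.bdd_cmult S.bdd_abs Xb)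
    show "\<bar>\<phi> \<eta> * (indicator A \<eta> * X \<eta>)\<bar> \<le> c * \<bar>X \<eta>\<bar>" for \<eta>
      using dens(3)[of \<eta>] dens(4)[of \<eta>] by (auto simp: abs_mult indicator_def intro!: mult_right_mono)
  qed
  also have "\<dots> = c * (\<integral>\<eta>. \<bar>X \<eta>\<bar> \<partial>N)" by simp
  also have "\<dots> \<le> c * (1 / sqrt (real (card Y)))"
    using weak_law[OF Y, of j] c0 unfolding X_def by (intro mult_left_mono)
  finally show ?thesis unfolding eq by simp
qed

theorem dominated_invariant_eq:
  assumes irr: "irreducible_walk (symmetrized p)"
    and Q: "prob_space Q" "sets Q = sets conf" and inv: "invariant_measure R Q"
    and c: "0 \<le> c" "\<And>A. A \<in> sets conf \<Longrightarrow> measure Q A \<le> c * measure N A"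
  shows "Q = N"
proof -
  interpret Q: prob_space Q by fact
  have mQ [measurable_cong]: "sets Q = sets conf" by fact
  have spQ: "space Q = UNIV" using sets_eq_imp_space_eq[OF Q(2)] by simp
  obtain \<phi> where \<phi>: "\<phi> \<in> borel_measurable N" "\<And>x. 0 \<le> \<phi> x" "\<And>x. \<phi> x \<le> c" and dens: "Q = density N (\<lambda>x. ennreal (\<phi> x))"
    by (rule bounded_density[OF N.finite_measure_axioms Q.finite_measure_axioms _ c(1)]) (use Q(2) c(2) in auto)
  have \<phi>m [measurable]: "\<phi> \<in> borel_measurable conf" using \<phi>(1) by simp
  have \<phi>b: "S.bdd \<phi>" by (rule S.bddI[of _ c]) (use \<phi> in auto)
  have intQ: "(\<integral>\<eta>. w \<eta> \<partial>Q) = (\<integral>\<eta>. w \<eta> * \<phi> \<eta> \<partial>N)" if "w \<in> borel_measurable N" for w :: "'d config \<Rightarrow> real"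
    unfolding dens using that \<phi> by (subst integral_density) (auto simp: mult.commute)
  have inv\<phi>: "(\<integral>x. R t f x * \<phi> x \<partial>N) = (\<integral>x. f x * \<phi> x \<partial>N)" if t: "0 \<le> t" and f: "S.bdd f" for t f
  proof -
    have "f \<in> borel_measurable Q" "\<exists>B. \<forall>x\<in>space Q. \<bar>f x\<bar> \<le> B"
      using f by (auto simp: S.bdd_def cong: measurable_cong_sets)
    then have "(\<integral>x. R t f x \<partial>Q) = (\<integral>x. f x \<partial>Q)" using inv t by (simp add: invariant_measure_def)
    then show ?thesis by (simp only: intQ[OF S.R_L2(2)[OF t S.bdd_L2[OF f]]] intQ[OF S.bdd_measurable[OF f]])
  qed
  have mcyl: "measure Q (cyl S e) = (\<integral>\<eta>. indicator (cyl S e) \<eta> * \<phi> \<eta> \<partial>N)" if "finite S" for S e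
  proof -
    have "measure Q (cyl S e) = (\<integral>\<eta>. indicator (cyl S e) \<eta> \<partial>Q)" by (simp add: spQ)
    also have "\<dots> = (\<integral>\<eta>. indicator (cyl S e) \<eta> * \<phi> \<eta> \<partial>N)"
      by (rule intQ) (use cyl_sets[OF that] in simp)
    finally show ?thesis .
  qed
  have gfin: "(\<integral>\<^sup>+\<eta>. ennreal (g (\<eta> y)) \<partial>Q) < \<infinity>" for y
  proof -
    have "(\<integral>\<^sup>+\<eta>. ennreal (g (\<eta> y)) \<partial>Q) = (\<integral>\<^sup>+\<eta>. ennreal (\<phi> \<eta>) * ennreal (g (\<eta> y)) \<partial>N)"
      unfolding dens by (rule nn_integral_density) (use \<phi> in auto)
    also have "\<dots> \<le> (\<integral>\<^sup>+\<eta>. ennreal c * ennreal (g (\<eta> y)) \<partial>N)"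
      using \<phi> by (intro nn_integral_mono mult_right_mono ennreal_leI) auto
    also have "\<dots> = ennreal c * (\<integral>\<^sup>+\<eta>. ennreal (g (\<eta> y)) \<partial>N)" by (rule nn_integral_cmult) simp
    also have "\<dots> \<le> ennreal c * ennreal (a0 * m1)" by (intro mult_left_mono nn_integral_g) simp
    also have "\<dots> < \<infinity>" by (simp add: ennreal_mult_less_top)
    finally show ?thesis .
  qed
  have edge: "exchange g Q x y" if p: "0 < p (y - x)" for x y
  proof (cases "x = y")
    case False
    show ?thesis
      by (rule exchange_cylI[OF Q.finite_measure_axioms Q(2) gfin False])
        (simp add: mcyl exchange_cylinders[OF \<phi>b inv\<phi> p False])
  qed (simp add: exchange_refl)
  \<comment> \<open>By symmetry of the relation an edge may be used against the direction of
    \<open>p\<close>, so connectedness through the symmetrized law suffices.\<close>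
  have ex: "exchange g Q x y" for x y
  proof (rule irreducible_walk_induct[OF irr])
    show "0 \<le> symmetrized p z" for z by (simp add: symmetrized_def)
    fix x y assume "0 < symmetrized p (y - x)"
    then have "0 < p (y - x) \<or> 0 < p (x - y)"
      using p_nonneg[of "y - x"] p_nonneg[of "x - y"] by (auto simp: symmetrized_def)
    then show "exchange g Q x y" using edge exchange_sym by blast
  qed (use exchange_refl exchange_trans in blast)+
  have mecke: "g (Suc (e x)) * measure Q (cyl S (e(x := Suc (e x)))) = \<psi> * measure Q (cyl S e)"
    if S: "finite S" "x \<in> S" for S x and e :: "'d config"
  proof -
    define A where "A = cyl S (e(x := Suc (e x)))"
    define B where "B = cyl S e"
    have AB: "A \<in> sets conf" "B \<in> sets conf" using cyl_sets[OF S(1)] by (auto simp: A_def B_def)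
    \<comment> \<open>Exchange with a site \<open>y\<close> outside \<open>S\<close> that holds
      exactly one particle: after this particle has moved to \<open>x\<close>, the site
      \<open>y\<close> is empty.\<close>
    have one: "g (Suc (e x)) * measure Q (A \<inter> {\<eta>. \<eta> y = 0}) = g 1 * measure Q (B \<inter> {\<eta>. \<eta> y = 1})" if y: "y \<notin> S" for y
    proof -
      have xy: "x \<noteq> y" using S y by auto
      have "g (Suc ((e(y := 1)) x)) * measure Q (cyl (insert y S) (move y x (e(y := 1)))) = g ((e(y := 1)) y) * measure Q (cyl (insert y S) (e(y := 1)))"
        by (rule exchange_cylD[OF ex Q.finite_measure_axioms Q(2) xy]) (use S in auto)
      moreover have "cyl (insert y S) (move y x (e(y := 1))) = A \<inter> {\<eta>. \<eta> y = 0}"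
        using y xy S by (auto simp: cyl_def A_def move_apply)
      moreover have "cyl (insert y S) (e(y := 1)) = B \<inter> {\<eta>. \<eta> y = 1}"
        using y by (auto simp: cyl_def B_def)
      ultimately show ?thesis using xy by simp
    qed
    \<comment> \<open>\<open>d\<close> does not involve \<open>Y\<close>, yet the averaging error
      over any \<open>Suc n\<close> sites outside \<open>S\<close> bounds it; hence it is 0.\<close>
    define d where "d = g (Suc (e x)) * (q 0 * measure Q A) - g 1 * (q 1 * measure Q B)"
    define k where "k = g (Suc (e x)) * c + g 1 * c"
    have k0: "0 \<le> k" using c(1) by (simp add: k_def)
    have dk: "\<bar>d\<bar> \<le> k / sqrt (real (Suc n))" for n
    proof -
      have "infinite (- S)" using S(1) infinite_sites by (simp add: Compl_eq_Diff_UNIV)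
      then obtain Y where Y: "finite Y" "card Y = Suc n" "Y \<subseteq> - S" using infinite_arbitrarily_large by blast
      then have Yne: "Y \<noteq> {}" by auto
      define a b where "a = (\<Sum>y\<in>Y. measure Q (A \<inter> {\<eta>. \<eta> y = 0})) / real (card Y)"
        and "b = (\<Sum>y\<in>Y. measure Q (B \<inter> {\<eta>. \<eta> y = 1})) / real (card Y)"
      have "g (Suc (e x)) * (\<Sum>y\<in>Y. measure Q (A \<inter> {\<eta>. \<eta> y = 0})) = g 1 * (\<Sum>y\<in>Y. measure Q (B \<inter> {\<eta>. \<eta> y = 1}))"
        unfolding sum_distrib_left using Y(3) by (intro sum.cong one) auto
      then have ab: "g (Suc (e x)) * a = g 1 * b" by (simp add: a_def b_def)
      have 1: "\<bar>a - q 0 * measure Q A\<bar> \<le> c / sqrt (real (card Y))" and 2: "\<bar>b - q 1 * measure Q B\<bar> \<le> c / sqrt (real (card Y))"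
        unfolding a_def b_def using \<phi> by (auto intro!: cylinder_average[OF Q dens \<phi>m] Y Yne AB)
      have "d = g 1 * (b - q 1 * measure Q B) - g (Suc (e x)) * (a - q 0 * measure Q A)"
        using ab by (simp add: d_def algebra_simps)
      also have "\<bar>\<dots>\<bar> \<le> g 1 * \<bar>b - q 1 * measure Q B\<bar> + g (Suc (e x)) * \<bar>a - q 0 * measure Q A\<bar>"
        by (rule order_trans[OF abs_triangle_ineq4]) (simp add: abs_mult)
      also have "\<dots> \<le> g 1 * (c / sqrt (real (card Y))) + g (Suc (e x)) * (c / sqrt (real (card Y)))"
        by (intro add_mono mult_left_mono 1 2) auto
      also have "\<dots> = k / sqrt (real (Suc n))" by (simp add: k_def Y(2) add_divide_distrib)
      finally show ?thesis .
    qed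
    have "(\<lambda>n. k / sqrt (real (Suc n))) \<longlonglongrightarrow> 0"
      by (intro tendsto_divide_0[OF tendsto_const] filterlim_at_top_imp_at_infinity filterlim_compose[OF sqrt_at_top]
          filterlim_compose[OF filterlim_real_sequentially filterlim_Suc])
    then have "\<bar>d\<bar> \<le> 0" by (rule LIMSEQ_le_const) (use dk in auto)
    then have "g (Suc (e x)) * (q 0 * measure Q A) = (g 1 * q 1) * measure Q B" by (simp add: d_def mult_ac)
    \<comment> \<open>Here the fugacity enters the relation for \<open>Q\<close>, through the
      empirical frequencies that \<open>Q\<close> shares with \<open>N\<close>.\<close>
    also have "g 1 * q 1 = \<psi> * q 0" using \<kappa>_detailed_balance[OF \<psi>, of 0] by simp
    finally have "q 0 * (g (Suc (e x)) * measure Q A) = q 0 * (\<psi> * measure Q B)" by (simp add: mult_ac)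
    then show ?thesis using \<kappa>_0_pos[OF \<psi>] by (simp add: A_def B_def)
  qed
  have meckeN: "g (Suc (e x)) * measure N (cyl S (e(x := Suc (e x)))) = \<psi> * measure N (cyl S e)"
    if S: "finite S" "x \<in> S" for S x and e :: "'d config"
  proof -
    have "(\<Prod>z\<in>S - {x}. q ((e(x := Suc (e x))) z)) = (\<Prod>z\<in>S - {x}. q (e z))" by (intro prod.cong) auto
    then have "measure N (cyl S (e(x := Suc (e x)))) = q (Suc (e x)) * (\<Prod>z\<in>S - {x}. q (e z))"
      using S by (simp add: measure_N_cyl prod.remove)
    moreover have "measure N (cyl S e) = q (e x) * (\<Prod>z\<in>S - {x}. q (e z))"
      using S by (simp add: measure_N_cyl prod.remove)
    ultimately show ?thesis using \<kappa>_detailed_balance[OF \<psi>, of "e x"] by (simp add: mult.assoc[symmetric])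
  qed
  show "Q = N"
  proof (rule cylinder_measure_eqI[where ?S0.0 = "{}"])
    fix S :: "'d site set" and e :: "'d config" assume S: "finite S"
    define r where "r = measure Q (cyl S (\<lambda>_. 0)) / measure N (cyl S (\<lambda>_. 0))"
    have N0: "0 < measure N (cyl S (\<lambda>_. 0))"
      using \<kappa>_0_pos[OF \<psi>] S by (simp add: measure_N_cyl)
    \<comment> \<open>\<open>mecke\<close> and \<open>meckeN\<close> are the same recursion, so on
      cylinders over \<open>S\<close> the measures are proportional, by induction on the number of
      particles in \<open>S\<close>.\<close>
    have ratio: "measure Q (cyl S e) = r * measure N (cyl S e)" for e
    proof (induction "\<Sum>z\<in>S. e z" arbitrary: e)
      case 0
      then have "cyl S e = cyl S (\<lambda>_. 0)" using S by (auto simp: cyl_def)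
      then show ?case using N0 by (simp add: r_def)
    next
      case (Suc n)
      then have "(\<Sum>z\<in>S. e z) \<noteq> 0" by simp
      then obtain x where x: "x \<in> S" "e x \<noteq> 0" using S by auto
      define e0 where "e0 = e(x := e x - 1)"
      have ee: "e = e0(x := Suc (e0 x))" using x by (auto simp: e0_def)
      have "(\<Sum>z\<in>S. e z) = e x + (\<Sum>z\<in>S - {x}. e z)" "(\<Sum>z\<in>S. e0 z) = e0 x + (\<Sum>z\<in>S - {x}. e0 z)"
        using S x by (auto intro: sum.remove)
      moreover have "(\<Sum>z\<in>S - {x}. e0 z) = (\<Sum>z\<in>S - {x}. e z)" by (intro sum.cong) (auto simp: e0_def)
      ultimately have "n = (\<Sum>z\<in>S. e0 z)" using Suc.hyps(2) x by (simp add: e0_def)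
      then have IH: "measure Q (cyl S e0) = r * measure N (cyl S e0)" by (rule Suc.hyps(1))
      have "g (Suc (e0 x)) * measure Q (cyl S e) = \<psi> * (r * measure N (cyl S e0))"
        using mecke[OF S x(1), of e0] ee IH by simp
      also have "\<dots> = r * (\<psi> * measure N (cyl S e0))" by simp
      also have "\<dots> = g (Suc (e0 x)) * (r * measure N (cyl S e))"
        using meckeN[OF S x(1), of e0] ee by simp
      finally show ?case using gpos[of "Suc (e0 x)"] by simp
    qed
    have r0: "0 \<le> r" by (simp add: r_def)
    \<comment> \<open>Normalization fixes the factor, as the cylinders over \<open>S\<close>
      partition the space.\<close>
    have "1 = emeasure Q UNIV" using Q.emeasure_space_1 spQ by simp
    also have "\<dots> = (\<integral>\<^sup>+\<zeta>. emeasure Q (cyl S \<zeta>) \<partial>count_space (range (restr S) \<inter> UNIV))"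
      by (rule emeasure_cyl_partition[OF Q(2) S]) simp
    also have "\<dots> = (\<integral>\<^sup>+\<zeta>. ennreal r * emeasure N (cyl S \<zeta>) \<partial>count_space (range (restr S) \<inter> UNIV))"
      by (simp add: Q.emeasure_eq_measure N.emeasure_eq_measure ratio ennreal_mult r0)
    also have "\<dots> = ennreal r * (\<integral>\<^sup>+\<zeta>. emeasure N (cyl S \<zeta>) \<partial>count_space (range (restr S) \<inter> UNIV))"
      by (rule nn_integral_cmult) simp
    also have "\<dots> = ennreal r * emeasure N UNIV"
      by (subst emeasure_cyl_partition[OF sets_N S, of UNIV]) auto
    also have "\<dots> = ennreal r" using N.emeasure_space_1 by simp
    finally have "r = 1" using r0 by (metis ennreal_1 ennreal_inj zero_le_one)
    then show "emeasure Q (cyl S e) = emeasure N (cyl S e)"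
      by (simp add: Q.emeasure_eq_measure N.emeasure_eq_measure ratio)
  qed (use Q(2) Q.finite_measure_axioms in auto)
qed

end

text \<open>The mixture is given on sets but needed for images under the semigroup, which are merely
  square integrable. Bounded densities ensure integrability under both components, and uniqueness of
  densities makes their convex combination 1 almost everywhere.\<close>

lemma integral_convex_combination:
  fixes w :: "'a \<Rightarrow> real"
  assumes N: "prob_space N" and Q: "prob_space Q1" "prob_space Q2" "sets Q1 = sets N" "sets Q2 = sets N"
    and \<epsilon>: "0 < \<epsilon>" "\<epsilon> < 1"
    and mix: "\<And>A. A \<in> sets N \<Longrightarrow> measure N A = \<epsilon> * measure Q1 A + (1 - \<epsilon>) * measure Q2 A"
    and w: "integrable N w"
  shows "(\<integral>x. w x \<partial>N) = \<epsilon> * (\<integral>x. w x \<partial>Q1) + (1 - \<epsilon>) * (\<integral>x. w x \<partial>Q2)"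
proof -
  interpret N: prob_space N by fact
  interpret Q1: prob_space Q1 by fact
  interpret Q2: prob_space Q2 by fact
  have le1: "measure Q1 A \<le> 1 / \<epsilon> * measure N A" if "A \<in> sets N" for A
  proof -
    have "0 \<le> (1 - \<epsilon>) * measure Q2 A" using \<epsilon> by simp
    then have "\<epsilon> * measure Q1 A \<le> measure N A" using mix[OF that] by linarith
    then show ?thesis using \<epsilon> by (simp add: pos_le_divide_eq mult.commute)
  qed
  have le2: "measure Q2 A \<le> 1 / (1 - \<epsilon>) * measure N A" if "A \<in> sets N" for A
  proof -
    have "0 \<le> \<epsilon> * measure Q1 A" using \<epsilon> by simp
    then have "(1 - \<epsilon>) * measure Q2 A \<le> measure N A" using mix[OF that] by linarith
    then show ?thesis using \<epsilon> by (simp add: pos_le_divide_eq mult.commute)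
  qed
  obtain f1 where f1: "f1 \<in> borel_measurable N" "\<And>x. 0 \<le> f1 x" "\<And>x. f1 x \<le> 1 / \<epsilon>" "Q1 = density N (\<lambda>x. ennreal (f1 x))"
    by (rule bounded_density[OF N.finite_measure_axioms Q1.finite_measure_axioms Q(3) _ le1]) (use \<epsilon> in auto)
  obtain f2 where f2: "f2 \<in> borel_measurable N" "\<And>x. 0 \<le> f2 x" "\<And>x. f2 x \<le> 1 / (1 - \<epsilon>)" "Q2 = density N (\<lambda>x. ennreal (f2 x))"
    by (rule bounded_density[OF N.finite_measure_axioms Q2.finite_measure_axioms Q(4) _ le2]) (use \<epsilon> in auto)
  note [measurable] = f1(1) f2(1)
  have "density N (\<lambda>x. ennreal (\<epsilon> * f1 x + (1 - \<epsilon>) * f2 x)) = density N (\<lambda>_. 1)"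
  proof (rule measure_eqI)
    fix A assume "A \<in> sets (density N (\<lambda>x. ennreal (\<epsilon> * f1 x + (1 - \<epsilon>) * f2 x)))"
    then have A [measurable]: "A \<in> sets N" by simp
    have "emeasure (density N (\<lambda>x. ennreal (\<epsilon> * f1 x + (1 - \<epsilon>) * f2 x))) A
      = (\<integral>\<^sup>+x. ennreal \<epsilon> * (ennreal (f1 x) * indicator A x) + ennreal (1 - \<epsilon>) * (ennreal (f2 x) * indicator A x) \<partial>N)"
      using f1(2) f2(2) \<epsilon>
      by (subst emeasure_density) (auto intro!: nn_integral_cong simp: ennreal_mult distrib_right mult.assoc)
    also have "\<dots> = ennreal \<epsilon> * emeasure Q1 A + ennreal (1 - \<epsilon>) * emeasure Q2 A"
      unfolding f1(4) f2(4) by (subst nn_integral_add) (auto simp: nn_integral_cmult emeasure_density)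
    also have "\<dots> = ennreal (measure N A)"
      using \<epsilon> by (simp add: Q1.emeasure_eq_measure Q2.emeasure_eq_measure mix[OF A] ennreal_mult)
    finally show "emeasure (density N (\<lambda>x. ennreal (\<epsilon> * f1 x + (1 - \<epsilon>) * f2 x))) A = emeasure (density N (\<lambda>_. 1)) A"
      by (simp add: N.emeasure_eq_measure density_1)
  qed simp
  then have "AE x in N. ennreal (\<epsilon> * f1 x + (1 - \<epsilon>) * f2 x) = 1"
    by (intro N.density_unique) auto
  then have one: "AE x in N. \<epsilon> * f1 x + (1 - \<epsilon>) * f2 x = 1"
    by eventually_elim (simp add: ennreal_eq_1)
  have wm [measurable]: "w \<in> borel_measurable N" using w by (rule borel_measurable_integrable)
  have i1: "integrable N (\<lambda>x. f1 x * w x)"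
  proof (rule Bochner_Integration.integrable_bound[OF integrable_mult_right[OF w, of "1 / \<epsilon>"]], measurable, rule AE_I2)
    fix x
    have "f1 x * \<bar>w x\<bar> \<le> 1 / \<epsilon> * \<bar>w x\<bar>" by (intro mult_right_mono f1) simp
    then show "norm (f1 x * w x) \<le> norm (1 / \<epsilon> * w x)" using f1(2)[of x] \<epsilon> by (simp add: abs_mult)
  qed
  have i2: "integrable N (\<lambda>x. f2 x * w x)"
  proof (rule Bochner_Integration.integrable_bound[OF integrable_mult_right[OF w, of "1 / (1 - \<epsilon>)"]], measurable, rule AE_I2)
    fix x
    have "f2 x * \<bar>w x\<bar> \<le> 1 / (1 - \<epsilon>) * \<bar>w x\<bar>" by (intro mult_right_mono f2) simp
    then show "norm (f2 x * w x) \<le> norm (1 / (1 - \<epsilon>) * w x)" using f2(2)[of x] \<epsilon> by (simp add: abs_mult)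
  qed
  have "(\<integral>x. w x \<partial>N) = (\<integral>x. \<epsilon> * (f1 x * w x) + (1 - \<epsilon>) * (f2 x * w x) \<partial>N)"
  proof (rule integral_cong_AE)
    show "AE x in N. w x = \<epsilon> * (f1 x * w x) + (1 - \<epsilon>) * (f2 x * w x)"
      using one
    proof eventually_elim
      case (elim x)
      have "\<epsilon> * (f1 x * w x) + (1 - \<epsilon>) * (f2 x * w x) = (\<epsilon> * f1 x + (1 - \<epsilon>) * f2 x) * w x" by (simp add: algebra_simps)
      then show ?case by (simp only: elim mult_1)
    qed
  qed measurable
  also have "\<dots> = \<epsilon> * (\<integral>x. f1 x * w x \<partial>N) + (1 - \<epsilon>) * (\<integral>x. f2 x * w x \<partial>N)" using i1 i2 by simp
  also have "(\<integral>x. f1 x * w x \<partial>N) = (\<integral>x. w x \<partial>Q1)"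
    unfolding f1(4) using f1 by (subst integral_density) auto
  also have "(\<integral>x. f2 x * w x \<partial>N) = (\<integral>x. w x \<partial>Q2)"
    unfolding f2(4) using f2 by (subst integral_density) auto
  finally show ?thesis .
qed

theorem theorem8p4p1:
  fixes g :: "nat \<Rightarrow> real" and a0 :: real
    and p :: "int ^ 'd::finite \<Rightarrow> real"
    and \<rho> \<epsilon> :: real
    and P P\<rho> :: "real \<Rightarrow> ((int ^ 'd \<Rightarrow> nat) \<Rightarrow> real) \<Rightarrow> (int ^ 'd \<Rightarrow> nat) \<Rightarrow> real"
    and Q1 Q2 :: "(int ^ 'd \<Rightarrow> nat) measure"
  assumes "g 0 = 0" and "\<And>k. 1 \<le> k \<Longrightarrow> 0 < g k" and "\<And>k. \<bar>g (k + 1) - g k\<bar> \<le> a0"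
    and "jump_law p" and "irreducible_walk p"
    and "irreducible_walk (symmetrized p)"
    and "0 \<le> \<rho>" and "ereal \<rho> < rho_star g"
    and "zero_range_semigroup g a0 p P"
    and "L2_extension p (\<nu> g \<rho>) P P\<rho>"
    and "0 < \<epsilon>" and "\<epsilon> < 1"
    and "prob_space Q1" and "sets Q1 = sets (\<nu> g \<rho>)" and "invariant_measure P\<rho> Q1"
    and "prob_space Q2" and "sets Q2 = sets (\<nu> g \<rho>)" and "invariant_measure P\<rho> Q2"
    and "\<And>A. A \<in> sets (\<nu> g \<rho>) \<Longrightarrow>
           measure (\<nu> g \<rho>) A = \<epsilon> * measure Q1 A + (1 - \<epsilon>) * measure Q2 A"
  shows "Q1 = \<nu> g \<rho> \<and> Q2 = \<nu> g \<rho>"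
proof -
  interpret positive_rate g by unfold_locales (use assms(1,2) in auto)
  interpret E: zero_range_equilibrium g p a0 P "\<Psi> g \<rho>"
    by unfold_locales (use assms Psi_fugacity in auto)
  have \<nu>: "\<nu> g \<rho> = E.N" by (simp add: \<nu>_def E.N_def)
  note ext = assms(10)[unfolded \<nu>] and mix = assms(19)[unfolded \<nu>]
  have s1: "sets Q1 = sets conf" and s2: "sets Q2 = sets conf" using assms(14,17) by (simp_all add: \<nu>)
  have le1: "measure Q1 A \<le> 1 / \<epsilon> * measure E.N A" if "A \<in> sets conf" for A
  proof -
    have "0 \<le> (1 - \<epsilon>) * measure Q2 A" using assms(12) by simp
    then have "\<epsilon> * measure Q1 A \<le> measure E.N A" using mix[of A] that by (simp only: E.sets_N)
    then show ?thesis using assms(11) by (simp add: pos_le_divide_eq mult.commute)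
  qed
  have le2: "measure Q2 A \<le> 1 / (1 - \<epsilon>) * measure E.N A" if "A \<in> sets conf" for A
  proof -
    have "0 \<le> \<epsilon> * measure Q1 A" using assms(11) by simp
    then have "(1 - \<epsilon>) * measure Q2 A \<le> measure E.N A" using mix[of A] that by (simp only: E.sets_N)
    then show ?thesis using assms(12) by (simp add: pos_le_divide_eq mult.commute)
  qed
  \<comment> \<open>The image of a bounded function is square integrable, hence integrable, as
    \<open>integral_convex_combination\<close> requires; stationarity of the mixture then follows
    from that of its components.\<close>
  interpret zero_range_L2 g p a0 P "\<Psi> g \<rho>" P\<rho>
  proof unfold_locales
    show "L2_extension p E.N P P\<rho>" by (rule ext)
    fix t B :: real and f :: "'d observable" assume t: "0 \<le> t" and f: "f \<in> borel_measurable conf" and B: "\<And>x. \<bar>f x\<bar> \<le> B"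
    have fN: "f \<in> borel_measurable E.N" using f by simp
    have if2: "integrable E.N (\<lambda>x. (f x)\<^sup>2)"
      by (rule E.N.integrable_const_bound[of _ "B\<^sup>2"]) (use B f in \<open>auto intro!: power2_le_iff_abs_le[THEN iffD2] order_trans[OF abs_ge_zero B]\<close>)
    have "f \<in> L2 E.N" using fN if2 by (simp add: L2_def)
    then have "P\<rho> t f \<in> L2 E.N"
      using ext[unfolded L2_extension_def L2_markov_semigroup_def, THEN conjunct1, THEN conjunct1] t by blast
    then have "P\<rho> t f \<in> borel_measurable E.N" "integrable E.N (\<lambda>x. (P\<rho> t f x)\<^sup>2)" unfolding L2_def by blast+
    then have iR: "integrable E.N (P\<rho> t f)" by (rule E.N.square_integrable_imp_integrable)
    have if1: "integrable E.N f" by (rule E.N.square_integrable_imp_integrable[OF fN if2])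
    have inv: "(\<integral>x. P\<rho> t f x \<partial>Q) = (\<integral>x. f x \<partial>Q)" if "invariant_measure P\<rho> Q" "sets Q = sets conf" for Q
    proof -
      have "f \<in> borel_measurable Q" using f that(2) by (simp cong: measurable_cong_sets)
      moreover have "\<exists>B. \<forall>x\<in>space Q. \<bar>f x\<bar> \<le> B" using B by blast
      ultimately show ?thesis using that(1) t unfolding invariant_measure_def by blast
    qed
    note comb = integral_convex_combination[OF E.N.prob_space_axioms assms(13,16) _ _ assms(11,12) mix]
    show "(\<integral>x. P\<rho> t f x \<partial>E.N) = (\<integral>x. f x \<partial>E.N)"
      using comb[OF _ _ _ iR] comb[OF _ _ _ if1] s1 s2 inv[OF assms(15) s1] inv[OF assms(18) s2] by simp
  qed
  have "Q1 = E.N"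
    by (rule dominated_invariant_eq[OF assms(6,13) s1 assms(15) _ le1]) (use assms(11) in auto)
  moreover have "Q2 = E.N"
    by (rule dominated_invariant_eq[OF assms(6,16) s2 assms(18) _ le2]) (use assms(12) in auto)
  ultimately show ?thesis by (simp add: \<nu>)
qed

end
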